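(* Let $\tau\in\mathbb{H}$, let $r\ge 1$, and let $k_1,\dots,k_r\ge 2$ be integers with $k_1+\cdots+k_r=k$. Then, for all $z\in\mathbb{C}\setminus L_\tau$, \begin{align*} \wp_{k_1,\dots,k_r}(z;\tau) =&\sum_{i=1}^{r}\sum_{\substack{n_1,\dots,n_r\geq 2\\ n_1+\cdots+n_r=k}}(-1)^{k_i+n_{i}+\cdots+n_r}\prod_{\substack{j=1\\ j\neq i}}^{r}\binom{n_j-1}{k_j-1} \widetilde{G}_{n_{i-1},\dots,n_1}(\tau)\,\widetilde{G}_{n_{i+1},\dots,n_r}(\tau)\,\bigl(\wp_{n_i}(z;\tau)-G_{n_i}(\tau)\bigr) \\ &+\sum_{i=1}^{r}\sum_{\substack{n_1,\dots,n_r\geq 0\\ n_1+\cdots+n_r=k\\ n_i=0}}(-1)^{k_i+n_{i+1}+\cdots+n_r}\prod_{\substack{j=1\\ j\neq i}}^{r}\binom{n_j-1}{k_j-1} \widetilde{G}_{n_{i-1},\dots,n_1}(\tau)\,\widetilde{G}_{n_{i+1},\dots,n_r}(\tau) \\ &+\sum_{i=0}^{r}(-1)^{k_{i+1}+\cdots+k_r}\,\widetilde{G}_{k_{i},\dots,k_1}(\tau)\,\widetilde{G}_{k_{i+1},\dots,k_r}(\tau). \end{align*}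
   Context: $\mathbb{H}$ is the upper half-plane, $L_\tau=\mathbb{Z}\tau+\mathbb{Z}$, $\mathbb{Z}_N=\{n\in\mathbb{Z}: |n|<N\}$, and $\mathbb{Z}_M\tau+\mathbb{Z}_N=\{m\tau+n: m\in\mathbb{Z}_M,\ n\in\mathbb{Z}_N\}$. The total order $\prec$ on $L_\tau$ is: $m_1\tau+n_1\prec m_2\tau+n_2$ iff $m_1<m_2$, or $m_1=m_2$ and $n_1<n_2$. For integers $k_1,\dots,k_r\ge2$ define $$\wp_{k_1,\dots,k_r}(z;\tau)=\lim_{M\to\infty}\lim_{N\to\infty}\sum_{\substack{w_1,\dots,w_r\in\mathbb{Z}_M\tau+\mathbb{Z}_N\\ w_1\prec\dots\prec w_r}}\frac{1}{(z-w_1)^{k_1}\cdots(z-w_r)^{k_r}},$$ $$\widetilde{G}_{k_1,\dots,k_r}(\tau)=\lim_{M\to\infty}\lim_{N\to\infty}\sum_{\substack{w_1,\dots,w_r\in\mathbb{Z}_M\tau+\mathbb{Z}_N\\ 0\prec w_1\prec\dots\prec w_r}}\frac{1}{w_1^{k_1}\cdots w_r^{k_r}},$$ and for $k\ge2$, $G_k(\tau)=\lim_{M\to\infty}\lim_{N\to\infty}\sum_{(m,n)\in\mathbb{Z}_M\times\mathbb{Z}_N,\,(m,n)\ne(0,0)}(m\tau+n)^{-k}$ (so $G_k=2\widetilde{G}_k$ for $k$ even and $G_k=0$ for $k$ odd). The empty index ($r=0$) gives $\wp_\emptyset=\widetilde{G}_\emptyset=1$. Convention: a binomial coefficient $\binom{n-1}{k-1}$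 with $0\le n<k$ is $0$ (also for $n=0$), so terms in which $\widetilde{G}$ would formally have an index entry less than $2$ do not occur. *)

theory Defs
  imports "HOL-Complex_Analysis.Complex_Analysis"
begin

definition period_lattice :: "complex \<Rightarrow> complex set" where
  "period_lattice \<tau> = {of_int m * \<tau> + of_int n | m n :: int. True}"

definition int_box :: "nat \<Rightarrow> int set" where
  "int_box N = {n. \<bar>n\<bar> < int N}"

definition lattice_box :: "complex \<Rightarrow> nat \<Rightarrow> nat \<Rightarrow> complex set" where
  "lattice_box \<tau> M N = {of_int m * \<tau> + of_int n | m n. m \<in> int_box M \<and> n \<in> int_box N}"

(* Meaningful for non-real tau, where the coordinates m, n of a lattice point are unique. *)
definition lattice_less :: "complex \<Rightarrow> complex \<Rightarrow> complex \<Rightarrow> bool" where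
  "lattice_less \<tau> u v \<longleftrightarrow>
     (\<exists>m1 n1 m2 n2 :: int. u = of_int m1 * \<tau> + of_int n1 \<and> v = of_int m2 * \<tau> + of_int n2 \<and>
        (m1 < m2 \<or> m1 = m2 \<and> n1 < n2))"

(* An index (k_1, ..., k_r) is a list; a chain w_1 < ... < w_r is a list of the same length,
   strictly sorted by the lattice order. For the empty list the only chain is the
   empty one, so that both multi_wp and multi_G are 1 there. *)
definition multi_wp :: "nat list \<Rightarrow> complex \<Rightarrow> complex \<Rightarrow> complex" where
  "multi_wp ks z \<tau> =
     lim (\<lambda>M. lim (\<lambda>N.
       \<Sum>ws | length ws = length ks \<and> set ws \<subseteq> lattice_box \<tau> M N \<and>
             sorted_wrt (lattice_less \<tau>) ws.
         1 / (\<Prod>j<length ks. (z - ws ! j) ^ (ks ! j))))"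

definition multi_G :: "nat list \<Rightarrow> complex \<Rightarrow> complex" where
  "multi_G ks \<tau> =
     lim (\<lambda>M. lim (\<lambda>N.
       \<Sum>ws | length ws = length ks \<and> set ws \<subseteq> lattice_box \<tau> M N \<and>
             sorted_wrt (lattice_less \<tau>) (0 # ws).
         1 / (\<Prod>j<length ks. (ws ! j) ^ (ks ! j))))"

definition Eisenstein_G :: "nat \<Rightarrow> complex \<Rightarrow> complex" where
  "Eisenstein_G k \<tau> =
     lim (\<lambda>M. lim (\<lambda>N.
       \<Sum>(m, n) \<in> int_box M \<times> int_box N - {(0, 0)}. 1 / (of_int m * \<tau> + of_int n) ^ k))"

(* The product of the binomial coefficients (n_j - 1 choose k_j - 1) over j in {1..r} - {i}.
   Since k_j >= 2, truncated subtraction gives the value 0 also for n_j = 0, so every term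
   with some n_j < k_j vanishes whatever the value of its multi_G factors. *)
definition binom_prod :: "nat \<Rightarrow> (nat \<Rightarrow> nat) \<Rightarrow> (nat \<Rightarrow> nat) \<Rightarrow> nat \<Rightarrow> complex" where
  "binom_prod r k n i = (\<Prod>j\<in>{1..r} - {i}. of_nat ((n j - 1) choose (k j - 1)))"

end

theory Submission
  imports Defs
begin

text \<open>
Fix a chain of lattice points w_1, ..., w_r, increasing in the order of the lattice. The product of
the (z - w_j)^(- k_j) is the sum of its principal parts, and expanding the other factors at w_i
shows that the coefficient of (z - w_i)^(- \<nu>) is a sum over the compositions n of K with
n_i = \<nu>, of binomial coefficients times the product over j \<noteq> i of (w_i - w_j)^(- n_j). At the
argument 0 the same expansion holds, except that when some w_i is 0 its own principal part is left
out and the value is replaced by the constant coefficient at w_i, which is the sum with n_i = 0.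
Subtracting the two expansions (chain_expansion) writes the product at z as its value at 0, plus a
contribution of the chains through 0, plus a combination of the differences (z - w_i)^(- n_i) - (- w_i)^(- n_i).

Now sum over all chains with points in the rows -M < m < M. The weight of w_i only involves the
differences w_i - w_j, so for w_i in row m it sums to a product of two independent sums over chains
above 0, one with rows below m + M and one with rows below M - m (chain_split_has_sum). Each tends
to a multiple Eisenstein series: a row at height m contributes O(m^(-2)), even for a single
exponent 2, because the sum of the (m \<tau> + l)^(-2) over l differs from a telescoping sum by
O(m^(-2)). For the same reason the differences above have row sums O(m^(-2)) for every n_i \<ge> 1, so
dominated convergence gives the limit M \<rightarrow> \<infinity>. The terms with n_i \<ge> 2 yield the
functions \<wp> - G of weight n_i, those with n_i = 0 come from the chains through 0, and the values
at 0 of the chains that avoid 0, cut at 0, form the last sum of the theorem.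

There remain the terms with n_i = 1, whose total coefficient is the sum of the residues of the
multiple function modulo the lattice. It vanishes (residues_cancel): for a single chain the residues add up
to 0, since the product is O(z^(-2)) at infinity. Summing this over the chains up to horizontal
translation makes the sum over the rows -M < m < M of the truncated coefficients 0 for every M, and
the average of these coefficients over the rows tends to the coefficient in question.

The partial fraction decomposition itself is the vanishing of the sum of the residues, for the points
together with the argument as one more point (partial_fractions).
\<close>

(* The dollar sign is to denote coefficients of power series only. *)
unbundle no vec_syntax

section \<open>Partial fractions of a product of powers\<close>

text \<open>Parts may be 0. The functions are extensional, so that there are only finitely many.\<close>

definition compositions :: "'a set \<Rightarrow> nat \<Rightarrow> ('a \<Rightarrow> nat) set" where
  "compositions J K = {n \<in> J \<rightarrow>\<^sub>E UNIV. sum n J = K}"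

lemma finite_compositions:
  assumes "finite J" shows "finite (compositions J K)"
proof -
  have "n \<in> J \<rightarrow>\<^sub>E {..K}" if "n \<in> compositions J K" for n
    using that assms member_le_sum[of _ J n] by (auto simp: compositions_def PiE_iff)
  then have "compositions J K \<subseteq> J \<rightarrow>\<^sub>E {..K}" by blast
  then show ?thesis using assms by (meson finite_PiE finite_atMost finite_subset)
qed

text \<open>The multisets of size K on J are the compositions of K, by their counting functions.\<close>

lemma fps_prod_nth_compositions:
  fixes f :: "'a \<Rightarrow> 'b :: comm_ring_1 fps"
  assumes "finite J"
  shows "(\<Prod>j\<in>J. f j) $ K = (\<Sum>n\<in>compositions J K. \<Prod>j\<in>J. f j $ n j)"
proof -
  have "(\<Sum>X\<in>multisets_of_size J K. \<Prod>x\<in>J. f x $ count X x)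
      = (\<Sum>n\<in>compositions J K. \<Prod>j\<in>J. f j $ n j)"
  proof (rule sum.reindex_bij_witness[where
        j = "\<lambda>X. restrict (count X) J"
        and i = "\<lambda>n. Abs_multiset (\<lambda>x. if x \<in> J then n x else 0)"], goal_cases)
    case (1 X)
    then show ?case
      by (auto simp: multisets_of_size_def multiset_eq_iff count_Abs_multiset assms
          simp flip: not_in_iff)
  next
    case (2 X)
    then show ?case
      by (auto simp: multisets_of_size_def compositions_def size_multiset_overloaded_eq assms
          intro!: sum.mono_neutral_right simp flip: not_in_iff)
  next
    case (3 n)
    then show ?case
      by (auto simp: compositions_def fun_eq_iff count_Abs_multiset assms PiE_iff extensional_def)
  next
    case (4 n)
    have c: "count (Abs_multiset (\<lambda>x. if x \<in> J then n x else 0)) = (\<lambda>x. if x \<in> J then n x else 0)"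
      by (subst count_Abs_multiset) (auto simp: assms)
    have s: "set_mset (Abs_multiset (\<lambda>x. if x \<in> J then n x else 0)) \<subseteq> J"
      by (auto simp: set_mset_def c split: if_splits)
    have "size (Abs_multiset (\<lambda>x. if x \<in> J then n x else 0)) = sum n J"
      unfolding size_multiset_overloaded_eq c
      using s assms by (intro sum.mono_neutral_cong_left) (auto simp: set_mset_def c)
    with 4 s show ?case by (auto simp: multisets_of_size_def compositions_def)
  next
    case (5 X)
    then show ?case by (auto intro!: prod.cong)
  qed
  then show ?thesis using fps_prod_nth'[OF assms, of f K] by simp
qed

text \<open>The power (X / (X + a))^k is the expansion at 0 of (X + a)^(- k) moved up by k degrees. With this shift the
coefficient of degree n carries exactly a^(- n), and the degrees of a product of such series add up
to the total exponent K.\<close>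

definition shifted_pole :: "complex \<Rightarrow> complex fps" where
  "shifted_pole a = fps_X * inverse (fps_X + fps_const a)"

lemma fps_X_plus_const_neq_0: "fps_X + fps_const a \<noteq> (0 :: complex fps)"
proof
  assume "fps_X + fps_const a = 0"
  from arg_cong[OF this, of "\<lambda>f. f $ 1"] show False by simp
qed

lemma shifted_pole_mult:
  assumes "a \<noteq> 0"
  shows "(fps_X + fps_const a) * shifted_pole a = fps_X"
proof -
  have "(fps_X + fps_const a) $ 0 \<noteq> 0" using assms by simp
  from inverse_mult_eq_1[OF this] show ?thesis
    unfolding shifted_pole_def by (metis mult.commute mult.left_commute mult.right_neutral)
qed

lemma nat_cases_0_1_Suc: "(n = 0 \<Longrightarrow> P) \<Longrightarrow> (n = 1 \<Longrightarrow> P) \<Longrightarrow> (\<And>m. n = Suc (Suc m) \<Longrightarrow> P) \<Longrightarrow> P"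
  by (cases n; cases "n - 1") auto

lemma shifted_pole_nth:
  assumes "a \<noteq> 0"
  shows "shifted_pole a $ n = (if n = 0 then 0 else (-1) ^ (n - 1) / a ^ n)"
proof -
  define g where "g = Abs_fps (\<lambda>n. if n = 0 then 0 else (-1) ^ (n - 1) / a ^ n)"
  have "(fps_X + fps_const a) * g = fps_X"
  proof (rule fps_ext)
    fix n
    have g0: "g $ 0 = 0" and gS: "g $ Suc m = (-1) ^ m / a ^ Suc m" for m
      by (simp_all add: g_def)
    have "((fps_X + fps_const a) * g) $ n = (if n = 0 then 0 else g $ (n - 1)) + a * g $ n"
      by (simp add: distrib_right)
    then show "((fps_X + fps_const a) * g) $ n = fps_X $ n"
      using assms by (cases n rule: nat_cases_0_1_Suc) (simp_all add: g0 gS)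
  qed
  then have "(fps_X + fps_const a) * g = (fps_X + fps_const a) * shifted_pole a"
    using shifted_pole_mult[OF assms] by simp
  then have "g = shifted_pole a" using fps_X_plus_const_neq_0[of a] by (metis mult_left_cancel)
  then have "shifted_pole a $ n = g $ n" by simp
  then show ?thesis by (simp add: g_def)
qed

lemma shifted_pole_power_nth:
  assumes "a \<noteq> 0" "k \<ge> 1" "n \<ge> 1"
  shows "(shifted_pole a ^ k) $ n = (-1) ^ (n + k) * of_nat ((n - 1) choose (k - 1)) / a ^ n"
  using assms(2,3)
proof (induction k arbitrary: n rule: nat_induct_at_least)
  case base
  then show ?case using assms(1) shifted_pole_nth[OF assms(1), of n]
    by (cases n) auto
next
  case (Suc k)
  define g where "g = Abs_fps (\<lambda>n. if n = 0 then 0 else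
     (-1) ^ (n + Suc k) * of_nat ((n - 1) choose k) / a ^ n)"
  have z: "(shifted_pole a ^ k) $ 0 = 0"
    using Suc.hyps shifted_pole_nth[OF assms(1), of 0]
    by (simp add: fps_power_zeroth)
  have "(fps_X + fps_const a) * g = fps_X * shifted_pole a ^ k"
  proof (rule fps_ext)
    fix n
    show "((fps_X + fps_const a) * g) $ n = (fps_X * shifted_pole a ^ k) $ n"
    proof (cases "n \<le> 1")
      case True
      then have "n = 0 \<or> n = 1" by auto
      then show ?thesis using z Suc.hyps by (auto simp: g_def distrib_right binomial_eq_0)
    next
      case False
      then obtain m where m: "n = Suc (Suc m)" by (cases n rule: nat_cases_0_1_Suc) auto
      obtain l where l: "k = Suc l" using Suc.hyps by (cases k) auto
      have "((fps_X + fps_const a) * g) $ n = g $ (Suc m) + a * g $ n"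
        by (simp add: distrib_right m)
      also have "\<dots> = (-1) ^ (Suc m + k) * of_nat (m choose l) / a ^ Suc m"
        using assms(1) by (simp add: g_def m l field_simps)
      also have "\<dots> = (shifted_pole a ^ k) $ Suc m"
        using Suc.IH[of "Suc m"] by (simp add: l)
      finally show ?thesis by (simp add: m)
    qed
  qed
  also have "\<dots> = (fps_X + fps_const a) * shifted_pole a ^ Suc k"
    using shifted_pole_mult[OF assms(1)] by (simp add: mult.assoc[symmetric])
  finally have "(fps_X + fps_const a) * g = (fps_X + fps_const a) * shifted_pole a ^ Suc k" .
  then have "g = shifted_pole a ^ Suc k" using fps_X_plus_const_neq_0[of a] by (metis mult_left_cancel)
  then have "(shifted_pole a ^ Suc k) $ n = g $ n" by simp
  then show ?case using Suc.prems by (simp add: g_def)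
qed

lemma shifted_pole_power_nth_less:
  assumes "n < k" shows "(shifted_pole a ^ k) $ n = 0"
proof -
  have "shifted_pole a ^ k = fps_X ^ k * inverse (fps_X + fps_const a) ^ k"
    by (simp add: shifted_pole_def power_mult_distrib)
  then show ?thesis using assms by (simp add: fps_X_power_mult_nth)
qed

text \<open>Up to the factor X raised to the sum of the other exponents, this is the Taylor series at w i of the
product of the (z - w j)^(- k j) with j \<noteq> i. Hence its coefficient of degree sum k J - \<nu> is the
coefficient of (z - w i)^(- \<nu>) in the Laurent series of the full product.\<close>

definition pole_cofactor :: "'a set \<Rightarrow> ('a \<Rightarrow> complex) \<Rightarrow> ('a \<Rightarrow> nat) \<Rightarrow> 'a \<Rightarrow> complex fps" where
  "pole_cofactor J w k i = (\<Prod>j\<in>J - {i}. shifted_pole (w i - w j) ^ k j)"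

text \<open>Multiplying the product by z - w j lowers the exponent of its j-th factor by 1.\<close>

lemma pole_cofactor_split:
  assumes "finite J" "j \<in> J" "j \<noteq> i" "k j \<ge> 1" "w i \<noteq> w j"
  shows "(fps_X + fps_const (w i - w j)) * pole_cofactor J w k i
       = fps_X * pole_cofactor J w (k(j := k j - 1)) i"
proof -
  have 1: "pole_cofactor J w k' i = shifted_pole (w i - w j) ^ k' j
       * (\<Prod>l\<in>J - {i} - {j}. shifted_pole (w i - w l) ^ k' l)" for k'
    unfolding pole_cofactor_def using assms by (subst prod.remove[of _ j]) auto
  have 2: "(\<Prod>l\<in>J - {i} - {j}. shifted_pole (w i - w l) ^ (k(j := k j - 1)) l)
      = (\<Prod>l\<in>J - {i} - {j}. shifted_pole (w i - w l) ^ k l)"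
    by (intro prod.cong) auto
  have "shifted_pole (w i - w j) ^ k j = shifted_pole (w i - w j) * shifted_pole (w i - w j) ^ (k j - 1)"
    using assms(4) by (cases "k j") auto
  then have "(fps_X + fps_const (w i - w j)) * shifted_pole (w i - w j) ^ k j
     = fps_X * shifted_pole (w i - w j) ^ (k j - 1)"
    using shifted_pole_mult[of "w i - w j"] assms(5) by (simp add: mult.assoc[symmetric])
  then show ?thesis unfolding 1 2 by (simp add: mult.assoc[symmetric])
qed

lemma pole_cofactor_cong:
  assumes "\<And>j. j \<in> J \<Longrightarrow> j \<noteq> i \<Longrightarrow> k j = k' j \<and> w j = w' j" "w i = w' i"
  shows "pole_cofactor J w k i = pole_cofactor J w' k' i"
  unfolding pole_cofactor_def using assms by (intro prod.cong) auto

lemma pole_cofactor_nth_less: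
  assumes "finite J" "n < sum k (J - {i})"
  shows "pole_cofactor J w k i $ n = 0"
proof -
  have "(\<Prod>j\<in>J - {i}. (shifted_pole (w i - w j) ^ k j) $ m j) = 0"
    if "m \<in> compositions (J - {i}) n" for m
  proof -
    have "\<exists>j\<in>J - {i}. m j < k j"
    proof (rule ccontr)
      assume "\<not> ?thesis"
      then have "sum k (J - {i}) \<le> sum m (J - {i})" by (intro sum_mono) (auto simp: not_less)
      then show False using that assms(2) by (simp add: compositions_def)
    qed
    then obtain j where "j \<in> J - {i}" "m j < k j" by blast
    then show ?thesis
      using assms(1) by (intro prod_zero bexI[of _ j] shifted_pole_power_nth_less) auto
  qed
  then show ?thesis
    unfolding pole_cofactor_def using assms(1)
    by (subst fps_prod_nth_compositions) (simp, rule sum.neutral, blast)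
qed

text \<open>Since (z - w b) - (z - w a) = w a - w b, a product with two poles of positive order is a difference of
two products of total degree one less, divided by w a - w b. The residues are linear, so the claim
descends to total degree 2 or to a single pole of order at least 2.\<close>

theorem sum_residues_eq_0:
  assumes "finite J" "inj_on w J" "sum k J \<ge> 2"
  shows "(\<Sum>i\<in>J. pole_cofactor J w k i $ (sum k J - 1)) = 0"
  using assms(3)
proof (induction "sum k J" arbitrary: k rule: less_induct)
  case less
  note K2 = less.prems
  show ?case
  proof (cases "\<exists>a\<in>J. \<exists>b\<in>J. a \<noteq> b \<and> k a \<ge> 1 \<and> k b \<ge> 1")
    case False
    \<comment> \<open>There is one pole, of order at least 2, and its Laurent series is a single term.\<close>
    have "pole_cofactor J w k i $ (sum k J - 1) = 0" if i: "i \<in> J" for i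
    proof (cases "k i = 0")
      case True
      then have "sum k (J - {i}) = sum k J" using assms(1) i by (simp add: sum.remove)
      then show ?thesis using K2 assms(1) by (intro pole_cofactor_nth_less) auto
    next
      case k0: False
      then have "k j = 0" if "j \<in> J - {i}" for j using False i that by force
      then have "pole_cofactor J w k i = 1" by (simp add: pole_cofactor_def)
      then show ?thesis using K2 by simp
    qed
    then show ?thesis by simp
  next
    case True
    then obtain a b where ab: "a \<in> J" "b \<in> J" "a \<noteq> b" "k a \<ge> 1" "k b \<ge> 1" by blast
    have wab: "w a - w b \<noteq> 0" using ab assms(2) by (auto simp: inj_on_def)
    define ka where "ka = k(a := k a - 1)"
    define kb where "kb = k(b := k b - 1)"
    have Ka: "sum ka J = sum k J - 1"
      using ab assms(1) by (simp add: ka_def sum.remove[of J a])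
    have Kb: "sum kb J = sum k J - 1"
      using ab assms(1) by (simp add: kb_def sum.remove[of J b])
    \<comment> \<open>The degree ?s extracts the residue once the total degree has dropped by 1.\<close>
    let ?s = "sum k J - 2"
    have s1: "sum k J - 1 = Suc ?s" using K2 by simp
    have ex: "(fps_X + fps_const c) * F = fps_X * G \<Longrightarrow> F $ ?s + c * F $ Suc ?s = G $ ?s"
      for c :: complex and F G
    proof -
      assume "(fps_X + fps_const c) * F = fps_X * G"
      then have "((fps_X + fps_const c) * F) $ Suc ?s = (fps_X * G) $ Suc ?s" by simp
      then show "F $ ?s + c * F $ Suc ?s = G $ ?s" by (simp add: distrib_right)
    qed
    have rec: "(w a - w b) * pole_cofactor J w k i $ Suc ?s
        = pole_cofactor J w kb i $ ?s - pole_cofactor J w ka i $ ?s" if i: "i \<in> J" for i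
    proof -
      have A: "i \<noteq> a \<Longrightarrow> pole_cofactor J w k i $ ?s + (w i - w a) * pole_cofactor J w k i $ Suc ?s
           = pole_cofactor J w ka i $ ?s"
        using pole_cofactor_split[of J a i k w] ab assms(1,2) i
        by (intro ex) (auto simp: ka_def inj_on_def)
      have B: "i \<noteq> b \<Longrightarrow> pole_cofactor J w k i $ ?s + (w i - w b) * pole_cofactor J w k i $ Suc ?s
           = pole_cofactor J w kb i $ ?s"
        using pole_cofactor_split[of J b i k w] ab assms(1,2) i
        by (intro ex) (auto simp: kb_def inj_on_def)
      have A': "pole_cofactor J w ka a = pole_cofactor J w k a"
        by (rule pole_cofactor_cong) (auto simp: ka_def)
      have B': "pole_cofactor J w kb b = pole_cofactor J w k b"
        by (rule pole_cofactor_cong) (auto simp: kb_def)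
      consider "i = a" | "i = b" | "i \<noteq> a" "i \<noteq> b" by blast
      then show ?thesis
      proof cases
        case 1
        then show ?thesis using B A' ab(3) by (auto simp: algebra_simps)
      next
        case 2
        then have "pole_cofactor J w k b $ ?s + (w b - w a) * pole_cofactor J w k b $ Suc ?s
           = pole_cofactor J w ka b $ ?s" using A ab(3) by simp
        then show ?thesis using 2 B' by (simp add: algebra_simps) 
      next
        case 3
        then show ?thesis using A B by (simp add: algebra_simps)
      qed
    qed
    show ?thesis
    proof (cases "sum k J = 2")
      case False
      then have K3: "sum k J - 1 \<ge> 2" using K2 by simp
      have e: "sum k J - 1 - 1 = ?s" by simp
      have "(\<Sum>i\<in>J. pole_cofactor J w ka i $ ?s) = 0" "(\<Sum>i\<in>J. pole_cofactor J w kb i $ ?s) = 0"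
        using less.hyps[of ka] less.hyps[of kb] K3 unfolding Ka Kb e by simp_all
      then have "(w a - w b) * (\<Sum>i\<in>J. pole_cofactor J w k i $ Suc ?s) = 0"
        by (simp add: sum_distrib_left rec sum_subtractf)
      then show ?thesis using wab s1 by simp
    next
      case 2: True
      have Sab: "sum k J = k a + k b + sum k (J - {a} - {b})"
        using ab assms(1) by (subst sum.remove[of J a], simp, simp, subst sum.remove[of _ b]) auto
      then have kab: "k a = 1" "k b = 1" "sum k (J - {a} - {b}) = 0" using 2 ab(4,5) by auto
      then have k0: "k j = 0" if "j \<in> J" "j \<noteq> a" "j \<noteq> b" for j using assms(1) that by simp
      have ca: "pole_cofactor J w k a = shifted_pole (w a - w b)"
        unfolding pole_cofactor_def using ab assms(1) k0 kab
        by (subst prod.remove[of _ b]) auto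
      have cb: "pole_cofactor J w k b = shifted_pole (w b - w a)"
        unfolding pole_cofactor_def using ab assms(1) k0 kab
        by (subst prod.remove[of _ a]) auto
      have c0: "pole_cofactor J w k i $ Suc 0 = 0" if "i \<in> J - {a} - {b}" for i
      proof (rule pole_cofactor_nth_less)
        have "k i = 0" using that k0 by auto
        then have "sum k (J - {i}) = sum k J" using assms(1) that by (simp add: sum.remove[of J i])
        then show "Suc 0 < sum k (J - {i})" using 2 by simp
      qed (use assms in auto)
      have "(\<Sum>i\<in>J. pole_cofactor J w k i $ Suc 0) = pole_cofactor J w k a $ Suc 0 + pole_cofactor J w k b $ Suc 0"
        using ab assms(1) c0
        by (subst sum.remove[of J a], simp, simp, subst sum.remove[of _ b]) auto
      also have "\<dots> = 0"
        using wab by (simp add: ca cb shifted_pole_nth divide_simps)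
      finally show ?thesis using 2 by simp
    qed
  qed
qed

text \<open>If c_\<nu> is the coefficient of (z - w i)^(- \<nu>) in the Laurent series at w i, this is the sum of the
c_\<nu> H \<nu> over \<nu> \<le> sum k J. The indicator of 1 extracts the residue, the indicator of 0
the constant coefficient, and polar (u - w i) the principal part evaluated at u.\<close>

definition expansion_pairing ::
    "'a set \<Rightarrow> ('a \<Rightarrow> complex) \<Rightarrow> ('a \<Rightarrow> nat) \<Rightarrow> 'a \<Rightarrow> (nat \<Rightarrow> complex) \<Rightarrow> complex" where
  "expansion_pairing J w k i H = (pole_cofactor J w k i * Abs_fps H) $ sum k J"

text \<open>The value at n = 0 leaves out the constant coefficient. At x = 0 everything is 0, because 1 / 0 = 0: a
pole that sits at the argument drops out of every sum over poles.\<close>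

definition polar :: "complex \<Rightarrow> nat \<Rightarrow> complex" where
  "polar x n = (if n = 0 then 0 else 1 / x ^ n)"

lemma sum_expansion_pairing_1:
  assumes "finite J" "inj_on w J" "sum k J \<ge> 2"
  shows "(\<Sum>i\<in>J. expansion_pairing J w k i (\<lambda>n. if n = 1 then 1 else 0)) = 0"
proof -
  have "Abs_fps (\<lambda>n. if n = 1 then 1 else 0) = (fps_X :: complex fps)"
    by (rule fps_ext) simp
  then have "expansion_pairing J w k i (\<lambda>n. if n = 1 then 1 else 0)
      = pole_cofactor J w k i $ (sum k J - 1)" for i
    using assms(3) by (simp add: expansion_pairing_def)
  then show ?thesis using sum_residues_eq_0[OF assms] by simp
qed

lemma expansion_pairing_0:
  "expansion_pairing J w k i (\<lambda>n. if n = 0 then 1 else 0) = pole_cofactor J w k i $ sum k J"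
proof -
  have "Abs_fps (\<lambda>n. if n = 0 then 1 else 0) = (1 :: complex fps)"
    by (rule fps_ext) simp
  then show ?thesis by (simp add: expansion_pairing_def)
qed

lemma expansion_pairing_polar:
  assumes "x \<noteq> 0"
  shows "expansion_pairing J w k i (polar x) = - (shifted_pole (- x) * pole_cofactor J w k i) $ sum k J"
proof -
  have "Abs_fps (polar x) = - shifted_pole (- x)"
  proof (rule fps_ext)
    fix n show "Abs_fps (polar x) $ n = (- shifted_pole (- x)) $ n"
      using assms by (cases n) (simp_all add: shifted_pole_nth polar_def power_minus[of x])
  qed
  then show ?thesis by (simp add: expansion_pairing_def mult.commute)
qed

text \<open>In the lowest degree only the constant coefficients of the factors 1 / (X + a j) contribute.\<close>

lemma prod_shifted_pole_nth:
  assumes "finite J" "\<And>j. j \<in> J \<Longrightarrow> a j \<noteq> 0"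
  shows "(\<Prod>j\<in>J. shifted_pole (a j) ^ k j) $ sum k J = (\<Prod>j\<in>J. 1 / a j ^ k j)"
  using assms
proof (induction J rule: finite_induct)
  case (insert x F)
  let ?P = "\<Prod>j\<in>F. shifted_pole (a j) ^ k j"
  have P: "?P = fps_X ^ sum k F * (\<Prod>j\<in>F. inverse (fps_X + fps_const (a j)) ^ k j)"
    by (simp add: shifted_pole_def power_mult_distrib prod.distrib power_sum)
  have split: "shifted_pole (a x) ^ k x * ?P = fps_X ^ k x * (inverse (fps_X + fps_const (a x)) ^ k x * ?P)"
    by (simp add: shifted_pole_def power_mult_distrib mult.assoc)
  have "(shifted_pole (a x) ^ k x * ?P) $ (k x + sum k F)
     = (inverse (fps_X + fps_const (a x)) ^ k x * ?P) $ sum k F"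
    unfolding split by (simp add: fps_X_power_mult_nth)
  also have "\<dots> = (fps_X ^ sum k F * (inverse (fps_X + fps_const (a x)) ^ k x
       * (\<Prod>j\<in>F. inverse (fps_X + fps_const (a j)) ^ k j))) $ sum k F"
    unfolding P by (simp only: mult.left_commute)
  also have "\<dots> = (1 / a x) ^ k x * (?P $ sum k F)"
    unfolding P by (simp add: fps_X_power_mult_nth fps_power_zeroth inverse_eq_divide)
  finally show ?case using insert by (simp add: power_one_over)
qed simp

text \<open>The residues of the product divided by z - u add up to 0. Away from the points w j, the additional
simple pole at u has the value of the product as its residue. If u = w a, division raises the order at w a
by 1, and the residue there becomes the constant coefficient of the original product. In both cases the
residue at any other w i is minus the principal part at w i, evaluated at u. Since 1 / 0 = 0, the first
term on the left is 0 in the second case, so that one formula covers both.\<close>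

theorem partial_fractions:
  fixes J :: "nat set"
  assumes J: "finite J" "J \<noteq> {}" and w: "inj_on w J" and k: "\<And>j. j \<in> J \<Longrightarrow> k j \<ge> 1"
  shows "(\<Prod>j\<in>J. 1 / (u - w j) ^ k j)
       + (\<Sum>i\<in>J. if w i = u then expansion_pairing J w k i (\<lambda>n. if n = 0 then 1 else 0) else 0)
       = (\<Sum>i\<in>J. expansion_pairing J w k i (polar (u - w i)))"
proof -
  have K1: "sum k J \<ge> 1" using J k
    by (metis One_nat_def Suc_leI less_one linorder_not_le not_gr_zero sum_eq_0_iff ex_in_conv)
  show ?thesis
  proof (cases "u \<in> w ` J")
    case False
    \<comment> \<open>An index outside J represents the additional pole at u.\<close>
    obtain a where a: "a \<notin> J" using J(1) ex_new_if_finite infinite_UNIV_nat by blast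
    define w' k' where "w' = w(a := u)" and "k' = k(a := 1)"
    have sk: "sum k' J = sum k J" using a by (intro sum.cong) (auto simp: k'_def)
    have K: "sum k' (insert a J) = Suc (sum k J)"
      using a J(1) sk by (simp add: k'_def)
    have "inj_on w' (insert a J)"
      using w False a by (auto simp: inj_on_def w'_def)
    then have "(\<Sum>i\<in>insert a J. pole_cofactor (insert a J) w' k' i $ sum k J) = 0"
      using K1 sum_residues_eq_0[of "insert a J" w' k'] J(1) K by simp
    moreover have "pole_cofactor (insert a J) w' k' a $ sum k J = (\<Prod>j\<in>J. 1 / (u - w j) ^ k j)"
    proof -
      have "pole_cofactor (insert a J) w' k' a = (\<Prod>j\<in>J. shifted_pole (u - w j) ^ k j)"
        unfolding pole_cofactor_def using a
        by (intro prod.cong) (auto simp: w'_def k'_def)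
      then show ?thesis using prod_shifted_pole_nth[of J "\<lambda>j. u - w j" k] J(1) False by auto
    qed
    moreover have "pole_cofactor (insert a J) w' k' i $ sum k J = - expansion_pairing J w k i (polar (u - w i))"
      if i: "i \<in> J" for i
    proof -
      have "insert a J - {i} = insert a (J - {i})" using i a by auto
      moreover have "(\<Prod>j\<in>J - {i}. shifted_pole (w' i - w' j) ^ k' j) = pole_cofactor J w k i"
        unfolding pole_cofactor_def using a i by (intro prod.cong) (auto simp: w'_def k'_def)
      ultimately have "pole_cofactor (insert a J) w' k' i = shifted_pole (w i - u) * pole_cofactor J w k i"
        unfolding pole_cofactor_def[of "insert a J"] using a i J(1) by (auto simp: w'_def k'_def)
      moreover have "u - w i \<noteq> 0" using i False by auto
      ultimately show ?thesis using expansion_pairing_polar[of "u - w i" J w k i] by simp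
    qed
    ultimately have "(\<Prod>j\<in>J. 1 / (u - w j) ^ k j) - (\<Sum>i\<in>J. expansion_pairing J w k i (polar (u - w i))) = 0"
      using a J(1) by (simp add: sum_negf)
    moreover have "(\<Sum>i\<in>J. if w i = u then expansion_pairing J w k i (\<lambda>n. if n = 0 then 1 else 0) else 0) = 0"
      using False by (intro sum.neutral) auto
    ultimately show ?thesis by simp
  next
    case True
    then obtain a where a: "a \<in> J" "w a = u" by auto
    define k' where "k' = k(a := k a + 1)"
    have K: "sum k' J = Suc (sum k J)"
      using a J(1) by (simp add: k'_def sum.remove[of J a])
    have "(\<Sum>i\<in>J. pole_cofactor J w k' i $ sum k J) = 0"
      using K1 sum_residues_eq_0[of J w k'] J(1) K w by simp
    moreover have "pole_cofactor J w k' i $ sum k J = (if w i = u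
         then expansion_pairing J w k i (\<lambda>n. if n = 0 then 1 else 0) else 0)
         - expansion_pairing J w k i (polar (u - w i))"
      if i: "i \<in> J" for i
    proof (cases "i = a")
      case True
      have "pole_cofactor J w k' a = pole_cofactor J w k a"
        by (rule pole_cofactor_cong) (auto simp: k'_def)
      moreover have "polar 0 = (\<lambda>_. 0)" by (auto simp: polar_def fun_eq_iff)
      moreover have "Abs_fps (\<lambda>_. 0 :: complex) = 0" by (rule fps_ext) simp
      ultimately show ?thesis using True a
        by (simp add: expansion_pairing_0) (simp add: expansion_pairing_def)
    next
      case False
      then have ne: "w i \<noteq> u" using a w i by (auto simp: inj_on_def)
      have 1: "pole_cofactor J w k'' i = shifted_pole (w i - w a) ^ k'' a
           * (\<Prod>l\<in>J - {i} - {a}. shifted_pole (w i - w l) ^ k'' l)" for k''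
        unfolding pole_cofactor_def using a False J(1) by (subst prod.remove[of _ a]) auto
      have "(\<Prod>l\<in>J - {i} - {a}. shifted_pole (w i - w l) ^ k' l)
          = (\<Prod>l\<in>J - {i} - {a}. shifted_pole (w i - w l) ^ k l)"
        by (intro prod.cong) (auto simp: k'_def)
      then have "pole_cofactor J w k' i = shifted_pole (w i - u) * pole_cofactor J w k i"
        unfolding 1 using a by (simp add: k'_def mult.assoc)
      then show ?thesis using ne expansion_pairing_polar[of "u - w i" J w k i] by simp
    qed
    ultimately have "(\<Sum>i\<in>J. if w i = u then expansion_pairing J w k i (\<lambda>n. if n = 0 then 1 else 0) else 0)
       - (\<Sum>i\<in>J. expansion_pairing J w k i (polar (u - w i))) = 0"
      by (simp add: sum_subtractf)
    moreover have "(\<Prod>j\<in>J. 1 / (u - w j) ^ k j) = 0"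
      using a J(1) k[OF a(1)] by (intro prod_zero) (auto intro!: bexI[of _ a] simp: zero_power)
    ultimately show ?thesis by simp
  qed
qed

lemma expansion_pairing_eq_sum:
  assumes "finite J" "i \<in> J"
  shows "expansion_pairing J w k i H = (\<Sum>n\<in>compositions J (sum k J).
      H (n i) * (\<Prod>j\<in>J - {i}. (shifted_pole (w i - w j) ^ k j) $ n j))"
proof -
  let ?f = "\<lambda>j. if j = i then Abs_fps H else shifted_pole (w i - w j) ^ k j"
  have 1: "prod ?f J = Abs_fps H * pole_cofactor J w k i"
    using assms by (simp add: prod.remove[of J i] pole_cofactor_def)
  have "expansion_pairing J w k i H = prod ?f J $ sum k J"
    unfolding 1 expansion_pairing_def by (simp only: mult.commute)
  also have "\<dots> = (\<Sum>n\<in>compositions J (sum k J). \<Prod>j\<in>J. ?f j $ n j)"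
    by (rule fps_prod_nth_compositions[OF assms(1)])
  also have "\<dots> = (\<Sum>n\<in>compositions J (sum k J).
      H (n i) * (\<Prod>j\<in>J - {i}. (shifted_pole (w i - w j) ^ k j) $ n j))"
    using assms by (intro sum.cong) (auto simp: prod.remove[of J i])
  finally show ?thesis .
qed

text \<open>The sign is the product of the (-1)^(n j + k j) over j \<noteq> i; it may be read off at i alone because the
n j and the k j have the same sum.\<close>

lemma expansion_pairing_binom_prod:
  assumes i: "i \<in> {1..r}" and k: "\<And>j. j \<in> {1..r} \<Longrightarrow> k j \<ge> 2" and w: "inj_on w {1..r}"
  shows "expansion_pairing {1..r} w k i H = (\<Sum>n\<in>compositions {1..r} (sum k {1..r}).
      (-1) ^ (k i + n i) * binom_prod r k n i * H (n i) * (\<Prod>j\<in>{1..r} - {i}. 1 / (w i - w j) ^ n j))"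
proof -
  have "(\<Prod>j\<in>{1..r} - {i}. (shifted_pole (w i - w j) ^ k j) $ n j)
      = (-1) ^ (k i + n i) * binom_prod r k n i * (\<Prod>j\<in>{1..r} - {i}. 1 / (w i - w j) ^ n j)"
    if n: "n \<in> compositions {1..r} (sum k {1..r})" for n
  proof -
    have "(\<Prod>j\<in>{1..r} - {i}. (shifted_pole (w i - w j) ^ k j) $ n j)
       = (\<Prod>j\<in>{1..r} - {i}. (-1) ^ (n j + k j) * of_nat ((n j - 1) choose (k j - 1)) * (1 / (w i - w j) ^ n j))"
    proof (rule prod.cong[OF refl])
      fix j assume j: "j \<in> {1..r} - {i}"
      then have ne: "w i - w j \<noteq> 0" using inj_onD[OF w, of i j] i by auto
      have k2: "k j \<ge> 2" using j k by simp
      show "(shifted_pole (w i - w j) ^ k j) $ n j =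
         (-1) ^ (n j + k j) * of_nat ((n j - 1) choose (k j - 1)) * (1 / (w i - w j) ^ n j)"
      proof (cases "n j = 0")
        case True
        then show ?thesis using k2 by (simp add: shifted_pole_power_nth_less)
      next
        case False
        then show ?thesis using k2 ne by (simp add: shifted_pole_power_nth)
      qed
    qed
    also have "\<dots> = (-1) ^ (\<Sum>j\<in>{1..r} - {i}. n j + k j) * binom_prod r k n i
        * (\<Prod>j\<in>{1..r} - {i}. 1 / (w i - w j) ^ n j)"
      by (simp only: prod.distrib power_sum binom_prod_def)
    finally have prod_eq: "(\<Prod>j\<in>{1..r} - {i}. (shifted_pole (w i - w j) ^ k j) $ n j)
       = (-1) ^ (\<Sum>j\<in>{1..r} - {i}. n j + k j) * binom_prod r k n i
        * (\<Prod>j\<in>{1..r} - {i}. 1 / (w i - w j) ^ n j)" .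
    have "(\<Sum>j\<in>{1..r} - {i}. n j + k j) + (k i + n i) = 2 * sum k {1..r}"
    proof -
      have "sum n {1..r} = sum k {1..r}" using n by (simp add: compositions_def)
      then have "(\<Sum>j\<in>{1..r}. n j + k j) = 2 * sum k {1..r}" by (simp add: sum.distrib)
      then show ?thesis using i by (simp add: sum.remove[of _ i])
    qed
    then have "even ((\<Sum>j\<in>{1..r} - {i}. n j + k j) + (k i + n i))"
      by (simp only: dvd_triv_left)
    then have "even (\<Sum>j\<in>{1..r} - {i}. n j + k j) = even (k i + n i)"
      by (simp only: even_add)
    then have "(-1 :: complex) ^ (\<Sum>j\<in>{1..r} - {i}. n j + k j) = (-1) ^ (k i + n i)"
      by (simp only: minus_one_power_iff)
    then show ?thesis unfolding prod_eq by (simp only:)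
  qed
  then show ?thesis
    unfolding expansion_pairing_eq_sum[OF finite_atLeastAtMost i]
    by (intro sum.cong) auto
qed

text \<open>Away from the position i, the exponents of every term with nonzero coefficient are thus at least 2, as
the convergence of the chain sums requires.\<close>

lemma binom_prod_nonzero:
  assumes "binom_prod r k n i \<noteq> 0" "j \<in> {1..r} - {i}" "k j \<ge> 2"
  shows "n j \<ge> k j"
proof -
  have "((n j - 1) choose (k j - 1)) \<noteq> 0"
    using assms(1,2) by (auto simp: binom_prod_def)
  then have "k j - 1 \<le> n j - 1" using binomial_eq_0 by (metis not_le)
  then show ?thesis using assms(3) by linarith
qed

section \<open>Infinite sums and averages\<close>

lemma
  fixes f :: "'a \<Rightarrow> complex" and g :: "'b \<Rightarrow> complex"
  assumes "f summable_on A" "g summable_on B"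
  shows summable_on_product: "(\<lambda>(x, y). f x * g y) summable_on A \<times> B"
    and infsum_product: "(\<Sum>\<^sub>\<infinity>(x, y)\<in>A \<times> B. f x * g y) = infsum f A * infsum g B"
proof -
  have f: "(\<lambda>x. norm (f x)) summable_on A" and g: "(\<lambda>x. norm (g x)) summable_on B"
    using assms by (simp_all flip: summable_on_iff_abs_summable_on_complex)
  have row: "((\<lambda>y. case (x, y) of (x, y) \<Rightarrow> norm (f x) * norm (g y)) has_sum
      norm (f x) * (\<Sum>\<^sub>\<infinity>y\<in>B. norm (g y))) B" for x
    using has_sum_cmult_right[OF has_sum_infsum[OF g], of "norm (f x)"] by simp
  have "(\<lambda>(x, y). norm (f x) * norm (g y)) summable_on A \<times> B"
    by (rule summable_on_SigmaI[OF row summable_on_cmult_left[OF f]]) auto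
  then have "(\<lambda>z. norm (case z of (x, y) \<Rightarrow> f x * g y)) summable_on A \<times> B"
    by (simp add: case_prod_unfold norm_mult)
  then show *: "(\<lambda>(x, y). f x * g y) summable_on A \<times> B"
    by (rule abs_summable_summable)
  show "(\<Sum>\<^sub>\<infinity>(x, y)\<in>A \<times> B. f x * g y) = infsum f A * infsum g B"
    by (simp add: infsum_Sigma'_banach[OF *, symmetric] infsum_cmult_right' infsum_cmult_left')
qed

text \<open>An unconditional sum may be computed along any exhaustion by finite sets; this turns the inner limits of
the definitions into sums over strips.\<close>

lemma tendsto_sum_increasing:
  fixes f :: "'a \<Rightarrow> complex"
  assumes "f summable_on A" "\<And>N. finite (X N)" "incseq X" "(\<Union>N. X N) = A"
  shows "(\<lambda>N. sum f (X N)) \<longlonglongrightarrow> infsum f A"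
proof -
  have "filterlim X (finite_subsets_at_top A) sequentially"
    unfolding filterlim_finite_subsets_at_top
  proof (intro allI impI)
    fix Y assume Y: "finite Y \<and> Y \<subseteq> A"
    have "\<exists>N. Y \<subseteq> X N" if "finite Y" "Y \<subseteq> A" for Y
      using that
    proof (induction Y rule: finite_induct)
      case (insert y Y)
      then obtain N where "Y \<subseteq> X N" by auto
      moreover obtain N' where "y \<in> X N'" using insert.prems assms(4) by auto
      ultimately have "insert y Y \<subseteq> X (max N N')"
        using incseqD[OF assms(3), of N "max N N'"] incseqD[OF assms(3), of N' "max N N'"] by auto
      then show ?case by blast
    qed simp
    with Y obtain N where N: "Y \<subseteq> X N" by blast
    show "\<forall>\<^sub>F n in sequentially. finite (X n) \<and> Y \<subseteq> X n \<and> X n \<subseteq> A"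
      using eventually_ge_at_top[of N]
    proof eventually_elim
      case (elim n)
      then have "X N \<subseteq> X n" by (rule incseqD[OF assms(3)])
      then show ?case using assms(2,4) N by blast
    qed
  qed
  then show ?thesis
    using infsum_tendsto[OF assms(1)] by (rule filterlim_compose[rotated])
qed

lemma infsum_delta: "infsum (\<lambda>p. if p = a then 1 else 0 :: complex) A = (if a \<in> A then 1 else 0)"
  and summable_on_delta: "(\<lambda>p. if p = a then 1 else 0 :: complex) summable_on A"
proof -
  have "((\<lambda>p. if p = a then 1 else 0 :: complex) has_sum (if a \<in> A then 1 else 0)) A"
    by (rule has_sum_finite_neutralI[where B = "{a} \<inter> A"]) auto
  then show "infsum (\<lambda>p. if p = a then 1 else 0 :: complex) A = (if a \<in> A then 1 else 0)"
    and "(\<lambda>p. if p = a then 1 else 0 :: complex) summable_on A"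
    by (auto intro: infsumI has_sum_imp_summable)
qed

lemma has_sum_finite_sum:
  fixes f :: "'a \<Rightarrow> 'b \<Rightarrow> 'c :: {topological_comm_monoid_add}"
  assumes "finite A" "\<And>a. a \<in> A \<Longrightarrow> (f a has_sum s a) X"
  shows "((\<lambda>x. \<Sum>a\<in>A. f a x) has_sum (\<Sum>a\<in>A. s a)) X"
  using assms by (induction A rule: finite_induct) (auto intro: has_sum_add)

lemma cesaro_zero:
  fixes x :: "nat \<Rightarrow> real"
  assumes "x \<longlonglongrightarrow> 0" "\<And>n. x n \<ge> 0"
  shows "(\<lambda>L. (\<Sum>A<L. x A) / real L) \<longlonglongrightarrow> 0"
proof (rule LIMSEQ_I)
  fix e :: real assume e: "e > 0"
  then obtain N where N: "\<And>n. n \<ge> N \<Longrightarrow> x n < e / 2"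
    using LIMSEQ_D[OF assms(1), of "e / 2"] assms(2) by auto
  define S where "S = (\<Sum>A<N. x A)"
  obtain N' :: nat where N': "2 * S / e < real N'" using reals_Archimedean2 by blast
  have "norm ((\<Sum>A<L. x A) / real L - 0) < e" if L: "L \<ge> max (Suc N) (Suc N')" for L
  proof -
    have "(\<Sum>A<L. x A) = S + (\<Sum>A=N..<L. x A)"
      using L by (simp add: S_def sum.atLeastLessThan_concat[of 0 N L] flip: atLeast0LessThan)
    also have "(\<Sum>A=N..<L. x A) \<le> (\<Sum>A=N..<L. e / 2)"
      by (intro sum_mono) (use N in \<open>auto intro: less_imp_le\<close>)
    also have "\<dots> \<le> real L * (e / 2)" using e by (simp add: mult_right_mono)
    finally have 1: "(\<Sum>A<L. x A) \<le> S + real L * (e / 2)" by simp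
    have "2 * S / e < real L" using N' L by simp
    then have "S < real L * (e / 2)" using e by (simp add: field_simps)
    with 1 have "(\<Sum>A<L. x A) < real L * e" by simp
    moreover have "0 \<le> (\<Sum>A<L. x A)" using assms(2) by (intro sum_nonneg) auto
    ultimately show ?thesis using L by (simp add: divide_less_eq mult.commute)
  qed
  then show "\<exists>no. \<forall>n\<ge>no. norm ((\<Sum>A<n. x A) / real n - 0) < e" by blast
qed

text \<open>Up to a null sequence of averages, p A * q (L - A) may be replaced by a * b.\<close>

lemma cesaro_convolution:
  fixes p q :: "nat \<Rightarrow> complex"
  assumes p: "p \<longlonglongrightarrow> a" and q: "q \<longlonglongrightarrow> b"
  shows "(\<lambda>L. (\<Sum>A\<in>{0<..<L}. p A * q (L - A)) / of_nat L) \<longlonglongrightarrow> a * b"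
proof -
  obtain B where B: "\<And>n. norm (q n) \<le> B" "B \<ge> 0"
  proof -
    from q have "Bseq q" by (intro convergent_imp_Bseq convergentI)
    then show ?thesis using that by (metis BseqE less_imp_le)
  qed
  let ?E = "\<lambda>L. (\<Sum>A\<in>{0<..<L}. p A * q (L - A) - a * b) / of_nat L"
  let ?x = "\<lambda>n. norm (p n - a)" and ?y = "\<lambda>n. norm (q n - b)"
  have x0: "?x \<longlonglongrightarrow> 0" and y0: "?y \<longlonglongrightarrow> 0"
    using p q by (auto intro: tendsto_norm_zero simp: LIM_zero_iff)
  have "(\<lambda>L. B * ((\<Sum>A<L. ?x A) / real L) + norm a * ((\<Sum>A<L. ?y A) / real L)) \<longlonglongrightarrow> B * 0 + norm a * 0"
    by (intro tendsto_add tendsto_mult tendsto_const cesaro_zero x0 y0) simp_all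
  then have majorant: "(\<lambda>L. B * ((\<Sum>A<L. ?x A) / real L) + norm a * ((\<Sum>A<L. ?y A) / real L)) \<longlonglongrightarrow> 0"
    by (simp only: mult_zero_right add_0_left)
  have "norm (?E L) \<le> B * ((\<Sum>A<L. ?x A) / real L) + norm a * ((\<Sum>A<L. ?y A) / real L)" for L
  proof -
    have "norm (p A * q (L - A) - a * b) \<le> B * ?x A + norm a * ?y (L - A)" for A
    proof -
      have "p A * q (L - A) - a * b = q (L - A) * (p A - a) + a * (q (L - A) - b)"
        by (simp add: algebra_simps)
      also have "norm \<dots> \<le> norm (q (L - A)) * ?x A + norm a * ?y (L - A)"
        by (metis norm_mult norm_triangle_ineq)
      also have "\<dots> \<le> B * ?x A + norm a * ?y (L - A)"
        using B by (intro add_mono mult_right_mono) auto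
      finally show ?thesis .
    qed
    then have "norm (\<Sum>A\<in>{0<..<L}. p A * q (L - A) - a * b)
       \<le> (\<Sum>A\<in>{0<..<L}. B * ?x A + norm a * ?y (L - A))"
      by (intro sum_norm_le) auto
    also have "\<dots> = B * (\<Sum>A\<in>{0<..<L}. ?x A) + norm a * (\<Sum>A\<in>{0<..<L}. ?y (L - A))"
      by (simp add: sum.distrib sum_distrib_left)
    also have "(\<Sum>A\<in>{0<..<L}. ?y (L - A)) = (\<Sum>A\<in>{0<..<L}. ?y A)"
      by (rule sum.reindex_bij_witness[of _ "\<lambda>A. L - A" "\<lambda>A. L - A"]) auto
    also have "B * (\<Sum>A\<in>{0<..<L}. ?x A) + norm a * (\<Sum>A\<in>{0<..<L}. ?y A)
        \<le> B * (\<Sum>A<L. ?x A) + norm a * (\<Sum>A<L. ?y A)"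
      using B by (intro add_mono mult_left_mono sum_mono2) auto
    finally have "norm (\<Sum>A\<in>{0<..<L}. p A * q (L - A) - a * b) / real L
       \<le> (B * (\<Sum>A<L. ?x A) + norm a * (\<Sum>A<L. ?y A)) / real L"
      by (rule divide_right_mono) simp
    then show ?thesis by (simp add: norm_divide add_divide_distrib)
  qed
  then have "?E \<longlonglongrightarrow> 0"
    by (intro Lim_null_comparison[OF _ majorant] always_eventually allI)
  moreover have "(\<lambda>L. of_nat (L - 1) * (a * b) / of_nat L) \<longlonglongrightarrow> a * b"
  proof -
    have "(\<lambda>L. 1 - 1 / of_nat L :: complex) \<longlonglongrightarrow> 1 - 0"
      by (intro tendsto_diff tendsto_const lim_1_over_n)
    then have "(\<lambda>L. (1 - 1 / of_nat L) * (a * b)) \<longlonglongrightarrow> 1 * (a * b)"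
      by (intro tendsto_mult tendsto_const) simp
    moreover have "\<forall>\<^sub>F L in sequentially.
       (1 - 1 / of_nat L) * (a * b) = of_nat (L - 1) * (a * b) / of_nat L"
      using eventually_gt_at_top[of 0]
    proof eventually_elim
      case (elim L)
      then have "of_nat (L - 1) = (of_nat L - 1 :: complex)" by (simp add: of_nat_diff)
      with elim show ?case by (simp add: diff_divide_distrib left_diff_distrib)
    qed
    ultimately show ?thesis by (simp add: Lim_transform_eventually)
  qed
  ultimately have "(\<lambda>L. ?E L + of_nat (L - 1) * (a * b) / of_nat L) \<longlonglongrightarrow> 0 + a * b"
    by (rule tendsto_add)
  moreover have "?E L + of_nat (L - 1) * (a * b) / of_nat L
      = (\<Sum>A\<in>{0<..<L}. p A * q (L - A)) / of_nat L" for L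
    by (simp add: sum_subtractf diff_divide_distrib)
  ultimately show ?thesis by simp
qed

text \<open>The theorem of Tannery for sums over the integers, transported along an enumeration of the integers.\<close>

lemma dominated_symmetric_sum:
  fixes u :: "nat \<Rightarrow> int \<Rightarrow> complex" and h :: "int \<Rightarrow> complex"
  assumes h: "h summable_on UNIV"
    and bound: "\<And>M m. \<bar>m\<bar> < int M \<Longrightarrow> norm (u M m) \<le> B"
    and lim: "\<And>m. (\<lambda>M. u M m) \<longlonglongrightarrow> c"
  shows "(\<lambda>M. \<Sum>m\<in>{-int M<..<int M}. u M m * h m) \<longlonglongrightarrow> c * infsum h UNIV"
proof -
  define v where "v M m = (if \<bar>m\<bar> < int M then u M m * h m else 0)" for M m
  have bij: "bij_betw int_decode UNIV UNIV" by (rule bij_int_decode)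
  have v_sums: "(\<lambda>k. v M (int_decode k)) sums (\<Sum>m\<in>{-int M<..<int M}. u M m * h m)" for M
  proof -
    have "(v M has_sum (\<Sum>m\<in>{-int M<..<int M}. u M m * h m)) UNIV"
      by (rule has_sum_finite_neutralI[where B = "{-int M<..<int M}"]) (auto simp: v_def intro!: sum.cong)
    then have "((\<lambda>k. v M (int_decode k)) has_sum (\<Sum>m\<in>{-int M<..<int M}. u M m * h m)) UNIV"
      by (simp only: has_sum_reindex_bij_betw[OF bij])
    then show ?thesis by (rule has_sum_imp_sums)
  qed
  have h_sums: "(\<lambda>k. c * h (int_decode k)) sums (c * infsum h UNIV)"
  proof -
    have "((\<lambda>m. c * h m) has_sum (c * infsum h UNIV)) UNIV"
      by (intro has_sum_cmult_right has_sum_infsum h)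
    then have "((\<lambda>k. c * h (int_decode k)) has_sum (c * infsum h UNIV)) UNIV"
      by (subst has_sum_reindex_bij_betw[OF bij])
    then show ?thesis by (rule has_sum_imp_sums)
  qed
  have "(\<lambda>m. B * norm (h m)) summable_on UNIV"
    using h by (intro summable_on_cmult_right) (simp flip: summable_on_iff_abs_summable_on_complex)
  then have "(\<lambda>k. B * norm (h (int_decode k))) summable_on UNIV"
    by (subst summable_on_reindex_bij_betw[OF bij])
  then have dom: "summable (\<lambda>k. B * norm (h (int_decode k)))"
    by (rule summable_on_imp_summable)
  have "B \<ge> 0" using order_trans[OF norm_ge_zero bound[of 0 1]] by simp
  have "(\<lambda>M. \<Sum>k. v M (int_decode k)) \<longlonglongrightarrow> (\<Sum>k. c * h (int_decode k))"
  proof (rule tannerys_theorem[THEN conjunct2, THEN conjunct2, OF _ _ dom])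
    fix k
    have "(\<lambda>M. u M (int_decode k) * h (int_decode k)) \<longlonglongrightarrow> c * h (int_decode k)"
      by (intro tendsto_mult lim tendsto_const)
    moreover have "\<forall>\<^sub>F M in sequentially. u M (int_decode k) * h (int_decode k) = v M (int_decode k)"
      using eventually_gt_at_top[of "nat \<bar>int_decode k\<bar>"]
      by eventually_elim (auto simp: v_def)
    ultimately show "(\<lambda>M. v M (int_decode k)) \<longlonglongrightarrow> c * h (int_decode k)"
      by (rule Lim_transform_eventually)
  next
    show "\<forall>\<^sub>F (k, M) in sequentially \<times>\<^sub>F sequentially. norm (v M (int_decode k)) \<le> B * norm (h (int_decode k))"
      using bound \<open>B \<ge> 0\<close> by (intro always_eventually) (auto simp: v_def norm_mult intro!: mult_right_mono)
  qed simp
  then show ?thesis using v_sums h_sums by (simp add: sums_iff)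
qed

section \<open>Sums over chains of integer points\<close>

type_synonym point = "int \<times> int"

text \<open>Lattice points are handled through their integer coordinates, on which translation and point
reflection respect or reverse the order.\<close>

definition lt :: "point \<Rightarrow> point \<Rightarrow> bool" where
  "lt p q \<longleftrightarrow> fst p < fst q \<or> fst p = fst q \<and> snd p < snd q"

definition chain_lists :: "point set \<Rightarrow> nat \<Rightarrow> point list set" where
  "chain_lists S r = {ps. length ps = r \<and> set ps \<subseteq> S \<and> sorted_wrt lt ps}"

definition power_weight :: "nat list \<Rightarrow> complex list \<Rightarrow> complex" where
  "power_weight ns xs = prod_list (map2 (\<lambda>n x. 1 / x ^ n) ns xs)"

definition chain_sum :: "(point \<Rightarrow> complex) \<Rightarrow> point set \<Rightarrow> nat list \<Rightarrow> complex" where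
  "chain_sum g S ns = (\<Sum>\<^sub>\<infinity>ps\<in>chain_lists S (length ns). power_weight ns (map g ps))"

lemma lt_irrefl [simp]: "\<not> lt p p"
  and lt_trans: "lt p q \<Longrightarrow> lt q s \<Longrightarrow> lt p s"
  and lt_asym: "lt p q \<Longrightarrow> \<not> lt q p"
  and lt_total: "p \<noteq> q \<Longrightarrow> lt p q \<or> lt q p"
  by (auto simp: lt_def prod_eq_iff)

lemma power_weight_Nil [simp]: "power_weight [] xs = 1"
  and power_weight_Cons [simp]: "power_weight (n # ns) (x # xs) = 1 / x ^ n * power_weight ns xs"
  by (simp_all add: power_weight_def)

lemma power_weight_append:
  "length ns = length xs \<Longrightarrow> power_weight (ns @ ns') (xs @ xs') = power_weight ns xs * power_weight ns' xs'"
  by (simp add: power_weight_def)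

lemma power_weight_rev:
  assumes "length ns = length xs"
  shows "power_weight (rev ns) (rev xs) = power_weight ns xs"
  using assms by (induction ns xs rule: list_induct2) (simp_all add: power_weight_append mult.commute)

lemma power_weight_uminus:
  assumes "length ns = length xs"
  shows "power_weight ns (map uminus xs) = (-1) ^ sum_list ns * power_weight ns xs"
  using assms
proof (induction ns xs rule: list_induct2)
  case (Cons n ns x xs)
  have "1 / (- x) ^ n = (-1) ^ n * (1 / x ^ n)"
    by (cases "even n") (simp_all add: power_minus_odd)
  then show ?case using Cons by (simp add: power_add)
qed simp

lemma power_weight_nth:
  assumes "length ns = length xs"
  shows "power_weight ns xs = (\<Prod>j<length ns. 1 / (xs ! j) ^ (ns ! j))"
  using assms
  by (induction ns xs rule: list_induct2) (simp_all add: prod.lessThan_Suc_shift del: prod.lessThan_Suc)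

lemma chain_lists_0 [simp]: "chain_lists S 0 = {[]}"
  by (auto simp: chain_lists_def)

lemma chain_sum_Nil [simp]: "chain_sum g S [] = 1"
  by (simp add: chain_sum_def)

lemma chain_lists_mono: "S \<subseteq> T \<Longrightarrow> chain_lists S r \<subseteq> chain_lists T r"
  by (auto simp: chain_lists_def)

lemma chain_lists_1: "chain_lists S (Suc 0) = (\<lambda>p. [p]) ` S"
  by (auto simp: chain_lists_def length_Suc_conv)

lemma chain_sum_single: "chain_sum g S [n] = (\<Sum>\<^sub>\<infinity>p\<in>S. 1 / g p ^ n)"
proof -
  have "inj_on (\<lambda>p :: point. [p]) S" by (simp add: inj_on_def)
  then show ?thesis by (simp add: chain_sum_def chain_lists_1 infsum_reindex o_def)
qed

lemma chain_lists_distinct: "ps \<in> chain_lists S r \<Longrightarrow> distinct ps"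
  unfolding chain_lists_def
  by clarsimp (metis distinct_conv_nth lt_irrefl nat_neq_iff sorted_wrt_iff_nth_less)

text \<open>Tuples without the order condition dominate chains, and their sum is a product of sums over points.\<close>

lemma has_sum_norm_tuples:
  assumes "\<And>n. n \<in> set ns \<Longrightarrow> (\<lambda>p. 1 / g p ^ n) summable_on (S :: 'a set)"
  shows "((\<lambda>ps. norm (power_weight ns (map g ps))) has_sum
     (\<Prod>n\<leftarrow>ns. \<Sum>\<^sub>\<infinity>p\<in>S. norm (1 / g p ^ n))) {ps. length ps = length ns \<and> set ps \<subseteq> S}"
  using assms
proof (induction ns)
  case Nil
  have "{ps. length ps = length ([] :: nat list) \<and> set ps \<subseteq> S} = {[]}" by auto
  then show ?case by (simp add: has_sum_finite_iff)
next
  case (Cons n ns)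
  let ?T = "{ps. length ps = length ns \<and> set ps \<subseteq> S}"
  let ?P = "\<Prod>n\<leftarrow>ns. \<Sum>\<^sub>\<infinity>p\<in>S. norm (1 / g p ^ n)"
  have IH: "((\<lambda>ps. norm (power_weight ns (map g ps))) has_sum ?P) ?T"
    using Cons by simp
  have s1: "(\<lambda>p. norm (1 / g p ^ n)) summable_on S"
    using Cons.prems[of n] by (simp flip: summable_on_iff_abs_summable_on_complex)
  have "((\<lambda>(p, ps). norm (1 / g p ^ n) * norm (power_weight ns (map g ps))) has_sum
        (\<Sum>\<^sub>\<infinity>p\<in>S. norm (1 / g p ^ n)) * ?P) (S \<times> ?T)"
  proof (rule has_sum_SigmaI)
    show row: "((\<lambda>y. case (x, y) of (p, ps) \<Rightarrow> norm (1 / g p ^ n) * norm (power_weight ns (map g ps)))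
        has_sum norm (1 / g x ^ n) * ?P) ?T" for x
      using has_sum_cmult_right[OF IH, of "norm (1 / g x ^ n)"] by simp
    show col: "((\<lambda>x. norm (1 / g x ^ n) * ?P) has_sum (\<Sum>\<^sub>\<infinity>p\<in>S. norm (1 / g p ^ n)) * ?P) S"
      by (intro has_sum_cmult_left has_sum_infsum s1)
    show "(\<lambda>(p, ps). norm (1 / g p ^ n) * norm (power_weight ns (map g ps))) summable_on S \<times> ?T"
      by (rule summable_on_SigmaI[OF row has_sum_imp_summable[OF col]]) auto
  qed
  moreover have "{ps. length ps = length (n # ns) \<and> set ps \<subseteq> S} = (\<lambda>(p, ps). p # ps) ` (S \<times> ?T)"
    by (auto simp: length_Suc_conv image_iff)
  moreover have "inj_on (\<lambda>(p, ps). p # ps) (S \<times> ?T)" by (auto simp: inj_on_def)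
  ultimately show ?case
    by (simp add: has_sum_reindex o_def case_prod_unfold norm_mult norm_divide norm_power)
qed

lemma
  assumes "\<And>n. n \<in> set ns \<Longrightarrow> (\<lambda>p. 1 / g p ^ n) summable_on S"
  shows chain_summable: "(\<lambda>ps. power_weight ns (map g ps)) summable_on chain_lists S (length ns)"
    and norm_chain_sum_le: "norm (chain_sum g S ns) \<le> (\<Prod>n\<leftarrow>ns. \<Sum>\<^sub>\<infinity>p\<in>S. norm (1 / g p ^ n))"
proof -
  let ?T = "{ps. length ps = length ns \<and> set ps \<subseteq> S}"
  have sub: "chain_lists S (length ns) \<subseteq> ?T" by (auto simp: chain_lists_def)
  note hs = has_sum_norm_tuples[of ns g S, OF assms]
  have s: "(\<lambda>ps. norm (power_weight ns (map g ps))) summable_on chain_lists S (length ns)"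
    using summable_on_subset[OF has_sum_imp_summable[OF hs] sub] .
  then show s': "(\<lambda>ps. power_weight ns (map g ps)) summable_on chain_lists S (length ns)"
    by (rule abs_summable_summable)
  have "norm (chain_sum g S ns) \<le> (\<Sum>\<^sub>\<infinity>ps\<in>chain_lists S (length ns). norm (power_weight ns (map g ps)))"
    unfolding chain_sum_def by (rule norm_infsum_bound[OF s])
  also have "\<dots> \<le> (\<Sum>\<^sub>\<infinity>ps\<in>?T. norm (power_weight ns (map g ps)))"
    using sub by (intro infsum_mono_neutral s has_sum_imp_summable[OF hs]) auto
  also have "\<dots> = (\<Prod>n\<leftarrow>ns. \<Sum>\<^sub>\<infinity>p\<in>S. norm (1 / g p ^ n))"
    by (rule infsumI[OF hs])
  finally show "norm (chain_sum g S ns) \<le> (\<Prod>n\<leftarrow>ns. \<Sum>\<^sub>\<infinity>p\<in>S. norm (1 / g p ^ n))" .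
qed

lemma chain_lists_rev_image:
  assumes "\<And>p q. lt (h p) (h q) \<longleftrightarrow> lt q p"
  shows "chain_lists (h ` S) r = (\<lambda>ps. rev (map h ps)) ` chain_lists S r"
proof (intro equalityI subsetI)
  fix qs assume "qs \<in> chain_lists (h ` S) r"
  then have qs: "length qs = r" "set qs \<subseteq> h ` S" "sorted_wrt lt qs" by (auto simp: chain_lists_def)
  from qs(2) have "rev qs \<in> map h ` lists S"
    by (metis in_lists_conv_set lists_image subsetD set_rev)
  then obtain ps where ps: "rev qs = map h ps" "set ps \<subseteq> S" by auto
  then have "qs = rev (map h ps)" by (simp add: rev_swap)
  then show "qs \<in> (\<lambda>ps. rev (map h ps)) ` chain_lists S r"
    using qs assms ps(2) by (auto simp: chain_lists_def sorted_wrt_map sorted_wrt_rev)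
next
  fix qs assume "qs \<in> (\<lambda>ps. rev (map h ps)) ` chain_lists S r"
  then obtain ps where "qs = rev (map h ps)" "length ps = r" "set ps \<subseteq> S" "sorted_wrt lt ps"
    by (auto simp: chain_lists_def)
  then show "qs \<in> chain_lists (h ` S) r"
    using image_mono[of "set ps" S h]
    by (simp add: chain_lists_def sorted_wrt_map sorted_wrt_rev assms)
qed

lemma chain_sum_anti_image:
  assumes "\<And>p q. lt (h p) (h q) \<longleftrightarrow> lt q p"
  shows "chain_sum g (h ` S) ns = chain_sum (g \<circ> h) S (rev ns)"
proof -
  have "inj h" by (rule injI) (metis assms lt_irrefl lt_total)
  then have "inj_on (\<lambda>ps. rev (map h ps)) X" for X by (simp add: inj_on_def)
  moreover have "power_weight ns (map g (rev (map h ps))) = power_weight (rev ns) (map (g \<circ> h) ps)"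
    if "ps \<in> chain_lists S (length ns)" for ps
    using that power_weight_rev[of "rev ns" "map (g \<circ> h) ps"]
    by (simp add: chain_lists_def rev_map o_def)
  ultimately show ?thesis
    unfolding chain_sum_def chain_lists_rev_image[of h, OF assms] length_rev
    by (simp add: infsum_reindex o_def cong: infsum_cong)
qed

lemma chain_sum_uminus:
  "chain_sum (\<lambda>p. - g p) S ns = (-1) ^ sum_list ns * chain_sum g S ns"
proof -
  have "power_weight ns (map (\<lambda>p. - g p) ps) = (-1) ^ sum_list ns * power_weight ns (map g ps)"
    if "ps \<in> chain_lists S (length ns)" for ps
    using that power_weight_uminus[of ns "map g ps"] by (simp add: chain_lists_def o_def)
  then show ?thesis
    unfolding chain_sum_def by (simp add: infsum_cmult_right' cong: infsum_cong)
qed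

lemma chain_lists_append:
  assumes "\<And>p q. p \<in> S \<Longrightarrow> q \<in> T \<Longrightarrow> lt p q"
  shows "chain_lists (S \<union> T) r = (\<Union>i\<le>r. (\<lambda>(us, vs). us @ vs) ` (chain_lists S i \<times> chain_lists T (r - i)))"
proof (intro equalityI subsetI)
  fix ps assume "ps \<in> chain_lists (S \<union> T) r"
  then have ps: "length ps = r" "set ps \<subseteq> S \<union> T" "sorted_wrt lt ps" by (auto simp: chain_lists_def)
  have "\<exists>us vs. ps = us @ vs \<and> set us \<subseteq> S \<and> set vs \<subseteq> T"
    using ps(2,3)
  proof (induction ps)
    case (Cons p ps)
    show ?case
    proof (cases "p \<in> S")
      case True
      obtain us vs where "ps = us @ vs" "set us \<subseteq> S" "set vs \<subseteq> T" using Cons by auto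
      then show ?thesis using True by (intro exI[of _ "p # us"] exI[of _ vs]) auto
    next
      case False
      have "q \<notin> S" if "q \<in> set (p # ps)" for q
        using that False Cons.prems assms[of q p] lt_asym[of p q] by auto
      then have "set (p # ps) \<subseteq> T" using Cons.prems(1) by auto
      then show ?thesis by (intro exI[of _ "[]"] exI[of _ "p # ps"]) auto
    qed
  qed simp
  then obtain us vs where "ps = us @ vs" "set us \<subseteq> S" "set vs \<subseteq> T" by blast
  then show "ps \<in> (\<Union>i\<le>r. (\<lambda>(us, vs). us @ vs) ` (chain_lists S i \<times> chain_lists T (r - i)))"
    using ps by (auto simp: chain_lists_def sorted_wrt_append intro!: bexI[of _ "length us"])
next
  fix ps assume "ps \<in> (\<Union>i\<le>r. (\<lambda>(us, vs). us @ vs) ` (chain_lists S i \<times> chain_lists T (r - i)))"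
  then obtain i us vs where "i \<le> r" "us \<in> chain_lists S i" "vs \<in> chain_lists T (r - i)" "ps = us @ vs" by auto
  then show "ps \<in> chain_lists (S \<union> T) r"
    using assms by (auto simp: chain_lists_def sorted_wrt_append intro!: assms dest: subsetD)
qed

text \<open>If S lies below T, a chain in their union is a chain in S followed by a chain in T.\<close>

lemma chain_sum_Un:
  assumes lt: "\<And>p q. p \<in> S \<Longrightarrow> q \<in> T \<Longrightarrow> lt p q"
    and s: "\<And>n. n \<in> set ns \<Longrightarrow> (\<lambda>p. 1 / g p ^ n) summable_on S"
    and t: "\<And>n. n \<in> set ns \<Longrightarrow> (\<lambda>p. 1 / g p ^ n) summable_on T"
  shows "chain_sum g (S \<union> T) ns = (\<Sum>i\<le>length ns. chain_sum g S (take i ns) * chain_sum g T (drop i ns))"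
proof -
  let ?r = "length ns" and ?app = "\<lambda>(us :: point list, vs). us @ vs"
  let ?B = "\<lambda>i. ?app ` (chain_lists S i \<times> chain_lists T (?r - i))"
  let ?w = "\<lambda>ps. power_weight ns (map g ps)"
  have disj: "?B i \<inter> ?B j = {}" if "i \<noteq> j" for i j
  proof -
    have ST: "S \<inter> T = {}" using lt by force
    have "length (takeWhile (\<lambda>p. p \<in> S) ps) = i" if ps: "ps \<in> ?B i" for i ps
    proof -
      from ps obtain us vs where uv: "ps = us @ vs" "us \<in> chain_lists S i" "vs \<in> chain_lists T (?r - i)" by auto
      have "takeWhile (\<lambda>p. p \<in> S) vs = []"
        using uv(3) ST by (cases vs) (auto simp: chain_lists_def)
      moreover have "\<forall>p \<in> set us. p \<in> S" "length us = i" using uv(2) by (auto simp: chain_lists_def)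
      ultimately show ?thesis using uv(1) by (simp add: takeWhile_append)
    qed
    then show ?thesis using that by blast
  qed
  have inj: "inj_on ?app (chain_lists S i \<times> chain_lists T (?r - i))" for i
    by (auto simp: inj_on_def chain_lists_def)
  have w: "?w (?app x) = (case x of (us, vs) \<Rightarrow>
       power_weight (take i ns) (map g us) * power_weight (drop i ns) (map g vs))"
    if "x \<in> chain_lists S i \<times> chain_lists T (?r - i)" "i \<le> ?r" for i x
  proof -
    obtain us vs where x: "x = (us, vs)" by (cases x)
    have "length (take i ns) = length (map g us)" using that x by (simp add: chain_lists_def)
    from power_weight_append[OF this, of "drop i ns" "map g vs"] show ?thesis by (simp add: x)
  qed
  have S: "(\<lambda>us. power_weight (take i ns) (map g us)) summable_on chain_lists S i" if "i \<le> ?r" for i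
  proof -
    have "(\<lambda>p. 1 / g p ^ n) summable_on S" if "n \<in> set (take i ns)" for n
      using that by (rule s[OF in_set_takeD])
    from chain_summable[of "take i ns" g S, OF this] that show ?thesis by (simp add: min_absorb2)
  qed
  have T: "(\<lambda>us. power_weight (drop i ns) (map g us)) summable_on chain_lists T (?r - i)" for i
  proof -
    have "(\<lambda>p. 1 / g p ^ n) summable_on T" if "n \<in> set (drop i ns)" for n
      using that by (rule t[OF in_set_dropD])
    from chain_summable[of "drop i ns" g T, OF this] show ?thesis by simp
  qed
  have summ: "?w summable_on ?B i" if "i \<le> ?r" for i
  proof -
    have "(?w \<circ> ?app) summable_on (chain_lists S i \<times> chain_lists T (?r - i)) \<longleftrightarrow>
       (\<lambda>(us, vs). power_weight (take i ns) (map g us) * power_weight (drop i ns) (map g vs))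
         summable_on (chain_lists S i \<times> chain_lists T (?r - i))"
      unfolding o_def by (rule summable_on_cong) (rule w[OF _ that])
    then show ?thesis
      using summable_on_product[OF S[OF that] T[of i]] by (simp only: summable_on_reindex[OF inj])
  qed
  have val: "infsum ?w (?B i) = chain_sum g S (take i ns) * chain_sum g T (drop i ns)" if "i \<le> ?r" for i
  proof -
    have "infsum ?w (?B i) = infsum (?w \<circ> ?app) (chain_lists S i \<times> chain_lists T (?r - i))"
      by (rule infsum_reindex[OF inj])
    also have "\<dots> = (\<Sum>\<^sub>\<infinity>(us, vs)\<in>chain_lists S i \<times> chain_lists T (?r - i).
       power_weight (take i ns) (map g us) * power_weight (drop i ns) (map g vs))"
      unfolding o_def by (rule infsum_cong) (rule w[OF _ that])
    also have "\<dots> = chain_sum g S (take i ns) * chain_sum g T (drop i ns)"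
      using infsum_product[OF S[OF that] T[of i]] that by (simp add: chain_sum_def min_absorb2)
    finally show ?thesis .
  qed
  have "chain_lists (S \<union> T) ?r = (\<Union>i\<le>?r. ?B i)" by (rule chain_lists_append[OF lt])
  then have "chain_sum g (S \<union> T) ns = infsum ?w (\<Union>i\<le>?r. ?B i)"
    by (simp only: chain_sum_def)
  also have "\<dots> = (\<Sum>i\<le>?r. infsum ?w (?B i))"
    by (rule sum_infsum[symmetric]) (use summ disj in auto)
  finally show ?thesis by (simp add: val)
qed

lemma power_weight_upt:
  assumes "length xs = r"
  shows "power_weight (map k [1..<r+1]) xs = (\<Prod>j=1..r. 1 / (xs ! (j - 1)) ^ k j)"
proof -
  have "power_weight (map k [1..<r+1]) xs = (\<Prod>j<r. 1 / (xs ! j) ^ k (1 + j))"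
    using assms by (auto simp: power_weight_nth simp del: upt_Suc intro!: prod.cong)
  also have "\<dots> = (\<Prod>j=1..r. 1 / (xs ! (j - 1)) ^ k j)"
    by (rule prod.reindex_bij_witness[of _ "\<lambda>j. j - 1" "\<lambda>j. 1 + j"]) auto
  finally show ?thesis .
qed

section \<open>Sums over the rows of the lattice\<close>

text \<open>The terms are compared with the telescoping differences of 1 / (n + y).\<close>

lemma quarter_row_bound:
  fixes t y :: real
  assumes "t \<ge> 0" "y > 0"
  shows "(\<lambda>n::nat. 1 / ((real n + t)\<^sup>2 + y\<^sup>2)) summable_on UNIV"
    and "(\<Sum>\<^sub>\<infinity>n::nat. 1 / ((real n + t)\<^sup>2 + y\<^sup>2)) \<le> 2 * (1 + 1 / y) / y"
proof -
  let ?f = "\<lambda>n::nat. 1 / ((real n + t)\<^sup>2 + y\<^sup>2)"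
  let ?g = "\<lambda>n::nat. 2 * (1 + 1 / y) * (1 / (real n + y) - 1 / (real (Suc n) + y))"
  have "(\<lambda>n. 1 / (real n + y)) \<longlonglongrightarrow> 0" by real_asymp
  from telescope_sums'[OF this] have "(\<lambda>n. 1 / (real n + y) - 1 / (real (Suc n) + y)) sums (1 / y)"
    by simp
  from sums_mult[OF this, of "2 * (1 + 1 / y)"] have g: "?g sums (2 * (1 + 1 / y) / y)" by simp
  have g0: "?g n \<ge> 0" for n
    using assms by (simp add: divide_simps)
  from sums_nonneg_imp_has_sum[OF g g0] have G: "(?g has_sum (2 * (1 + 1 / y) / y)) UNIV" .
  have le: "?f n \<le> ?g n" for n
  proof -
    let ?s = "real n + y"
    have s: "?s > 0" "?s \<ge> y" using assms by auto
    have "?s\<^sup>2 \<le> 2 * ((real n)\<^sup>2 + y\<^sup>2)"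
      using sum_squares_bound[of "real n" y] by (simp add: power2_sum)
    also have "\<dots> \<le> 2 * ((real n + t)\<^sup>2 + y\<^sup>2)" using assms by (simp add: power_mono)
    finally have "?s\<^sup>2 \<le> 2 * ((real n + t)\<^sup>2 + y\<^sup>2)" .
    then have "?f n \<le> 2 / ?s\<^sup>2"
    proof -
      have "0 < (real n + t)\<^sup>2 + y\<^sup>2" using assms by (simp add: add_nonneg_pos)
      then show ?thesis
        using s \<open>?s\<^sup>2 \<le> 2 * ((real n + t)\<^sup>2 + y\<^sup>2)\<close>
        by (simp add: pos_divide_le_eq pos_le_divide_eq)
    qed
    also have "\<dots> \<le> 2 * ((1 + 1 / y) / (?s * (?s + 1)))"
    proof -
      have "?s + 1 \<le> (1 + 1 / y) * ?s" using s assms by (simp add: field_simps)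
      then have "?s * (?s + 1) \<le> (1 + 1 / y) * ?s\<^sup>2"
        using s by (simp add: power2_eq_square mult.left_commute)
      then have "1 / ?s\<^sup>2 \<le> (1 + 1 / y) / (?s * (?s + 1))"
        using s by (simp add: pos_divide_le_eq pos_le_divide_eq mult.commute)
      then have "2 * (1 / ?s\<^sup>2) \<le> 2 * ((1 + 1 / y) / (?s * (?s + 1)))" by (intro mult_left_mono) auto
      then show ?thesis by (simp only: mult_1_right times_divide_eq_right)
    qed
    also have "\<dots> = ?g n" using s by (simp add: field_simps)
    finally show ?thesis .
  qed
  have f0: "?f n \<ge> 0" for n by simp
  show *: "?f summable_on UNIV"
    using has_sum_imp_summable[OF G] by (rule summable_on_comparison_test) (use le f0 in auto)
  have "infsum ?f UNIV \<le> infsum ?g UNIV"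
    by (rule infsum_mono[OF * has_sum_imp_summable[OF G] le])
  then show "infsum ?f UNIV \<le> 2 * (1 + 1 / y) / y" using infsumI[OF G] by simp
qed

text \<open>The bound must not depend on x and must decay like 1 / y: it is used for points x + l + i y in a row at
height y.\<close>

lemma half_plane_row_bound:
  fixes x y :: real
  assumes "y > 0"
  shows "(\<lambda>l::int. 1 / ((x + l)\<^sup>2 + y\<^sup>2)) summable_on UNIV"
    and "(\<Sum>\<^sub>\<infinity>l::int. 1 / ((x + l)\<^sup>2 + y\<^sup>2)) \<le> 4 * (1 + 1 / y) / y"
proof -
  let ?f = "\<lambda>l::int. 1 / ((x + l)\<^sup>2 + y\<^sup>2)"
  \<comment> \<open>The two halves start at the integer nearest to - x on either side.\<close>
  let ?u = "\<lambda>n::nat. int n - \<lfloor>x\<rfloor>" and ?v = "\<lambda>n::nat. - int n - 1 - \<lfloor>x\<rfloor>"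
  have U: "(UNIV :: int set) = range ?u \<union> range ?v"
  proof -
    have "l \<in> range ?u \<union> range ?v" for l :: int
    proof (cases "l + \<lfloor>x\<rfloor> \<ge> 0")
      case True
      then have "l = ?u (nat (l + \<lfloor>x\<rfloor>))" by simp
      then show ?thesis by blast
    next
      case False
      then have "l = ?v (nat (- l - 1 - \<lfloor>x\<rfloor>))" by simp
      then show ?thesis by blast
    qed
    then show ?thesis by blast
  qed
  have disj: "range ?u \<inter> range ?v = {}" by auto
  have inj: "inj ?u" "inj ?v" by (auto simp: inj_on_def)
  have u: "(?f \<circ> ?u) = (\<lambda>n. 1 / ((real n + frac x)\<^sup>2 + y\<^sup>2))"
    by (auto simp: fun_eq_iff frac_def algebra_simps)
  have v: "(?f \<circ> ?v) = (\<lambda>n. 1 / ((real n + (1 - frac x))\<^sup>2 + y\<^sup>2))"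
  proof
    fix n
    have "x + of_int (?v n) = - (real n + (1 - frac x))" by (simp add: frac_def)
    then have "(x + of_int (?v n))\<^sup>2 = (real n + (1 - frac x))\<^sup>2" by (metis power2_minus)
    then show "(?f \<circ> ?v) n = 1 / ((real n + (1 - frac x))\<^sup>2 + y\<^sup>2)" by simp
  qed
  have fr: "frac x \<ge> 0" "1 - frac x \<ge> 0" using frac_lt_1[of x] by auto
  note qu = quarter_row_bound[OF fr(1) assms] and qv = quarter_row_bound[OF fr(2) assms]
  have su: "?f summable_on range ?u" and sv: "?f summable_on range ?v"
    using qu(1) qv(1) by (simp_all only: summable_on_reindex[OF inj(1)] summable_on_reindex[OF inj(2)] u v)
  show "?f summable_on UNIV"
    unfolding U by (rule summable_on_Un_disjoint[OF su sv disj])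
  have "infsum ?f UNIV = infsum ?f (range ?u) + infsum ?f (range ?v)"
    unfolding U by (rule infsum_Un_disjoint[OF su sv disj])
  also have "\<dots> \<le> 2 * (1 + 1 / y) / y + 2 * (1 + 1 / y) / y"
    using qu(2) qv(2) by (simp only: infsum_reindex[OF inj(1)] infsum_reindex[OF inj(2)] u v add_mono)
  finally show "infsum ?f UNIV \<le> 4 * (1 + 1 / y) / y" by simp
qed

text \<open>Here c may be arbitrarily close to an integer, so the terms with Re c within 1 of l are set aside.\<close>

lemma row_power_summable:
  assumes "k \<ge> 2"
  shows "(\<lambda>l::int. 1 / (c - of_int l) ^ k :: complex) summable_on UNIV"
proof -
  let ?f = "\<lambda>l::int. 1 / (c - of_int l) ^ k :: complex"
  define F where "F = {l::int. \<bar>Re c - l\<bar> < 1}"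
  have "F \<subseteq> {\<lfloor>Re c\<rfloor> - 1..\<lfloor>Re c\<rfloor> + 1}" unfolding F_def by (auto; linarith)
  then have finF: "finite F" by (rule finite_subset) simp
  have "(\<lambda>l::int. 2 * (1 / ((- Re c + l)\<^sup>2 + 1\<^sup>2))) summable_on UNIV"
    by (intro summable_on_cmult_right half_plane_row_bound(1)) simp
  then have "(\<lambda>l::int. 2 * (1 / ((- Re c + l)\<^sup>2 + 1\<^sup>2))) summable_on (- F)"
    by (rule summable_on_subset) simp
  moreover have "norm (?f l) \<le> 2 * (1 / ((- Re c + l)\<^sup>2 + 1\<^sup>2))" if "l \<in> - F" for l
  proof -
    define a where "a = \<bar>Re c - l\<bar>"
    have a: "a \<ge> 1" using that by (simp add: F_def a_def)
    have "a \<le> norm (c - of_int l)" using abs_Re_le_cmod[of "c - of_int l"] by (simp add: a_def)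
    then have "a ^ k \<le> norm (c - of_int l) ^ k" using a by (intro power_mono) auto
    moreover have "a\<^sup>2 \<le> a ^ k" using a assms by (intro power_increasing) auto
    moreover have "(a\<^sup>2 + 1) / 2 \<le> a\<^sup>2" using a by (simp add: field_simps one_le_power)
    ultimately have le: "(a\<^sup>2 + 1) / 2 \<le> norm (c - of_int l) ^ k" by linarith
    have "norm (?f l) = 1 / norm (c - of_int l) ^ k" by (simp add: norm_divide norm_power)
    also have "\<dots> \<le> 1 / ((a\<^sup>2 + 1) / 2)"
      proof -
      have "0 < (a\<^sup>2 + 1) / 2" by (simp add: add_nonneg_pos)
      with le show ?thesis by (intro divide_left_mono[OF le]) auto
    qed
    also have "\<dots> = 2 * (1 / ((- Re c + l)\<^sup>2 + 1\<^sup>2))"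
      by (simp add: a_def power2_commute)
    finally show ?thesis .
  qed
  ultimately have "(\<lambda>l. norm (?f l)) summable_on (- F)"
    by (rule Infinite_Sum.abs_summable_on_comparison_test')
  then have "?f summable_on (- F)" by (rule abs_summable_summable)
  moreover have "?f summable_on F" using finF by simp
  ultimately have "?f summable_on (- F \<union> F)" by (rule summable_on_Un_disjoint) auto
  then show ?thesis by (simp add: Un_commute)
qed

lemma prod_list_map_mono:
  fixes f g :: "'a \<Rightarrow> real"
  assumes "\<And>x. x \<in> set xs \<Longrightarrow> 0 \<le> f x \<and> f x \<le> g x"
  shows "(\<Prod>x\<leftarrow>xs. f x) \<le> (\<Prod>x\<leftarrow>xs. g x)"
proof -
  have "0 \<le> (\<Prod>x\<leftarrow>xs. f x) \<and> (\<Prod>x\<leftarrow>xs. f x) \<le> (\<Prod>x\<leftarrow>xs. g x)"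
    using assms
  proof (induction xs)
    case (Cons x xs)
    then have "0 \<le> f x" "f x \<le> g x" by auto
    moreover from this have "0 \<le> g x" by linarith
    ultimately show ?case using Cons by (auto intro!: mult_mono)
  qed simp
  then show ?thesis ..
qed

definition lattice_row :: "int \<Rightarrow> point set" where "lattice_row m = {m} \<times> UNIV"

definition strip :: "int \<Rightarrow> point set" where "strip M = {p. \<bar>fst p\<bar> < M}"

definition positive_strip :: "int \<Rightarrow> point set" where
  "positive_strip A = {p. lt (0, 0) p \<and> fst p < A}"

lemma row_eq_image: "lattice_row m = Pair m ` UNIV" and inj_Pair_UNIV: "inj (Pair m)"
  by (auto simp: lattice_row_def inj_on_def)

lemma strip_eq_Sigma: "strip M = {-M<..<M} \<times> UNIV"
  by (auto simp: strip_def)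

text \<open>A strip has finitely many rows, so only the rows need to be summable.\<close>

lemma summable_on_finite_Sigma:
  fixes f :: "'a \<times> 'b \<Rightarrow> complex"
  assumes "finite A" "\<And>a. a \<in> A \<Longrightarrow> (\<lambda>b. f (a, b)) summable_on B a"
  shows "f summable_on Sigma A B"
proof -
  have "(\<lambda>x. norm (f x)) summable_on Sigma A B"
    unfolding Infinite_Sum.abs_summable_on_Sigma_iff using assms
    by (auto simp flip: summable_on_iff_abs_summable_on_complex)
  then show ?thesis by (rule abs_summable_summable)
qed

lemma infsum_strip:
  fixes f :: "point \<Rightarrow> complex"
  assumes "f summable_on strip M"
  shows "infsum f (strip M) = (\<Sum>m\<in>{-M<..<M}. infsum f (lattice_row m))"
proof -
  have "infsum f (strip M) = infsum (\<lambda>m. infsum (\<lambda>l. f (m, l)) UNIV) {-M<..<M}"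
    using assms unfolding strip_eq_Sigma by (rule infsum_Sigma_banach[symmetric])
  also have "\<dots> = (\<Sum>m\<in>{-M<..<M}. infsum f (lattice_row m))"
    by (simp add: row_eq_image infsum_reindex[OF inj_Pair_UNIV] o_def)
  finally show ?thesis .
qed

locale upper_half_plane =
  fixes \<tau> :: complex
  assumes Im_tau: "Im \<tau> > 0"
begin

definition lat :: "point \<Rightarrow> complex" where
  "lat p = of_int (fst p) * \<tau> + of_int (snd p)"

lemma Im_lat: "Im (lat p) = of_int (fst p) * Im \<tau>"
  and Re_lat: "Re (lat p) = of_int (fst p) * Re \<tau> + of_int (snd p)"
  by (simp_all add: lat_def)

lemma lat_add: "lat (p + q) = lat p + lat q"
  and lat_diff: "lat (p - q) = lat p - lat q"
  by (simp_all add: lat_def algebra_simps)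

lemma inj_lat: "inj lat"
proof (rule injI)
  fix p q assume eq: "lat p = lat q"
  then have "Im (lat p) = Im (lat q)" by simp
  then have 1: "fst p = fst q" using Im_tau by (simp add: Im_lat)
  with eq have "snd p = snd q" by (simp add: lat_def)
  with 1 show "p = q" by (simp add: prod_eq_iff)
qed

lemma lat_eq_iff [simp]: "lat p = lat q \<longleftrightarrow> p = q"
  using inj_lat by (rule inj_eq)

lemma lat_eq_0_iff [simp]: "lat p = 0 \<longleftrightarrow> p = (0, 0)"
proof -
  have "lat (0, 0) = 0" by (simp add: lat_def)
  then show ?thesis by (metis lat_eq_iff)
qed

lemma row_summable:
  assumes "k \<ge> 2" shows "(\<lambda>p. 1 / (z - lat p) ^ k) summable_on lattice_row m"
  using row_power_summable[OF assms, of "z - of_int m * \<tau>"]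
  by (simp add: row_eq_image summable_on_reindex[OF inj_Pair_UNIV] o_def lat_def diff_diff_eq)

lemma strip_summable:
  assumes "k \<ge> 2" "S \<subseteq> strip M" shows "(\<lambda>p. 1 / (z - lat p) ^ k) summable_on S"
proof -
  have "(\<lambda>p. 1 / (z - lat p) ^ k) summable_on strip M"
    unfolding strip_eq_Sigma
  proof (rule summable_on_finite_Sigma)
    fix m show "(\<lambda>l. 1 / (z - lat (m, l)) ^ k) summable_on UNIV"
      using row_summable[OF assms(1), of z m]
      by (simp add: row_eq_image summable_on_reindex[OF inj_Pair_UNIV] o_def)
  qed simp
  then show ?thesis using assms(2) by (rule summable_on_subset)
qed

lemma strip_summable_0:
  assumes "k \<ge> 2" "S \<subseteq> strip M" shows "(\<lambda>p. 1 / lat p ^ k) summable_on S"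
proof -
  have "(\<lambda>p. (-1) ^ k * (1 / (0 - lat p) ^ k)) summable_on S"
    by (intro summable_on_cmult_right strip_summable[OF assms])
  moreover have "(-1) ^ k * (1 / (0 - lat p) ^ k) = 1 / lat p ^ k" for p
    by (cases "even k") (simp_all add: power_minus_odd)
  ultimately show ?thesis by simp
qed

lemma row_subset_strip: "lattice_row m \<subseteq> strip (\<bar>m\<bar> + 1)"
  by (auto simp: lattice_row_def strip_def)

lemma positive_strip_subset: "positive_strip A \<subseteq> strip A"
  by (auto simp: positive_strip_def strip_def lt_def)

definition row_const :: real where "row_const = 4 * (1 + 1 / Im \<tau>) / Im \<tau>"

lemma row_const_pos: "row_const > 0"
  using Im_tau by (simp add: row_const_def add_pos_pos)

text \<open>Exponents beyond 2 are traded for powers of the inverse of \<bar>m\<bar> Im \<tau>, the distance of the row from 0.\<close>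

lemma row_norm_sum_le:
  assumes "n \<ge> 2" "m \<noteq> 0"
  shows "(\<Sum>\<^sub>\<infinity>p\<in>lattice_row m. norm (1 / lat p ^ n)) \<le> row_const / \<bar>m\<bar> * (1 / (\<bar>m\<bar> * Im \<tau>)) ^ (n - 2)"
proof -
  define Y where "Y = \<bar>m\<bar> * Im \<tau>"
  have m1: "1 \<le> real_of_int \<bar>m\<bar>" using assms(2) by linarith
  have Y: "Y > 0" using m1 Im_tau by (simp add: Y_def)
  have YI: "Y \<ge> Im \<tau>" using m1 Im_tau by (simp add: Y_def)
  let ?g = "\<lambda>l::int. 1 / ((m * Re \<tau> + l)\<^sup>2 + Y\<^sup>2)"
  note B = half_plane_row_bound[OF Y, of "m * Re \<tau>"]
  have le: "norm (1 / lat (m, l) ^ n) \<le> (1 / Y) ^ (n - 2) * ?g l" for l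
  proof -
    have sq: "(norm (lat (m, l)))\<^sup>2 = (m * Re \<tau> + l)\<^sup>2 + Y\<^sup>2"
      by (simp add: cmod_power2 Im_lat Re_lat Y_def power_mult_distrib)
    have "Y \<le> norm (lat (m, l))"
      using abs_Im_le_cmod[of "lat (m, l)"] Im_tau by (simp add: Im_lat Y_def abs_mult)
    then have "1 / norm (lat (m, l)) \<le> 1 / Y" using Y by (intro frac_le) auto
    then have "(1 / norm (lat (m, l))) ^ (n - 2) \<le> (1 / Y) ^ (n - 2)" by (intro power_mono) auto
    moreover have "(1 / norm (lat (m, l))) ^ n
        = (1 / norm (lat (m, l))) ^ (n - 2) * (1 / norm (lat (m, l)))\<^sup>2"
      using assms(1) by (metis le_add_diff_inverse2 power_add)
    ultimately show ?thesis
      by (simp add: norm_divide norm_power power_one_over[symmetric] sq[symmetric] mult_right_mono)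
  qed
  have "(\<Sum>\<^sub>\<infinity>p\<in>lattice_row m. norm (1 / lat p ^ n)) = (\<Sum>\<^sub>\<infinity>l. norm (1 / lat (m, l) ^ n))"
    by (simp add: row_eq_image infsum_reindex[OF inj_Pair_UNIV] o_def)
  also have "\<dots> \<le> (\<Sum>\<^sub>\<infinity>l. (1 / Y) ^ (n - 2) * ?g l)"
    by (intro infsum_mono summable_on_cmult_right B(1) le
        Infinite_Sum.abs_summable_on_comparison_test'[OF summable_on_cmult_right[OF B(1)] le])
  also have "\<dots> = (1 / Y) ^ (n - 2) * (\<Sum>\<^sub>\<infinity>l. ?g l)"
    by (rule infsum_cmult_right')
  also have "\<dots> \<le> (1 / Y) ^ (n - 2) * (4 * (1 + 1 / Y) / Y)"
    using B(2) Y by (intro mult_left_mono) auto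
  also have "4 * (1 + 1 / Y) / Y \<le> row_const / \<bar>m\<bar>"
  proof -
    have "1 / Y \<le> 1 / Im \<tau>" using YI Im_tau by (intro divide_left_mono) auto
    then have "4 * (1 + 1 / Y) / Y \<le> 4 * (1 + 1 / Im \<tau>) / Y" using Y by (intro divide_right_mono) auto
    also have "\<dots> = row_const / \<bar>m\<bar>" by (simp add: row_const_def Y_def mult.commute)
    finally show ?thesis .
  qed
  then have "(1 / Y) ^ (n - 2) * (4 * (1 + 1 / Y) / Y) \<le> (1 / Y) ^ (n - 2) * (row_const / \<bar>m\<bar>)"
    using Y by (intro mult_left_mono) auto
  finally show ?thesis by (simp add: Y_def mult.commute)
qed

text \<open>The sum of absolute values is only O(1 / \<bar>m\<bar>). But with x = m \<tau> + l, the term 1 / x^2 differs from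
1 / x - 1 / (x + 1), whose sum over l is 0, by 1 / (x^2 (x + 1)).\<close>

lemma row_sum_squares_le:
  assumes "m \<noteq> 0"
  shows "norm (\<Sum>\<^sub>\<infinity>p\<in>lattice_row m. 1 / lat p ^ 2) \<le> row_const / Im \<tau> / (of_int m)\<^sup>2"
proof -
  define Y where "Y = \<bar>m\<bar> * Im \<tau>"
  have m1: "1 \<le> real_of_int \<bar>m\<bar>" using assms by linarith
  have Y: "Y > 0" using m1 Im_tau by (simp add: Y_def)
  define a where "a l = 1 / lat (m, l)" for l
  define d where "d l = a l - a (l + 1)" for l
  have lat1: "lat (m, l + 1) = lat (m, l) + 1" for l by (simp add: lat_def)
  have nz: "lat (m, l) \<noteq> 0" for l using assms by simp
  have nY: "norm (a l) \<le> 1 / Y" for l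
  proof -
    have "Y \<le> norm (lat (m, l))"
      using abs_Im_le_cmod[of "lat (m, l)"] Im_tau by (simp add: Im_lat Y_def abs_mult)
    then show ?thesis using Y by (simp add: a_def norm_divide frac_le)
  qed
  have s2: "(\<lambda>l. (a l)\<^sup>2) summable_on UNIV"
    using strip_summable_0[of 2, OF _ row_subset_strip[of m]]
    by (simp add: row_eq_image summable_on_reindex[OF inj_Pair_UNIV] o_def a_def power_one_over)
  then have n2: "(\<lambda>l. norm ((a l)\<^sup>2)) summable_on UNIV"
    by (simp flip: summable_on_iff_abs_summable_on_complex)
  have split: "(a l)\<^sup>2 = d l + (a l)\<^sup>2 * a (l + 1)" for l
  proof -
    define x where "x = lat (m, l)"
    have "x \<noteq> 0" "x + 1 \<noteq> 0" using nz[of l] nz[of "l + 1", unfolded lat1] unfolding x_def by blast+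
    then show ?thesis
      unfolding d_def a_def lat1 x_def[symmetric] by (simp add: divide_simps power2_eq_square)
  qed
  have le: "norm ((a l)\<^sup>2 * a (l + 1)) \<le> norm ((a l)\<^sup>2) * (1 / Y)" for l
    unfolding norm_mult by (intro mult_left_mono nY) auto
  have n3: "(\<lambda>l. norm ((a l)\<^sup>2 * a (l + 1))) summable_on UNIV"
    by (rule Infinite_Sum.abs_summable_on_comparison_test'[OF summable_on_cmult_left[OF n2] le])
  then have s3: "(\<lambda>l. (a l)\<^sup>2 * a (l + 1)) summable_on UNIV" by (rule abs_summable_summable)
  have "(\<lambda>l. (a l)\<^sup>2 + - ((a l)\<^sup>2 * a (l + 1))) summable_on UNIV"
    by (intro summable_on_add s2 summable_on_uminus[THEN iffD2] s3)
  moreover have "(a l)\<^sup>2 + - ((a l)\<^sup>2 * a (l + 1)) = d l" for l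
    using split[of l] by (metis add_diff_cancel_right' diff_conv_add_uminus)
  ultimately have sd: "d summable_on UNIV" by simp
  have d0: "infsum d UNIV = 0"
  proof (rule LIMSEQ_unique)
    show "(\<lambda>N. sum d {- int N..<int N}) \<longlonglongrightarrow> infsum d UNIV"
    proof (rule tendsto_sum_increasing[OF sd])
      show "incseq (\<lambda>N. {- int N..<int N})" by (auto simp: incseq_def)
      have "l \<in> {- int (nat \<bar>l\<bar> + 1)..<int (nat \<bar>l\<bar> + 1)}" for l by auto
      then show "(\<Union>N. {- int N..<int N}) = UNIV" by blast
    qed simp
    have "sum d {- int N..<int N} = a (- int N) - a (int N)" for N
    proof (induction N)
      case (Suc N)
      have e: "- int (Suc N) = - int N - 1" "int (Suc N) = int N + 1" by simp_all
      have "{- int N - 1..<int N + 1} = insert (- int N - 1) (insert (int N) {- int N..<int N})"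
        by auto
      then have "sum d {- int N - 1..<int N + 1} = d (- int N - 1) + (d (int N) + sum d {- int N..<int N})"
        by simp
      also have "\<dots> = a (- int N - 1) - a (int N + 1)" unfolding Suc by (simp add: d_def)
      finally show ?case by (simp only: e(1)) (simp only: e(2))
    qed simp
    moreover have "(\<lambda>N. a (- int N) - a (int N)) \<longlonglongrightarrow> 0"
    proof (rule tendsto_norm_zero_cancel)
      have "(\<lambda>N. norm (a (s * int N))) \<longlonglongrightarrow> 0" if "s = 1 \<or> s = -1" for s
      proof (rule tendsto_sandwich[OF _ _ tendsto_const])
        have "norm (a (s * int N)) \<le> 1 / (real N - \<bar>m * Re \<tau>\<bar>)" if "real N > \<bar>m * Re \<tau>\<bar>" for N
        proof -
          have "real N - \<bar>m * Re \<tau>\<bar> \<le> \<bar>Re (lat (m, s * int N))\<bar>"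
            using \<open>s = 1 \<or> s = -1\<close> by (auto simp: Re_lat)
          also have "\<dots> \<le> norm (lat (m, s * int N))" by (rule abs_Re_le_cmod)
          finally show ?thesis using that by (simp add: a_def norm_divide frac_le)
        qed
        moreover have "\<forall>\<^sub>F N in sequentially. real N > \<bar>m * Re \<tau>\<bar>"
          using filterlim_real_sequentially by (simp add: filterlim_at_top_dense)
        ultimately show "\<forall>\<^sub>F N in sequentially. norm (a (s * int N)) \<le> 1 / (real N - \<bar>m * Re \<tau>\<bar>)"
          by (rule eventually_mono[rotated])
        show "(\<lambda>N. 1 / (real N - \<bar>m * Re \<tau>\<bar>)) \<longlonglongrightarrow> 0" by real_asymp
      qed auto
      from this[of 1] this[of "-1"]
      have *: "(\<lambda>N. norm (a (- int N)) + norm (a (int N))) \<longlonglongrightarrow> 0"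
        using tendsto_add_zero by fastforce
      show "(\<lambda>N. norm (a (- int N) - a (int N))) \<longlonglongrightarrow> 0"
        by (rule tendsto_sandwich[OF _ _ tendsto_const *]) (auto intro: always_eventually norm_triangle_ineq4)
    qed
    ultimately show "(\<lambda>N. sum d {- int N..<int N}) \<longlonglongrightarrow> 0" by simp
  qed
  have "(\<Sum>\<^sub>\<infinity>p\<in>lattice_row m. 1 / lat p ^ 2) = (\<Sum>\<^sub>\<infinity>l. (a l)\<^sup>2)"
    by (simp add: row_eq_image infsum_reindex[OF inj_Pair_UNIV] o_def a_def power_one_over)
  also have "\<dots> = (\<Sum>\<^sub>\<infinity>l. d l + (a l)\<^sup>2 * a (l + 1))" using split by simp
  also have "\<dots> = (\<Sum>\<^sub>\<infinity>l. (a l)\<^sup>2 * a (l + 1))" by (simp add: infsum_add[OF sd s3] d0)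
  also have "norm \<dots> \<le> (\<Sum>\<^sub>\<infinity>l. norm ((a l)\<^sup>2 * a (l + 1)))" by (rule norm_infsum_bound[OF n3])
  also have "\<dots> \<le> (\<Sum>\<^sub>\<infinity>l. norm ((a l)\<^sup>2) * (1 / Y))"
    by (rule infsum_mono[OF n3 summable_on_cmult_left[OF n2] le])
  also have "\<dots> = (\<Sum>\<^sub>\<infinity>l. norm ((a l)\<^sup>2)) * (1 / Y)" by (rule infsum_cmult_left')
  also have "(\<Sum>\<^sub>\<infinity>l. norm ((a l)\<^sup>2)) = (\<Sum>\<^sub>\<infinity>p\<in>lattice_row m. norm (1 / lat p ^ 2))"
    by (simp add: row_eq_image infsum_reindex[OF inj_Pair_UNIV] o_def a_def power_one_over)
  also have "\<dots> * (1 / Y) \<le> row_const / \<bar>m\<bar> * (1 / Y)"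
    using row_norm_sum_le[of 2 m] assms Y by (intro mult_right_mono) auto
  also have "\<dots> = row_const / Im \<tau> / (of_int m)\<^sup>2"
    by (simp add: Y_def power2_eq_square mult.commute mult.left_commute)
  finally show ?thesis .
qed

text \<open>Two or more factors give O(m^(-2)) from the absolute row sums, and so does a single exponent at least 3.
Only a single exponent 2 needs cancellation.\<close>

lemma row_chain_sum_bound:
  assumes "ns \<noteq> []" "\<And>n. n \<in> set ns \<Longrightarrow> n \<ge> 2"
  obtains C where "\<And>m. m \<noteq> 0 \<Longrightarrow> norm (chain_sum lat (lattice_row m) ns) \<le> C / (of_int m)\<^sup>2"
proof -
  define E where "E n = row_const * (1 / Im \<tau>) ^ (n - 2)" for n
  have E0: "E n \<ge> 0" for n using row_const_pos Im_tau by (simp add: E_def)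
  have fac: "(\<Sum>\<^sub>\<infinity>p\<in>lattice_row m. norm (1 / lat p ^ n)) \<le> E n / \<bar>m\<bar> * (1 / \<bar>m\<bar>) ^ (n - 2)"
    if "n \<ge> 2" "m \<noteq> 0" for n m
    using row_norm_sum_le[OF that] by (simp add: E_def power_mult_distrib power_one_over power_divide mult.commute mult.left_commute)
  have inv1: "1 / real_of_int \<bar>m\<bar> \<le> 1" if "m \<noteq> 0" for m
    using that by (simp add: divide_simps)
  consider n where "ns = [n]" "n \<noteq> 2" | "ns = [2]" | "length ns \<ge> 2"
    using assms(1) by (cases ns rule: remdups_adj.cases) auto
  then show ?thesis
  proof cases
    case 1
    then have n3: "n \<ge> 3" using assms(2)[of n] by simp
    have "norm (chain_sum lat (lattice_row m) ns) \<le> E n / (of_int m)\<^sup>2" if m: "m \<noteq> 0" for m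
    proof -
      have "norm (chain_sum lat (lattice_row m) ns) \<le> (\<Sum>\<^sub>\<infinity>p\<in>lattice_row m. norm (1 / lat p ^ n))"
        using norm_chain_sum_le[of ns lat "lattice_row m"] strip_summable_0[of n, OF _ row_subset_strip[of m]] n3
        by (simp add: 1)
      also have "\<dots> \<le> E n / \<bar>m\<bar> * (1 / \<bar>m\<bar>) ^ (n - 2)" using fac n3 m by simp
      also have "\<dots> \<le> E n / \<bar>m\<bar> * (1 / \<bar>m\<bar>) ^ 1"
        using inv1[OF m] n3 E0 by (intro mult_left_mono power_decreasing) auto
      also have "\<dots> = E n / (of_int m)\<^sup>2" by (simp add: power2_eq_square)
      finally show ?thesis .
    qed
    then show ?thesis by (rule that)
  next
    case 2
    then show ?thesis
      by (intro that[of "row_const / Im \<tau>"]) (use row_sum_squares_le in \<open>simp only: chain_sum_single\<close>)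
  next
    case 3
    have "norm (chain_sum lat (lattice_row m) ns) \<le> (\<Prod>n\<leftarrow>ns. E n) / (of_int m)\<^sup>2" if m: "m \<noteq> 0" for m
    proof -
      have "norm (chain_sum lat (lattice_row m) ns) \<le> (\<Prod>n\<leftarrow>ns. \<Sum>\<^sub>\<infinity>p\<in>lattice_row m. norm (1 / lat p ^ n))"
        by (rule norm_chain_sum_le) (use assms(2) strip_summable_0[OF _ row_subset_strip[of m]] in auto)
      also have "\<dots> \<le> (\<Prod>n\<leftarrow>ns. E n / \<bar>m\<bar>)"
      proof (rule prod_list_map_mono)
        fix n assume "n \<in> set ns"
        then have "n \<ge> 2" by (rule assms(2))
        have "E n / \<bar>m\<bar> * (1 / \<bar>m\<bar>) ^ (n - 2) \<le> E n / \<bar>m\<bar> * 1"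
          using inv1[OF m] E0 by (intro mult_left_mono power_le_one) auto
        then show "0 \<le> (\<Sum>\<^sub>\<infinity>p\<in>lattice_row m. norm (1 / lat p ^ n)) \<and>
            (\<Sum>\<^sub>\<infinity>p\<in>lattice_row m. norm (1 / lat p ^ n)) \<le> E n / \<bar>m\<bar>"
          using fac[OF \<open>n \<ge> 2\<close> m] by (auto intro: infsum_nonneg)
      qed
      also have "\<dots> = (\<Prod>n\<leftarrow>ns. E n) * (1 / \<bar>m\<bar>) ^ length ns"
        by (induction ns) (simp_all add: field_simps)
      also have "\<dots> \<le> (\<Prod>n\<leftarrow>ns. E n) * (1 / \<bar>m\<bar>)\<^sup>2"
        using inv1[OF m] 3 E0
        by (intro mult_left_mono power_decreasing prod_list_nonneg) auto
      also have "\<dots> = (\<Prod>n\<leftarrow>ns. E n) / (of_int m)\<^sup>2" by (simp add: power_one_over)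
      finally show ?thesis .
    qed
    then show ?thesis by (rule that)
  qed
qed

section \<open>Convergence of the truncated sums\<close>

text \<open>The multiple Eisenstein series is the limit of these sums.\<close>

definition truncated_G :: "int \<Rightarrow> nat list \<Rightarrow> complex" where
  "truncated_G A ns = chain_sum lat (positive_strip A) ns"

lemma truncated_G_Nil [simp]: "truncated_G A [] = 1"
  by (simp add: truncated_G_def)

lemma truncated_G_Suc:
  assumes "A \<ge> 1" "\<And>n. n \<in> set ns \<Longrightarrow> n \<ge> 2"
  shows "truncated_G (A + 1) ns =
     (\<Sum>i\<le>length ns. truncated_G A (take i ns) * chain_sum lat (lattice_row A) (drop i ns))"
proof -
  have "positive_strip (A + 1) = positive_strip A \<union> lattice_row A"
    using assms(1) by (auto simp: positive_strip_def lattice_row_def lt_def)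
  moreover have "lt p q" if "p \<in> positive_strip A" "q \<in> lattice_row A" for p q
    using that by (auto simp: positive_strip_def lattice_row_def lt_def)
  moreover have "(\<lambda>p. 1 / lat p ^ n) summable_on positive_strip A"
    and "(\<lambda>p. 1 / lat p ^ n) summable_on lattice_row A" if "n \<in> set ns" for n
    using that assms(2) strip_summable_0[OF _ positive_strip_subset] strip_summable_0[OF _ row_subset_strip]
    by blast+
  ultimately show ?thesis
    unfolding truncated_G_def by (simp only: chain_sum_Un)
qed

text \<open>Passing from A to A + 1 adds chains with a nonempty last part in row A. By induction on the length the
part below row A is bounded, so the increments are O(A^(-2)).\<close>

lemma truncated_G_convergent:
  assumes "\<And>n. n \<in> set ns \<Longrightarrow> n \<ge> 2"
  shows "convergent (\<lambda>A. truncated_G (int A) ns)"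
  using assms
proof (induction "length ns" arbitrary: ns rule: less_induct)
  case less
  note ge2 = less.prems
  let ?g = "\<lambda>A. truncated_G (int A) ns"
  have "\<exists>C. \<forall>A\<ge>1. norm (truncated_G (int A) (take i ns) * chain_sum lat (lattice_row A) (drop i ns))
        \<le> C / (real A)\<^sup>2" if i: "i < length ns" for i
  proof -
    have "convergent (\<lambda>A. truncated_G (int A) (take i ns))"
      using i ge2[OF in_set_takeD] by (intro less.hyps) auto
    then have "Bseq (\<lambda>A. truncated_G (int A) (take i ns))" by (rule convergent_imp_Bseq)
    then obtain B where B: "\<And>A. norm (truncated_G (int A) (take i ns)) \<le> B" "B > 0"
      by (metis BseqE)
    obtain C where C: "\<And>m. m \<noteq> 0 \<Longrightarrow> norm (chain_sum lat (lattice_row m) (drop i ns)) \<le> C / (of_int m)\<^sup>2"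
      using row_chain_sum_bound[of "drop i ns"] i ge2 by (metis drop_eq_Nil in_set_dropD not_le)
    have "norm (truncated_G (int A) (take i ns) * chain_sum lat (lattice_row A) (drop i ns))
       \<le> B * C / (real A)\<^sup>2" if "A \<ge> 1" for A
      unfolding norm_mult times_divide_eq_right[symmetric]
      using B C[of "int A"] that by (intro mult_mono) auto
    then show ?thesis by blast
  qed
  then obtain C where C: "\<And>i A. i < length ns \<Longrightarrow> A \<ge> 1 \<Longrightarrow>
      norm (truncated_G (int A) (take i ns) * chain_sum lat (lattice_row A) (drop i ns)) \<le> C i / (real A)\<^sup>2"
    by metis
  have diff: "?g (Suc A) - ?g A
      = (\<Sum>i<length ns. truncated_G (int A) (take i ns) * chain_sum lat (lattice_row A) (drop i ns))"
    if "A \<ge> 1" for A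
    using truncated_G_Suc[of "int A" ns] that ge2
    by (simp add: lessThan_Suc_atMost[symmetric] add.commute)
  have "summable (\<lambda>A. ?g (Suc A) - ?g A)"
  proof (rule summable_comparison_test_ev)
    show "\<forall>\<^sub>F A in sequentially. norm (?g (Suc A) - ?g A) \<le> (\<Sum>i<length ns. C i) * (1 / (real A)\<^sup>2)"
      using eventually_ge_at_top[of 1]
    proof eventually_elim
      case (elim A)
      have "norm (?g (Suc A) - ?g A) \<le> (\<Sum>i<length ns. C i / (real A)\<^sup>2)"
        unfolding diff[OF elim] using C elim by (intro sum_norm_le) auto
      then show ?case by (simp add: sum_divide_distrib)
    qed
    show "summable (\<lambda>A. (\<Sum>i<length ns. C i) * (1 / (real A)\<^sup>2))"
      using inverse_power_summable[of 2, where 'a = real]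
      by (intro summable_mult) (simp add: inverse_eq_divide)
  qed
  then have "convergent (\<lambda>n. \<Sum>A<n. ?g (Suc A) - ?g A)" by (simp add: summable_iff_convergent)
  then have "convergent (\<lambda>n. ?g n - ?g 0)" by (simp only: sum_lessThan_telescope[of ?g])
  then have "convergent (\<lambda>n. ?g n - ?g 0 + ?g 0)"
    by (intro convergent_add convergent_const)
  then show ?case by simp
qed

section \<open>Splitting a chain at one of its points\<close>

text \<open>Exponents are indexed from 1, list positions from 0, and position i - 1 holds p.\<close>

lemma chain_prod_eq_power_weight:
  fixes g :: "point \<Rightarrow> complex"
  assumes "length us = i - 1" "length vs = r - i" "i \<in> {1..r}"
  shows "(\<Prod>j\<in>{1..r} - {i}. 1 / g ((us @ p # vs) ! (j - 1)) ^ n j)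
     = power_weight (map n [1..<i]) (map g us) * power_weight (map n [i+1..<r+1]) (map g vs)"
proof -
  let ?f = "\<lambda>j. 1 / g ((us @ p # vs) ! (j - 1)) ^ n j"
  have "{1..r} - {i} = {1..<i} \<union> {i+1..<r+1}" using assms(3) by auto
  then have "prod ?f ({1..r} - {i}) = prod ?f {1..<i} * prod ?f {i+1..<r+1}"
    by (simp add: prod.union_disjoint)
  also have "prod ?f {1..<i} = power_weight (map n [1..<i]) (map g us)"
  proof -
    have "power_weight (map n [1..<i]) (map g us) = (\<Prod>j<i - 1. 1 / g (us ! j) ^ n (j + 1))"
      using assms by (auto simp: power_weight_nth intro!: prod.cong)
    also have "\<dots> = prod ?f {1..<i}"
      by (rule prod.reindex_bij_witness[of _ "\<lambda>j. j - 1" "\<lambda>j. j + 1"])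
        (use assms in \<open>auto simp: nth_append\<close>)
    finally show ?thesis ..
  qed
  also have "prod ?f {i+1..<r+1} = power_weight (map n [i+1..<r+1]) (map g vs)"
  proof -
    have "power_weight (map n [i+1..<r+1]) (map g vs) = (\<Prod>j<r - i. 1 / g (vs ! j) ^ n (i + 1 + j))"
      using assms by (auto simp: power_weight_nth simp del: upt_Suc intro!: prod.cong)
    also have "\<dots> = prod ?f {i+1..<r+1}"
      by (rule prod.reindex_bij_witness[of _ "\<lambda>j. j - i - 1" "\<lambda>j. j + i + 1"])
        (use assms in \<open>auto simp: nth_append nth_Cons' add.commute\<close>)
    finally show ?thesis ..
  qed
  finally show ?thesis .
qed

lemma lt_diff_left: "lt (p - q) (p - q') \<longleftrightarrow> lt q' q"
  and lt_diff_right: "lt (q - p) (q' - p) \<longleftrightarrow> lt q q'"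
  and lt_add_left: "lt (p + q) (p + q') \<longleftrightarrow> lt q q'"
  by (auto simp: lt_def)

text \<open>A chain is determined by its i-th point p together with the points before and after it, which are
recorded by their differences with p, taken positive so that both parts become chains above 0. For the part
before p this reverses the order, which is why the left factor of the final formula carries the indices
i - 1, ..., 1.\<close>

lemma chain_lists_split_at:
  assumes "i \<in> {1..r}"
  shows "bij_betw (\<lambda>(p, us, vs). rev (map (\<lambda>q. p - q) us) @ p # map (\<lambda>q. p + q) vs)
     (SIGMA p:strip M. chain_lists (positive_strip (fst p + M)) (i - 1)
        \<times> chain_lists (positive_strip (M - fst p)) (r - i))
     (chain_lists (strip M) r)"
proof (rule bij_betw_byWitness[where f' = "\<lambda>ps. (ps ! (i - 1),
    map (\<lambda>q. ps ! (i - 1) - q) (rev (take (i - 1) ps)), map (\<lambda>q. q - ps ! (i - 1)) (drop i ps))"],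
    goal_cases)
  case 1
  show ?case using assms by (auto simp: chain_lists_def rev_map o_def nth_append)
next
  case 2
  show ?case
  proof
    fix ps assume "ps \<in> chain_lists (strip M) r"
    then have "length ps = r" by (simp add: chain_lists_def)
    then have "ps = take (i - 1) ps @ ps ! (i - 1) # drop i ps"
      using id_take_nth_drop[of "i - 1" ps] assms by auto
    then show "(case (ps ! (i - 1), map (\<lambda>q. ps ! (i - 1) - q) (rev (take (i - 1) ps)),
         map (\<lambda>q. q - ps ! (i - 1)) (drop i ps)) of
         (p, us, vs) \<Rightarrow> rev (map (\<lambda>q. p - q) us) @ p # map (\<lambda>q. p + q) vs) = ps"
      by (simp add: rev_map o_def)
  qed
next
  case 3
  show ?case
  proof
    fix ps assume "ps \<in> (\<lambda>(p, us, vs). rev (map (\<lambda>q. p - q) us) @ p # map (\<lambda>q. p + q) vs) `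
     (SIGMA p:strip M. chain_lists (positive_strip (fst p + M)) (i - 1)
        \<times> chain_lists (positive_strip (M - fst p)) (r - i))"
    then obtain p us vs where ps: "ps = rev (map (\<lambda>q. p - q) us) @ p # map (\<lambda>q. p + q) vs"
      and p: "p \<in> strip M" and us: "us \<in> chain_lists (positive_strip (fst p + M)) (i - 1)"
      and vs: "vs \<in> chain_lists (positive_strip (M - fst p)) (r - i)" by auto
    have u: "lt (p - q) p" "p - q \<in> strip M" if "q \<in> set us" for q
      using us p that by (auto simp: chain_lists_def positive_strip_def strip_def lt_def dest!: subsetD)
    have v: "lt p (p + q)" "p + q \<in> strip M" if "q \<in> set vs" for q
      using vs p that by (auto simp: chain_lists_def positive_strip_def strip_def lt_def dest!: subsetD)
    have "sorted_wrt lt (rev (map (\<lambda>q. p - q) us))"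
      using us by (simp add: chain_lists_def sorted_wrt_rev sorted_wrt_map lt_diff_left)
    moreover have "sorted_wrt lt (map (\<lambda>q. p + q) vs)"
      using vs by (simp add: chain_lists_def sorted_wrt_map lt_add_left)
    ultimately have "sorted_wrt lt ps"
      unfolding ps using u(1) v(1) lt_trans[OF u(1) v(1)] by (simp add: sorted_wrt_append)
    moreover have "set ps \<subseteq> strip M" unfolding ps using u(2) v(2) p by auto
    moreover have "length ps = r" unfolding ps using us vs assms by (simp add: chain_lists_def)
    ultimately show "ps \<in> chain_lists (strip M) r" by (simp add: chain_lists_def)
  qed
next
  case 4
  show ?case
  proof
    fix x assume "x \<in> (\<lambda>ps. (ps ! (i - 1), map (\<lambda>q. ps ! (i - 1) - q) (rev (take (i - 1) ps)),
        map (\<lambda>q. q - ps ! (i - 1)) (drop i ps))) ` chain_lists (strip M) r"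
    then obtain ps where x: "x = (ps ! (i - 1), map (\<lambda>q. ps ! (i - 1) - q) (rev (take (i - 1) ps)),
        map (\<lambda>q. q - ps ! (i - 1)) (drop i ps))" and ps: "ps \<in> chain_lists (strip M) r" by blast
    define p us vs where "p = ps ! (i - 1)" and "us = take (i - 1) ps" and "vs = drop i ps"
    have len: "length us = i - 1" "length vs = r - i"
      using ps assms by (auto simp: us_def vs_def chain_lists_def)
    have "ps = us @ p # vs"
      using id_take_nth_drop[of "i - 1" ps] ps assms by (auto simp: us_def vs_def p_def chain_lists_def)
    then have s: "sorted_wrt lt (us @ p # vs)" "set us \<subseteq> strip M" "p \<in> strip M" "set vs \<subseteq> strip M"
      using ps by (auto simp: chain_lists_def)
    have "map (\<lambda>q. p - q) (rev us) \<in> chain_lists (positive_strip (fst p + M)) (i - 1)"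
    proof -
      have "sorted_wrt lt (map (\<lambda>q. p - q) (rev us))"
        using s(1) by (simp add: sorted_wrt_append sorted_wrt_map sorted_wrt_rev lt_diff_left)
      moreover have "p - q \<in> positive_strip (fst p + M)" if "q \<in> set us" for q
        using s(1,2) that by (auto simp: sorted_wrt_append positive_strip_def strip_def lt_def)
      ultimately show ?thesis using len by (auto simp: chain_lists_def)
    qed
    moreover have "map (\<lambda>q. q - p) vs \<in> chain_lists (positive_strip (M - fst p)) (r - i)"
    proof -
      have "sorted_wrt lt (map (\<lambda>q. q - p) vs)"
        using s(1) by (simp add: sorted_wrt_append sorted_wrt_map lt_diff_right)
      moreover have "q - p \<in> positive_strip (M - fst p)" if "q \<in> set vs" for q
        using s(1,4) that by (auto simp: sorted_wrt_append positive_strip_def strip_def lt_def)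
      ultimately show ?thesis using len by (auto simp: chain_lists_def)
    qed
    ultimately show "x \<in> (SIGMA p:strip M. chain_lists (positive_strip (fst p + M)) (i - 1)
        \<times> chain_lists (positive_strip (M - fst p)) (r - i))"
      using s(3) unfolding x p_def[symmetric] us_def[symmetric] vs_def[symmetric] by auto
  qed
qed

lemma power_weight_split_at:
  assumes "i \<in> {1..r}" "length us = i - 1" "length vs = r - i"
    and ps: "ps = rev (map (\<lambda>q. p - q) us) @ p # map (\<lambda>q. p + q) vs"
  shows "(\<Prod>j\<in>{1..r} - {i}. 1 / (lat (ps ! (i - 1)) - lat (ps ! (j - 1))) ^ n j)
     = (-1) ^ (\<Sum>j=i+1..r. n j) * (power_weight (map n (rev [1..<i])) (map lat us)
        * power_weight (map n [i+1..<r+1]) (map lat vs))"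
proof -
  have "ps ! (i - 1) = p" unfolding ps using assms(2) by (simp add: nth_append)
  then have "(\<Prod>j\<in>{1..r} - {i}. 1 / (lat (ps ! (i - 1)) - lat (ps ! (j - 1))) ^ n j)
    = power_weight (map n [1..<i]) (map (\<lambda>q. lat p - lat q) (rev (map (\<lambda>q. p - q) us)))
     * power_weight (map n [i+1..<r+1]) (map (\<lambda>q. lat p - lat q) (map (\<lambda>q. p + q) vs))"
    using chain_prod_eq_power_weight[of "rev (map (\<lambda>q. p - q) us)" i "map (\<lambda>q. p + q) vs" r
        "\<lambda>q. lat p - lat q" p n] assms(1-3) unfolding ps by simp
  also have "map (\<lambda>q. lat p - lat q) (rev (map (\<lambda>q. p - q) us)) = rev (map lat us)"
    by (simp add: rev_map o_def lat_diff)
  also have "power_weight (map n [1..<i]) (rev (map lat us)) = power_weight (map n (rev [1..<i])) (map lat us)"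
    using power_weight_rev[of "map n (rev [1..<i])" "map lat us"] assms(2) by (simp add: rev_map)
  also have "map (\<lambda>q. lat p - lat q) (map (\<lambda>q. p + q) vs) = map uminus (map lat vs)"
    by (simp add: lat_add)
  also have "power_weight (map n [i+1..<r+1]) (map uminus (map lat vs))
      = (-1) ^ (\<Sum>j=i+1..r. n j) * power_weight (map n [i+1..<r+1]) (map lat vs)"
  proof -
    have "sum_list (map n [i+1..<r+1]) = (\<Sum>j=i+1..r. n j)"
      by (simp add: sum_list_distinct_conv_sum_set atLeastLessThanSuc_atLeastAtMost del: upt_Suc)
    then show ?thesis
      using power_weight_uminus[of "map n [i+1..<r+1]" "map lat vs"] assms(3) by (simp del: upt_Suc)
  qed
  finally show ?thesis by (simp only: mult.left_commute)
qed

text \<open>Relative to the i-th point, the points before it and the points after it are independent chains above 0.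
The sign turns p - q into the positive q - p for the points q after the i-th point p.\<close>

theorem chain_split_has_sum:
  assumes i: "i \<in> {1..r}" and n: "\<And>j. j \<in> {1..r} - {i} \<Longrightarrow> n j \<ge> 2"
    and H: "H summable_on strip M"
  shows "((\<lambda>ps. H (ps ! (i - 1)) * (\<Prod>j\<in>{1..r} - {i}. 1 / (lat (ps ! (i - 1)) - lat (ps ! (j - 1))) ^ n j))
    has_sum (-1) ^ (\<Sum>j=i+1..r. n j) * (\<Sum>\<^sub>\<infinity>p\<in>strip M. H p *
       (truncated_G (fst p + M) (map n (rev [1..<i])) * truncated_G (M - fst p) (map n [i+1..<r+1]))))
    (chain_lists (strip M) r)"
proof -
  let ?as = "map n (rev [1..<i])" and ?bs = "map n [i+1..<r+1]" and ?s = "(-1 :: complex) ^ (\<Sum>j=i+1..r. n j)"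
  let ?C = "\<lambda>p. chain_lists (positive_strip (fst p + M)) (i - 1) \<times> chain_lists (positive_strip (M - fst p)) (r - i)"
  let ?D = "SIGMA p:strip M. ?C p"
  let ?L = "\<lambda>us. power_weight ?as (map lat us)" and ?R = "\<lambda>vs. power_weight ?bs (map lat vs)"
  let ?F = "\<lambda>ps. H (ps ! (i - 1)) * (\<Prod>j\<in>{1..r} - {i}. 1 / (lat (ps ! (i - 1)) - lat (ps ! (j - 1))) ^ n j)"
  let ?G = "\<lambda>(p, x). ?s * H p * (case x of (us, vs) \<Rightarrow> ?L us * ?R vs)"
  have as: "n' \<ge> 2" if "n' \<in> set ?as" for n'
  proof -
    from that obtain j where "n' = n j" "j \<in> {1..<i}" by auto
    then show ?thesis using n[of j] i by simp
  qed
  have bs: "n' \<ge> 2" if "n' \<in> set ?bs" for n'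
  proof -
    from that obtain j where "n' = n j" "j \<in> {i+1..<r+1}" by (auto simp del: upt_Suc)
    then show ?thesis using n[of j] i by simp
  qed
  have la: "length ?as = i - 1" and lb: "length ?bs = r - i" using i by auto
  have L: "?L summable_on chain_lists (positive_strip A) (i - 1)" for A
    using chain_summable[of ?as lat "positive_strip A"] strip_summable_0[OF as positive_strip_subset]
    unfolding la by blast
  have R: "?R summable_on chain_lists (positive_strip A) (r - i)" for A
    using chain_summable[of ?bs lat "positive_strip A"] strip_summable_0[OF bs positive_strip_subset]
    unfolding lb by blast
  have "?G summable_on strip M \<times> (chain_lists (positive_strip (2 * M)) (i - 1)
     \<times> chain_lists (positive_strip (2 * M)) (r - i))"
    using summable_on_product[OF summable_on_cmult_right[OF H, of ?s] summable_on_product[OF L R]] .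
  \<comment> \<open>The height of the two strips depends on p, but 2 M bounds it, and over the larger product the sum factors.\<close>
  moreover have "?D \<subseteq> strip M \<times> (chain_lists (positive_strip (2 * M)) (i - 1)
     \<times> chain_lists (positive_strip (2 * M)) (r - i))"
  proof -
    have "positive_strip (fst p + M) \<subseteq> positive_strip (2 * M)" "positive_strip (M - fst p) \<subseteq> positive_strip (2 * M)"
      if "p \<in> strip M" for p using that by (auto simp: positive_strip_def strip_def)
    then show ?thesis by (intro Sigma_mono chain_lists_mono) auto
  qed
  ultimately have G: "?G summable_on ?D" by (rule summable_on_subset)
  have "infsum ?G ?D = (\<Sum>\<^sub>\<infinity>p\<in>strip M. \<Sum>\<^sub>\<infinity>x\<in>?C p. ?G (p, x))"
    by (rule infsum_Sigma_banach[OF G, symmetric])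
  also have "\<dots> = (\<Sum>\<^sub>\<infinity>p\<in>strip M. ?s * (H p * (truncated_G (fst p + M) ?as * truncated_G (M - fst p) ?bs)))"
  proof (rule infsum_cong)
    fix p
    have "(\<Sum>\<^sub>\<infinity>x\<in>?C p. ?G (p, x)) = ?s * H p * (\<Sum>\<^sub>\<infinity>(us, vs)\<in>?C p. ?L us * ?R vs)"
      by (simp only: split infsum_cmult_right')
    also have "(\<Sum>\<^sub>\<infinity>(us, vs)\<in>?C p. ?L us * ?R vs)
       = truncated_G (fst p + M) ?as * truncated_G (M - fst p) ?bs"
      unfolding infsum_product[OF L R] truncated_G_def chain_sum_def la lb ..
    finally show "(\<Sum>\<^sub>\<infinity>x\<in>?C p. ?G (p, x)) = ?s * (H p * (truncated_G (fst p + M) ?as * truncated_G (M - fst p) ?bs))"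
      by (simp only: mult.assoc)
  qed
  also have "\<dots> = ?s * (\<Sum>\<^sub>\<infinity>p\<in>strip M. H p * (truncated_G (fst p + M) ?as * truncated_G (M - fst p) ?bs))"
    by (rule infsum_cmult_right')
  finally have "(?G has_sum ?s * (\<Sum>\<^sub>\<infinity>p\<in>strip M. H p * (truncated_G (fst p + M) ?as * truncated_G (M - fst p) ?bs))) ?D"
    using has_sum_infsum[OF G] by simp
  moreover have "?F (case x of (p, us, vs) \<Rightarrow> rev (map (\<lambda>q. p - q) us) @ p # map (\<lambda>q. p + q) vs) = ?G x"
    if "x \<in> ?D" for x
  proof -
    obtain p us vs where x: "x = (p, us, vs)" by (cases x)
    have l: "length us = i - 1" "length vs = r - i" using that x by (auto simp: chain_lists_def)
    have "(rev (map (\<lambda>q. p - q) us) @ p # map (\<lambda>q. p + q) vs) ! (i - 1) = p"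
      using l(1) by (simp add: nth_append)
    then show ?thesis unfolding x split power_weight_split_at[OF i l refl] by simp
  qed
  ultimately have "((\<lambda>x. ?F (case x of (p, us, vs) \<Rightarrow> rev (map (\<lambda>q. p - q) us) @ p # map (\<lambda>q. p + q) vs))
     has_sum ?s * (\<Sum>\<^sub>\<infinity>p\<in>strip M. H p * (truncated_G (fst p + M) ?as * truncated_G (M - fst p) ?bs))) ?D"
    by (subst has_sum_cong[of ?D _ ?G]) 
  then show ?thesis
    by (rule has_sum_reindex_bij_betw[OF chain_lists_split_at[OF i, of M], of ?F, THEN iffD1])
qed

section \<open>The iterated limits as sums over strips\<close>

lemma lat_0 [simp]: "lat (0, 0) = 0"
  by (simp add: lat_def)

lemma period_lattice_eq: "period_lattice \<tau> = range lat"
  by (auto simp: period_lattice_def lat_def image_iff; blast)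

lemma lattice_box_eq: "lattice_box \<tau> M N = lat ` (int_box M \<times> int_box N)"
  by (auto simp: lattice_box_def lat_def image_iff; blast)

text \<open>The coordinates of a lattice point are unique because \<tau> is not real.\<close>

lemma lattice_less_lat: "lattice_less \<tau> (lat p) (lat q) \<longleftrightarrow> lt p q"
proof
  assume "lattice_less \<tau> (lat p) (lat q)"
  then obtain m1 n1 m2 n2 where *: "lat p = lat (m1, n1)" "lat q = lat (m2, n2)"
      "m1 < m2 \<or> m1 = m2 \<and> n1 < n2"
    by (auto simp: lattice_less_def lat_def)
  then show "lt p q" by (auto simp: lt_def)
next
  assume "lt p q"
  then show "lattice_less \<tau> (lat p) (lat q)"
    unfolding lattice_less_def lt_def lat_def
    by (intro exI[of _ "fst p"] exI[of _ "snd p"] exI[of _ "fst q"] exI[of _ "snd q"]) auto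
qed

lemma sorted_wrt_lattice_less: "sorted_wrt (lattice_less \<tau>) (map lat ps) \<longleftrightarrow> sorted_wrt lt ps"
  by (simp add: sorted_wrt_map lattice_less_lat)

lemma lists_over_image:
  assumes "set ws \<subseteq> f ` S"
  obtains ps where "ws = map f ps" "set ps \<subseteq> S"
proof -
  from assms have "ws \<in> map f ` lists S" by (metis in_lists_conv_set lists_image subsetD)
  then show ?thesis using that by auto
qed

lemma lattice_chains_eq:
  "{ws. length ws = r \<and> set ws \<subseteq> lat ` S \<and> sorted_wrt (lattice_less \<tau>) ws} = map lat ` chain_lists S r"
proof (intro equalityI subsetI)
  fix ws assume "ws \<in> {ws. length ws = r \<and> set ws \<subseteq> lat ` S \<and> sorted_wrt (lattice_less \<tau>) ws}"
  then show "ws \<in> map lat ` chain_lists S r"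
    by (auto simp: chain_lists_def sorted_wrt_lattice_less elim!: lists_over_image)
next
  fix ws assume "ws \<in> map lat ` chain_lists S r"
  then obtain ps where "ws = map lat ps" "ps \<in> chain_lists S r" by auto
  then show "ws \<in> {ws. length ws = r \<and> set ws \<subseteq> lat ` S \<and> sorted_wrt (lattice_less \<tau>) ws}"
    using image_mono[of "set ps" S lat] by (simp add: chain_lists_def sorted_wrt_lattice_less)
qed

lemma lattice_chains_above_0_eq:
  "{ws. length ws = r \<and> set ws \<subseteq> lat ` S \<and> sorted_wrt (lattice_less \<tau>) (0 # ws)}
     = map lat ` chain_lists (S \<inter> {q. lt (0, 0) q}) r"
proof -
  have "lattice_less \<tau> 0 (lat q) \<longleftrightarrow> lt (0, 0) q" for q
    using lattice_less_lat[of "(0, 0)" q] by simp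
  then have "sorted_wrt (lattice_less \<tau>) (0 # map lat ps) \<longleftrightarrow> set ps \<subseteq> {q. lt (0, 0) q} \<and> sorted_wrt lt ps" for ps
    by (auto simp: sorted_wrt_lattice_less)
  note eq = this
  show ?thesis
  proof (intro equalityI subsetI)
    fix ws assume ws: "ws \<in> {ws. length ws = r \<and> set ws \<subseteq> lat ` S \<and> sorted_wrt (lattice_less \<tau>) (0 # ws)}"
    then obtain ps where ps: "ws = map lat ps" "set ps \<subseteq> S" by (auto elim!: lists_over_image)
    then have "ps \<in> chain_lists (S \<inter> {q. lt (0, 0) q}) r"
      using ws eq[of ps] by (simp add: chain_lists_def)
    then show "ws \<in> map lat ` chain_lists (S \<inter> {q. lt (0, 0) q}) r" using ps(1) by blast
  next
    fix ws assume "ws \<in> map lat ` chain_lists (S \<inter> {q. lt (0, 0) q}) r"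
    then obtain ps where "ws = map lat ps" "ps \<in> chain_lists (S \<inter> {q. lt (0, 0) q}) r" by auto
    then show "ws \<in> {ws. length ws = r \<and> set ws \<subseteq> lat ` S \<and> sorted_wrt (lattice_less \<tau>) (0 # ws)}"
      using image_mono[of "set ps" S lat] eq[of ps] by (simp add: chain_lists_def)
  qed
qed

lemma sum_chain_products:
  "(\<Sum>ws\<in>map lat ` chain_lists S (length ks). 1 / (\<Prod>j<length ks. (f (ws ! j)) ^ (ks ! j)))
     = (\<Sum>ps\<in>chain_lists S (length ks). power_weight ks (map (\<lambda>p. f (lat p)) ps))"
proof -
  have "inj_on (map lat) X" for X using inj_lat by (simp add: inj_on_def inj_eq)
  then show ?thesis
    by (subst sum.reindex) (auto simp: chain_lists_def power_weight_nth prod_dividef intro!: sum.cong)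
qed

lemma finite_chain_lists: "finite S \<Longrightarrow> finite (chain_lists S r)"
  unfolding chain_lists_def
  by (rule finite_subset[OF _ finite_lists_length_eq[of S r]]) auto

lemma int_box_eq: "int_box N = {- int N<..<int N}"
  by (auto simp: int_box_def)

text \<open>The inner limit: the boxes of fixed height exhaust the strip, and the sum over chains in the strip is
absolutely convergent.\<close>

lemma box_chain_sum_tendsto:
  assumes "\<And>n. n \<in> set ns \<Longrightarrow> (\<lambda>p. 1 / g p ^ n) summable_on (strip (int M) \<inter> P)"
  shows "(\<lambda>N. \<Sum>ps\<in>chain_lists (int_box M \<times> int_box N \<inter> P) (length ns). power_weight ns (map g ps))
    \<longlonglongrightarrow> chain_sum g (strip (int M) \<inter> P) ns"
  unfolding chain_sum_def
proof (rule tendsto_sum_increasing[OF chain_summable[OF assms]])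
  show "incseq (\<lambda>N. chain_lists (int_box M \<times> int_box N \<inter> P) (length ns))"
    unfolding incseq_def int_box_eq by (intro allI impI chain_lists_mono) auto
  show "(\<Union>N. chain_lists (int_box M \<times> int_box N \<inter> P) (length ns)) = chain_lists (strip (int M) \<inter> P) (length ns)"
  proof (intro equalityI subsetI)
    fix ps assume "ps \<in> chain_lists (strip (int M) \<inter> P) (length ns)"
    then have ps: "length ps = length ns" "set ps \<subseteq> strip (int M) \<inter> P" "sorted_wrt lt ps"
      by (auto simp: chain_lists_def)
    define N where "N = nat (Max (insert 0 ((\<lambda>p. \<bar>snd p\<bar>) ` set ps)) + 1)"
    have "\<bar>snd p\<bar> < int N" if "p \<in> set ps" for p
    proof -
      have "\<bar>snd p\<bar> \<le> Max (insert 0 ((\<lambda>p. \<bar>snd p\<bar>) ` set ps))" using that by (intro Max_ge) auto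
      then show ?thesis by (simp add: N_def)
    qed
    then have "set ps \<subseteq> int_box M \<times> int_box N \<inter> P"
      using ps(2) by (fastforce simp: int_box_def strip_def)
    then show "ps \<in> (\<Union>N. chain_lists (int_box M \<times> int_box N \<inter> P) (length ns))"
      using ps by (auto simp: chain_lists_def)
  qed (auto simp: chain_lists_def int_box_def strip_def dest!: subsetD)
qed (auto intro!: finite_chain_lists simp: int_box_eq)

lemma multi_wp_eq_lim:
  assumes "\<And>k. k \<in> set ks \<Longrightarrow> k \<ge> 2"
  shows "multi_wp ks z \<tau> = lim (\<lambda>M. chain_sum (\<lambda>p. z - lat p) (strip (int M)) ks)"
proof -
  have "(\<lambda>N. \<Sum>ps\<in>chain_lists (int_box M \<times> int_box N) (length ks). power_weight ks (map (\<lambda>p. z - lat p) ps))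
    \<longlonglongrightarrow> chain_sum (\<lambda>p. z - lat p) (strip (int M)) ks" for M
    using box_chain_sum_tendsto[of ks "\<lambda>p. z - lat p" M UNIV, unfolded Int_UNIV_right]
      strip_summable[OF assms order_refl] by blast
  from limI[OF this] show ?thesis
    unfolding multi_wp_def lattice_box_eq lattice_chains_eq sum_chain_products by (simp only:)
qed

lemma multi_G_eq_lim:
  assumes "\<And>k. k \<in> set ks \<Longrightarrow> k \<ge> 2"
  shows "multi_G ks \<tau> = lim (\<lambda>M. truncated_G (int M) ks)"
proof -
  have ps: "strip (int M) \<inter> {q. lt (0, 0) q} = positive_strip (int M)" for M
    by (auto simp: strip_def positive_strip_def lt_def)
  have "(\<lambda>N. \<Sum>ps\<in>chain_lists (int_box M \<times> int_box N \<inter> {q. lt (0, 0) q}) (length ks). power_weight ks (map lat ps))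
    \<longlonglongrightarrow> truncated_G (int M) ks" for M
    using box_chain_sum_tendsto[of ks lat M "{q. lt (0, 0) q}"]
      strip_summable_0[OF _ positive_strip_subset] assms
    unfolding ps truncated_G_def by blast
  from limI[OF this] show ?thesis
    unfolding multi_G_def lattice_box_eq lattice_chains_above_0_eq sum_chain_products[where f = "\<lambda>x. x"]
    by (simp only:)
qed

lemma truncated_G_tendsto:
  assumes "\<And>k. k \<in> set ks \<Longrightarrow> k \<ge> 2"
  shows "(\<lambda>M. truncated_G (int M) ks) \<longlonglongrightarrow> multi_G ks \<tau>"
proof -
  have "convergent (\<lambda>M. truncated_G (int M) ks)" by (rule truncated_G_convergent[OF assms])
  moreover have "multi_G ks \<tau> = lim (\<lambda>M. truncated_G (int M) ks)" by (rule multi_G_eq_lim[OF assms])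
  ultimately show ?thesis by (simp only: convergent_LIMSEQ_iff)
qed

text \<open>The origin may be included, as 1 / 0 = 0.\<close>

lemma Eisenstein_G_eq_lim:
  assumes "k \<ge> 2"
  shows "Eisenstein_G k \<tau> = lim (\<lambda>M. \<Sum>\<^sub>\<infinity>p\<in>strip (int M). 1 / lat p ^ k)"
proof -
  have "(\<lambda>N. \<Sum>(m, n)\<in>int_box M \<times> int_box N - {(0, 0)}. 1 / (of_int m * \<tau> + of_int n) ^ k)
     \<longlonglongrightarrow> (\<Sum>\<^sub>\<infinity>p\<in>strip (int M). 1 / lat p ^ k)" for M
  proof -
    have "(\<lambda>N. \<Sum>p\<in>int_box M \<times> int_box N. 1 / lat p ^ k) \<longlonglongrightarrow> (\<Sum>\<^sub>\<infinity>p\<in>strip (int M). 1 / lat p ^ k)"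
    proof (rule tendsto_sum_increasing)
      show "(\<lambda>p. 1 / lat p ^ k) summable_on strip (int M)" using strip_summable_0[OF assms] by blast
      show "incseq (\<lambda>N. int_box M \<times> int_box N)" by (auto simp: incseq_def int_box_eq)
      have "n \<in> int_box (nat \<bar>n\<bar> + 1)" for n by (simp add: int_box_def)
      then show "(\<Union>N. int_box M \<times> int_box N) = strip (int M)"
        by (fastforce simp: int_box_def strip_def)
    qed (simp add: int_box_eq)
    moreover have "(\<Sum>(m, n)\<in>int_box M \<times> int_box N - {(0, 0)}. 1 / (of_int m * \<tau> + of_int n) ^ k)
        = (\<Sum>p\<in>int_box M \<times> int_box N. 1 / lat p ^ k)" for N
    proof (rule sum.mono_neutral_cong_left)
      show "\<forall>p\<in>int_box M \<times> int_box N - (int_box M \<times> int_box N - {(0, 0)}). 1 / lat p ^ k = 0"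
        using assms by (auto simp: lat_def zero_power)
    qed (auto simp: int_box_eq lat_def)
    ultimately show ?thesis by simp
  qed
  from limI[OF this] show ?thesis unfolding Eisenstein_G_def by (simp only:)
qed

section \<open>Regularized poles\<close>

text \<open>For n = 1 the pole itself is not summable over a row. With the value at 0 subtracted it is, and the row
sums are O(m^(-2)) for every n \<ge> 1.\<close>

definition polar_difference :: "complex \<Rightarrow> nat \<Rightarrow> point \<Rightarrow> complex" where
  "polar_difference z n p = polar (z - lat p) n - polar (0 - lat p) n"

lemma polar_eq_power: "n \<ge> 1 \<Longrightarrow> polar x n = (1 / x) ^ n"
  by (simp add: polar_def power_one_over)

text \<open>For n = 1 the difference is - z times the product of the two poles, and such a product is at most the
sum of their squares.\<close>

lemma polar_difference_summable:
  assumes "z \<notin> range lat"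
  shows "polar_difference z n summable_on strip M"
proof -
  consider "n = 0" | "n = 1" | "n \<ge> 2" by linarith
  then show ?thesis
  proof cases
    case 1
    then have "polar_difference z n = (\<lambda>_. 0)" by (simp add: polar_difference_def polar_def fun_eq_iff)
    then show ?thesis by simp
  next
    case 3
    then have "polar_difference z n = (\<lambda>p. 1 / (z - lat p) ^ n + - (1 / (0 - lat p) ^ n))"
      by (simp add: polar_difference_def polar_def fun_eq_iff)
    then show ?thesis
      using summable_on_add[OF strip_summable[OF 3, of "strip M" M z]
          summable_on_uminus[THEN iffD2, OF strip_summable[OF 3, of "strip M" M 0]]] by simp
  next
    case 2
    have sq: "(\<lambda>p. norm (1 / (u - lat p) ^ 2)) summable_on strip M" for u
      using strip_summable[of 2 "strip M" M u] by (simp flip: summable_on_iff_abs_summable_on_complex)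
    have "norm (polar_difference z n p) \<le> norm z * (norm (1 / (z - lat p) ^ 2) + norm (1 / (0 - lat p) ^ 2))" for p
    proof (cases "lat p = 0")
      case True
      have "z \<noteq> 0" using assms True by (metis rangeI)
      then show ?thesis
        using 2 True by (simp add: polar_difference_def polar_def norm_divide norm_mult power2_eq_square)
    next
      case False
      have ne: "z - lat p \<noteq> 0" using assms by auto
      define a b where "a = 1 / (z - lat p)" and "b = 1 / (0 - lat p)"
      have "polar_difference z n p = - z * (a * b)"
        using 2 False ne by (simp add: polar_difference_def polar_def a_def b_def divide_simps) 
      then have "norm (polar_difference z n p) = norm z * (norm a * norm b)" by (simp add: norm_mult)
      also have "\<dots> \<le> norm z * ((norm a)\<^sup>2 + (norm b)\<^sup>2)"
      proof (rule mult_left_mono)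
        have "2 * (norm a * norm b) \<le> (norm a)\<^sup>2 + (norm b)\<^sup>2"
          using sum_squares_bound[of "norm a" "norm b"] by simp
        moreover have "norm a * norm b \<ge> 0" by simp
        ultimately show "norm a * norm b \<le> (norm a)\<^sup>2 + (norm b)\<^sup>2" by linarith
      qed simp
      finally show ?thesis by (simp add: a_def b_def norm_divide power_divide norm_power)
    qed
    then have "(\<lambda>p. norm (polar_difference z n p)) summable_on strip M"
      by (intro Infinite_Sum.abs_summable_on_comparison_test'[OF
            summable_on_cmult_right[OF summable_on_add[OF sq sq]]])
    then show ?thesis by (rule abs_summable_summable)
  qed
qed

lemma norm_power_difference_le:
  fixes a b :: complex
  assumes "norm a \<le> B" "norm b \<le> B"
  shows "norm (a ^ n - b ^ n) \<le> real n * norm (a - b) * B ^ (n - 1)"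
proof -
  have "norm (\<Sum>i<n. b ^ (n - Suc i) * a ^ i) \<le> (\<Sum>i<n. B ^ (n - 1))"
  proof (rule sum_norm_le)
    fix i assume i: "i \<in> {..<n}"
    have "0 \<le> B" using assms norm_ge_zero order_trans by blast
    then have "norm (b ^ (n - Suc i) * a ^ i) \<le> B ^ (n - Suc i) * B ^ i"
      unfolding norm_mult norm_power using assms by (intro mult_mono power_mono) auto
    also have "\<dots> = B ^ (n - 1)" using i by (simp flip: power_add)
    finally show "norm (b ^ (n - Suc i) * a ^ i) \<le> B ^ (n - 1)" .
  qed
  then have "norm (a - b) * norm (\<Sum>i<n. b ^ (n - Suc i) * a ^ i) \<le> norm (a - b) * (real n * B ^ (n - 1))"
    by (intro mult_left_mono) auto
  then show ?thesis
    unfolding power_diff_sumr2 norm_mult by (simp add: mult_ac)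
qed

text \<open>Write a = 1 / (z - w) and b = 1 / (- w), so that a - b = - z a b is O(b^2). For n \<ge> 2 it follows that
a^n - b^n is O(b^(n + 1)), which has absolute row sums O(m^(-2)). For n = 1 the same holds after removing
the main part - z b^2, whose row sums are O(m^(-2)) by cancellation.\<close>

lemma polar_difference_row_bound:
  assumes z: "z \<notin> range lat" and n: "n \<ge> 1"
  obtains C m0 where
    "\<And>m. \<bar>m\<bar> \<ge> m0 \<Longrightarrow> m \<noteq> 0 \<Longrightarrow> norm (infsum (polar_difference z n) (lattice_row m)) \<le> C / (of_int m)\<^sup>2"
proof -
  \<comment> \<open>From row m0 on, every lattice point w has norm at least 2 * norm z, so that a is at most 2 b in norm.\<close>
  define m0 where "m0 = \<lceil>2 * norm z / Im \<tau>\<rceil>"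
  define D where "D = 2 * (norm z + (norm z)\<^sup>2 + 1) * real n * 2 ^ n"
  \<comment> \<open>The order of the remainder: b^3 after removing the main part if n = 1, and b^(n + 1) otherwise.\<close>
  define l where "l = max 3 (n + 1)"
  define E where "E = D * (row_const * (1 / Im \<tau>) ^ (l - 2)) + norm z * (row_const / Im \<tau>)"
  have l3: "l \<ge> 3" by (simp add: l_def)
  have D0: "D \<ge> 0" by (simp add: D_def)
  have "norm (infsum (polar_difference z n) (lattice_row m)) \<le> E / (of_int m)\<^sup>2"
    if m: "\<bar>m\<bar> \<ge> m0" "m \<noteq> 0" for m
  proof -
    have m1: "1 \<le> real_of_int \<bar>m\<bar>" using m(2) by linarith
    \<comment> \<open>The main part s / w^2 is only needed for a simple pole.\<close>
    define s where "s = (if n = 1 then - z else 0)"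
    have rest: "norm (polar_difference z n p - s * (1 / lat p ^ 2)) \<le> D * norm (1 / lat p ^ l)"
      if p: "p \<in> lattice_row m" for p
    proof -
      define w where "w = lat p"
      define a b where "a = 1 / (z - w)" and "b = 1 / (0 - w)"
      have "2 * norm z / Im \<tau> \<le> real_of_int m0" unfolding m0_def by (rule le_of_int_ceiling)
      also have "\<dots> \<le> real_of_int \<bar>m\<bar>" using m(1) by (simp only: of_int_le_iff)
      finally have "2 * norm z \<le> \<bar>m\<bar> * Im \<tau>" using Im_tau by (simp add: pos_divide_le_eq)
      also have "\<dots> = \<bar>Im w\<bar>" using p Im_tau by (auto simp: w_def Im_lat lattice_row_def abs_mult)
      also have "\<dots> \<le> norm w" by (rule abs_Im_le_cmod)
      finally have zw: "2 * norm z \<le> norm w" .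
      have w0: "w \<noteq> 0" using p m(2) by (auto simp: w_def lattice_row_def)
      have ne: "z - w \<noteq> 0" using z by (auto simp: w_def)
      have "norm w \<le> norm z + norm (z - w)"
        by (metis add.commute add_diff_cancel_left' norm_minus_commute norm_triangle_sub)
      then have zw2: "norm w / 2 \<le> norm (z - w)" using zw by linarith
      have b: "norm b = 1 / norm w" by (simp add: b_def norm_divide)
      have a: "norm a \<le> 2 * norm b"
      proof -
        have "1 / norm (z - w) \<le> 1 / (norm w / 2)" using zw2 w0 by (intro frac_le) auto
        then show ?thesis by (simp add: a_def b norm_divide)
      qed
      have ab: "a - b = - z * (a * b)" using w0 ne by (simp add: a_def b_def divide_simps)
      have nab: "norm (a - b) \<le> 2 * norm z * (norm b)\<^sup>2"
      proof -
        have "norm (a - b) = norm z * (norm a * norm b)" by (simp add: ab norm_mult)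
        also have "\<dots> \<le> norm z * (2 * norm b * norm b)" using a by (intro mult_left_mono mult_right_mono) auto
        finally show ?thesis by (simp add: power2_eq_square mult_ac)
      qed
      have pd: "polar_difference z n p = a ^ n - b ^ n"
        using n by (simp add: polar_difference_def polar_eq_power a_def b_def w_def)
      show ?thesis
      proof (cases "n = 1")
        case True
        have "b\<^sup>2 = 1 / lat p ^ 2" by (simp add: b_def w_def power_divide)
        then have "polar_difference z n p - s * (1 / lat p ^ 2) = - z * (a * b) + z * b\<^sup>2"
          using True pd ab by (simp add: s_def)
        also have "\<dots> = - z * b * (a - b)" by (simp add: algebra_simps power2_eq_square)
        finally have "norm (polar_difference z n p - s * (1 / lat p ^ 2)) = norm z * norm b * norm (a - b)"
          by (simp add: norm_mult)
        also have "\<dots> \<le> norm z * norm b * (2 * norm z * (norm b)\<^sup>2)"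
          using nab by (intro mult_left_mono) auto
        also have "\<dots> = 2 * (norm z)\<^sup>2 * (norm b) ^ 3" by (simp add: power2_eq_square power3_eq_cube)
        also have "\<dots> \<le> D * (norm b) ^ 3" using True by (intro mult_right_mono) (auto simp: D_def)
        also have "(norm b) ^ 3 = norm (1 / lat p ^ l)"
          using True by (simp add: l_def b w_def norm_divide norm_power norm_mult power_divide power3_eq_cube)
        finally show ?thesis .
      next
        case False
        then have n2: "n \<ge> 2" using n by simp
        have "norm (polar_difference z n p - s * (1 / lat p ^ 2)) = norm (a ^ n - b ^ n)"
          using False by (simp add: pd s_def)
        also have "\<dots> \<le> real n * norm (a - b) * (2 * norm b) ^ (n - 1)"
          using a by (intro norm_power_difference_le) auto
        also have "\<dots> \<le> real n * (2 * norm z * (norm b)\<^sup>2) * (2 * norm b) ^ (n - 1)"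
          using nab by (intro mult_left_mono mult_right_mono) auto
        also have "\<dots> = 2 * norm z * real n * 2 ^ (n - 1) * ((norm b)\<^sup>2 * norm b ^ (n - 1))"
          by (simp add: power_mult_distrib mult_ac)
        also have "(norm b)\<^sup>2 * norm b ^ (n - 1) = norm b ^ l"
        proof -
          have "2 + (n - 1) = l" using n2 by (simp add: l_def)
          then show ?thesis by (metis power_add)
        qed
        also have "2 * norm z * real n * 2 ^ (n - 1) * norm b ^ l \<le> D * norm b ^ l"
        proof (intro mult_right_mono)
          have "2 * norm z * real n * 2 ^ (n - 1) \<le> 2 * (norm z + (norm z)\<^sup>2 + 1) * real n * 2 ^ n"
            by (intro mult_mono power_increasing) auto
          then show "2 * norm z * real n * 2 ^ (n - 1) \<le> D" by (simp add: D_def)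
        qed auto
        also have "norm b ^ l = norm (1 / lat p ^ l)" by (simp add: b w_def norm_divide norm_power power_divide)
        finally show ?thesis .
      qed
    qed
    have sl: "(\<lambda>p. D * norm (1 / lat p ^ l)) summable_on lattice_row m"
      using strip_summable_0[OF _ row_subset_strip, of l m] l3
      by (intro summable_on_cmult_right) (simp flip: summable_on_iff_abs_summable_on_complex)
    have s2: "(\<lambda>p. s * (1 / lat p ^ 2)) summable_on lattice_row m"
      using strip_summable_0[OF _ row_subset_strip, of 2 m] by (intro summable_on_cmult_right) simp
    let ?rest = "\<lambda>p. polar_difference z n p - s * (1 / lat p ^ 2)"
    have srn: "(\<lambda>p. norm (?rest p)) summable_on lattice_row m"
      by (rule Infinite_Sum.abs_summable_on_comparison_test'[OF sl rest])
    then have sr: "?rest summable_on lattice_row m" by (rule abs_summable_summable)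
    have "norm (infsum ?rest (lattice_row m)) \<le> (\<Sum>\<^sub>\<infinity>p\<in>lattice_row m. D * norm (1 / lat p ^ l))"
      using norm_infsum_bound[OF srn] infsum_mono[OF srn sl rest] by linarith
    also have "\<dots> = D * (\<Sum>\<^sub>\<infinity>p\<in>lattice_row m. norm (1 / lat p ^ l))" by (rule infsum_cmult_right')
    also have "\<dots> \<le> D * (row_const / \<bar>m\<bar> * (1 / (\<bar>m\<bar> * Im \<tau>)) ^ (l - 2))"
      using row_norm_sum_le[of l m] l3 m D0 by (intro mult_left_mono) auto
    also have "\<dots> \<le> D * (row_const * (1 / Im \<tau>) ^ (l - 2)) / (of_int m)\<^sup>2"
    proof -
      have "(1 / real_of_int \<bar>m\<bar>) ^ (l - 2) \<le> (1 / real_of_int \<bar>m\<bar>) ^ 1"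
        using l3 m1 by (intro power_decreasing) auto
      then have "row_const * (1 / Im \<tau>) ^ (l - 2) / \<bar>m\<bar> * (1 / real_of_int \<bar>m\<bar>) ^ (l - 2)
         \<le> row_const * (1 / Im \<tau>) ^ (l - 2) / \<bar>m\<bar> * (1 / \<bar>m\<bar>) ^ 1"
        using row_const_pos Im_tau by (intro mult_left_mono) auto
      moreover have sqm: "(real_of_int m)\<^sup>2 = \<bar>m\<bar> * \<bar>m\<bar>" by (simp add: power2_eq_square)
      ultimately have "row_const / \<bar>m\<bar> * (1 / (\<bar>m\<bar> * Im \<tau>)) ^ (l - 2)
         \<le> row_const * (1 / Im \<tau>) ^ (l - 2) / (of_int m)\<^sup>2"
        unfolding sqm by (simp add: power_mult_distrib power_one_over power_divide mult_ac del: abs_mult_self_eq)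
      from mult_left_mono[OF this D0] show ?thesis by simp
    qed
    finally have 1: "norm (infsum ?rest (lattice_row m))
       \<le> D * (row_const * (1 / Im \<tau>) ^ (l - 2)) / (of_int m)\<^sup>2" .
    have "norm (\<Sum>\<^sub>\<infinity>p\<in>lattice_row m. s * (1 / lat p ^ 2)) = norm s * norm (\<Sum>\<^sub>\<infinity>p\<in>lattice_row m. 1 / lat p ^ 2)"
      by (simp only: infsum_cmult_right' norm_mult)
    also have "\<dots> \<le> norm z * (row_const / Im \<tau> / (of_int m)\<^sup>2)"
      using row_sum_squares_le[OF m(2)] by (intro mult_mono) (auto simp: s_def)
    finally have 2: "norm (\<Sum>\<^sub>\<infinity>p\<in>lattice_row m. s * (1 / lat p ^ 2)) \<le> norm z * (row_const / Im \<tau>) / (of_int m)\<^sup>2"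
      by simp
    have "infsum (polar_difference z n) (lattice_row m) = (\<Sum>\<^sub>\<infinity>p\<in>lattice_row m. ?rest p + s * (1 / lat p ^ 2))"
      by simp
    also have "\<dots> = infsum ?rest (lattice_row m) + (\<Sum>\<^sub>\<infinity>p\<in>lattice_row m. s * (1 / lat p ^ 2))"
      by (rule infsum_add[OF sr s2])
    finally have split: "infsum (polar_difference z n) (lattice_row m)
        = infsum ?rest (lattice_row m) + (\<Sum>\<^sub>\<infinity>p\<in>lattice_row m. s * (1 / lat p ^ 2))" .
    have "norm (infsum (polar_difference z n) (lattice_row m))
      \<le> D * (row_const * (1 / Im \<tau>) ^ (l - 2)) / (of_int m)\<^sup>2 + norm z * (row_const / Im \<tau>) / (of_int m)\<^sup>2"
      unfolding split by (rule order_trans[OF norm_triangle_ineq add_mono[OF 1 2]])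
    then show ?thesis by (simp add: E_def add_divide_distrib)
  qed
  then show ?thesis by (rule that)
qed

lemma polar_difference_rows_summable:
  assumes "z \<notin> range lat" "n \<ge> 1"
  shows "(\<lambda>m. infsum (polar_difference z n) (lattice_row m)) summable_on UNIV"
proof -
  let ?R = "\<lambda>m. infsum (polar_difference z n) (lattice_row m)"
  obtain C m0 where C: "\<And>m. \<bar>m\<bar> \<ge> m0 \<Longrightarrow> m \<noteq> 0 \<Longrightarrow> norm (?R m) \<le> C / (of_int m)\<^sup>2"
    using polar_difference_row_bound[OF assms] by blast
  define F where "F = {-\<bar>m0\<bar>..\<bar>m0\<bar>}"
  have "(\<lambda>m::int. norm (1 / (0 - of_int m) ^ 2 :: complex)) summable_on UNIV"
    using row_power_summable[of 2 0] by (simp flip: summable_on_iff_abs_summable_on_complex)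
  then have "(\<lambda>m::int. C * norm (1 / (0 - of_int m) ^ 2 :: complex)) summable_on - F"
    by (intro summable_on_cmult_right) (rule summable_on_subset, auto)
  moreover have "norm (?R m) \<le> C * norm (1 / (0 - of_int m) ^ 2 :: complex)" if "m \<in> - F" for m
    using C[of m] that by (auto simp: F_def norm_divide norm_power)
  ultimately have "(\<lambda>m. norm (?R m)) summable_on - F"
    by (rule Infinite_Sum.abs_summable_on_comparison_test')
  then have "?R summable_on - F" by (rule abs_summable_summable)
  moreover have "?R summable_on F" by (simp add: F_def)
  ultimately have "?R summable_on (- F \<union> F)" by (rule summable_on_Un_disjoint) auto
  then show ?thesis by (simp add: Un_commute)
qed

section \<open>The limit of the chain expansion\<close>

text \<open>The factor c is constant on each row, like the truncated sums that the splitting of a chain produces.\<close>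

lemma infsum_strip_row_factor:
  fixes f :: "point \<Rightarrow> complex"
  assumes "f summable_on strip M"
  shows "(\<Sum>\<^sub>\<infinity>p\<in>strip M. f p * c (fst p)) = (\<Sum>m\<in>{-M<..<M}. c m * infsum f (lattice_row m))"
proof -
  have "(\<lambda>p. f p * c (fst p)) summable_on strip M"
    unfolding strip_eq_Sigma
  proof (rule summable_on_finite_Sigma)
    fix m assume "m \<in> {-M<..<M}"
    then have "lattice_row m \<subseteq> strip M" by (auto simp: lattice_row_def strip_def)
    then have "f summable_on lattice_row m" by (rule summable_on_subset[OF assms])
    then have "(\<lambda>l. f (m, l)) summable_on UNIV"
      by (simp add: row_eq_image summable_on_reindex[OF inj_Pair_UNIV] o_def)
    then show "(\<lambda>l. f (m, l) * c (fst (m, l))) summable_on UNIV"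
      by (simp add: summable_on_cmult_left)
  qed simp
  then have "(\<Sum>\<^sub>\<infinity>p\<in>strip M. f p * c (fst p)) = (\<Sum>m\<in>{-M<..<M}. \<Sum>\<^sub>\<infinity>p\<in>lattice_row m. f p * c (fst p))"
    by (rule infsum_strip)
  moreover have "(\<Sum>\<^sub>\<infinity>p\<in>lattice_row m. f p * c (fst p)) = c m * infsum f (lattice_row m)" for m
  proof -
    have "(\<Sum>\<^sub>\<infinity>p\<in>lattice_row m. f p * c (fst p)) = (\<Sum>\<^sub>\<infinity>p\<in>lattice_row m. c m * f p)"
      by (rule infsum_cong) (auto simp: lattice_row_def)
    then show ?thesis by (simp add: infsum_cmult_right')
  qed
  ultimately show ?thesis by simp
qed

text \<open>Chains through 0 contribute 0, as 1 / 0 = 0. The others are cut at 0; the part below 0 is reflected,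
which reverses it, and the part above 0 acquires a sign.\<close>

lemma chain_sum_at_0:
  assumes M: "M \<ge> 1" and ks: "\<And>k. k \<in> set ks \<Longrightarrow> k \<ge> 2"
  shows "chain_sum (\<lambda>p. 0 - lat p) (strip M) ks
    = (\<Sum>i\<le>length ks. truncated_G M (rev (take i ks)) * ((-1) ^ sum_list (drop i ks) * truncated_G M (drop i ks)))"
proof -
  let ?N = "uminus ` positive_strip M"
  have NP: "?N \<union> positive_strip M = strip M - {(0, 0)}"
  proof
    show "strip M - {(0, 0)} \<subseteq> ?N \<union> positive_strip M"
    proof
      fix p assume p: "p \<in> strip M - {(0, 0)}"
      show "p \<in> ?N \<union> positive_strip M"
      proof (cases "lt (0, 0) p")
        case True
        then show ?thesis using p by (auto simp: positive_strip_def strip_def)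
      next
        case False
        then have "- p \<in> positive_strip M" using p by (cases p) (auto simp: positive_strip_def strip_def lt_def)
        then show ?thesis by (metis UnI1 image_eqI minus_minus)
      qed
    qed
  qed (use M in \<open>auto simp: positive_strip_def strip_def lt_def\<close>)
  have N: "?N \<subseteq> strip M" and P: "positive_strip M \<subseteq> strip M" using NP by auto
  have anti: "lt (- p) (- q) \<longleftrightarrow> lt q p" for p q by (auto simp: lt_def)
  have zero: "power_weight ks (map (\<lambda>p. 0 - lat p) ps) = 0"
    if ps: "ps \<in> chain_lists (strip M) (length ks)" "ps \<notin> chain_lists (strip M - {(0, 0)}) (length ks)" for ps
  proof -
    have len: "length ks = length ps" and "(0, 0) \<in> set ps" using ps by (auto simp: chain_lists_def)
    then obtain j where j: "j < length ks" "ps ! j = (0, 0)" by (metis in_set_conv_nth)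
    then have "ks ! j \<ge> 2" using ks by simp
    then show ?thesis
      using j len by (subst power_weight_nth) (auto intro!: prod_zero bexI[of _ j] simp: zero_power)
  qed
  have "chain_sum (\<lambda>p. 0 - lat p) (strip M) ks = chain_sum (\<lambda>p. 0 - lat p) (?N \<union> positive_strip M) ks"
    unfolding chain_sum_def NP
    by (rule infsum_cong_neutral) (use zero chain_lists_mono[of "strip M - {(0, 0)}" "strip M"] in auto)
  also have "\<dots> = (\<Sum>i\<le>length ks. chain_sum (\<lambda>p. 0 - lat p) ?N (take i ks)
       * chain_sum (\<lambda>p. 0 - lat p) (positive_strip M) (drop i ks))"
  proof (rule chain_sum_Un)
    show "lt p q" if "p \<in> ?N" "q \<in> positive_strip M" for p q
      using that by (auto simp: positive_strip_def lt_def)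
  qed (rule strip_summable[OF ks N] strip_summable[OF ks P], assumption)+
  finally have split: "chain_sum (\<lambda>p. 0 - lat p) (strip M) ks
     = (\<Sum>i\<le>length ks. chain_sum (\<lambda>p. 0 - lat p) ?N (take i ks)
       * chain_sum (\<lambda>p. 0 - lat p) (positive_strip M) (drop i ks))" .
  have neg: "chain_sum (\<lambda>p. 0 - lat p) ?N ns = truncated_G M (rev ns)" for ns
  proof -
    have "(\<lambda>p. 0 - lat p) \<circ> uminus = lat" by (auto simp: fun_eq_iff lat_def)
    then show ?thesis using chain_sum_anti_image[of uminus, OF anti] by (simp add: truncated_G_def)
  qed
  have pos: "chain_sum (\<lambda>p. 0 - lat p) (positive_strip M) ns = (-1) ^ sum_list ns * truncated_G M ns" for ns
    using chain_sum_uminus[of lat "positive_strip M" ns] by (simp add: truncated_G_def)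
  show ?thesis unfolding split neg pos ..
qed

definition truncated_pair :: "nat \<Rightarrow> (nat \<Rightarrow> nat) \<Rightarrow> nat \<Rightarrow> int \<Rightarrow> int \<Rightarrow> complex" where
  "truncated_pair r n i A B = truncated_G A (map n (rev [1..<i])) * truncated_G B (map n [i+1..<r+1])"

definition multi_G_pair :: "nat \<Rightarrow> (nat \<Rightarrow> nat) \<Rightarrow> nat \<Rightarrow> complex" where
  "multi_G_pair r n i = multi_G (map n (rev [1..<i])) \<tau> * multi_G (map n [i+1..<r+1]) \<tau>"

lemma split_indices_ge_2:
  assumes "i \<in> {1..r}" "\<And>j. j \<in> {1..r} - {i} \<Longrightarrow> n j \<ge> 2"
  shows "l \<in> set (map n (rev [1..<i])) \<Longrightarrow> l \<ge> 2"
    and "l \<in> set (map n [i+1..<r+1]) \<Longrightarrow> l \<ge> 2"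
proof -
  assume "l \<in> set (map n (rev [1..<i]))"
  then obtain j where "l = n j" "j \<in> {1..<i}" by auto
  then show "l \<ge> 2" using assms(2)[of j] assms(1) by simp
next
  assume "l \<in> set (map n [i+1..<r+1])"
  then obtain j where "l = n j" "j \<in> {i+1..<r+1}" by (auto simp del: upt_Suc)
  then show "l \<ge> 2" using assms(2)[of j] assms(1) by simp
qed

lemma truncated_G_tendsto_shift:
  assumes "\<And>k. k \<in> set ks \<Longrightarrow> k \<ge> 2"
  shows "(\<lambda>M. truncated_G (int M + m) ks) \<longlonglongrightarrow> multi_G ks \<tau>"
proof -
  have "filterlim (\<lambda>M. nat (int M + m)) sequentially sequentially"
    unfolding filterlim_at_top eventually_sequentially
  proof (intro allI)
    fix Z show "\<exists>N. \<forall>n\<ge>N. Z \<le> nat (int n + m)" by (intro exI[of _ "nat (int Z + \<bar>m\<bar>)"]) auto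
  qed
  moreover have "(\<lambda>M. truncated_G (int M) ks) \<longlonglongrightarrow> multi_G ks \<tau>"
    using assms by (rule truncated_G_tendsto)
  ultimately have "(\<lambda>M. truncated_G (int (nat (int M + m))) ks) \<longlonglongrightarrow> multi_G ks \<tau>"
    by (rule filterlim_compose[rotated])
  moreover have "\<forall>\<^sub>F M in sequentially. truncated_G (int (nat (int M + m))) ks = truncated_G (int M + m) ks"
    using eventually_ge_at_top[of "nat \<bar>m\<bar>"]
  proof eventually_elim
    case (elim M)
    then have "int (nat (int M + m)) = int M + m" by linarith
    then show ?case by simp
  qed
  ultimately show ?thesis by (rule Lim_transform_eventually)
qed

lemma truncated_G_bounded:
  assumes "\<And>k. k \<in> set ks \<Longrightarrow> k \<ge> 2"
  obtains B where "B > 0" "\<And>A. A \<ge> 0 \<Longrightarrow> norm (truncated_G A ks) \<le> B"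
proof -
  have "Bseq (\<lambda>A. truncated_G (int A) ks)"
    using truncated_G_convergent[OF assms] by (rule convergent_imp_Bseq)
  then obtain B where B: "B > 0" "\<And>A. norm (truncated_G (int A) ks) \<le> B" by (metis BseqE)
  have "norm (truncated_G A ks) \<le> B" if "A \<ge> 0" for A using B(2)[of "nat A"] that by simp
  with B(1) show ?thesis by (rule that)
qed

lemma truncated_pair_weighted_tendsto:
  assumes i: "i \<in> {1..r}" "\<And>j. j \<in> {1..r} - {i} \<Longrightarrow> n j \<ge> 2"
    and h: "h summable_on UNIV"
  shows "(\<lambda>M. \<Sum>m\<in>{-int M<..<int M}. truncated_pair r n i (m + int M) (int M - m) * h m)
    \<longlonglongrightarrow> multi_G_pair r n i * infsum h UNIV"
proof -
  note ge = split_indices_ge_2[of i r n, OF i]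
  obtain B where B: "B > 0" "\<And>A. A \<ge> 0 \<Longrightarrow> norm (truncated_G A (map n (rev [1..<i]))) \<le> B"
    using truncated_G_bounded[OF ge(1)] by blast
  obtain B' where B': "B' > 0" "\<And>A. A \<ge> 0 \<Longrightarrow> norm (truncated_G A (map n [i+1..<r+1])) \<le> B'"
    using truncated_G_bounded[OF ge(2)] by blast
  show ?thesis
  proof (rule dominated_symmetric_sum[OF h])
    fix M m assume "\<bar>m\<bar> < int M"
    then show "norm (truncated_pair r n i (m + int M) (int M - m)) \<le> B * B'"
      unfolding truncated_pair_def norm_mult using B B' by (intro mult_mono) auto
  next
    fix m
    have "(\<lambda>M. truncated_G (int M + m) (map n (rev [1..<i])) * truncated_G (int M + - m) (map n [i+1..<r+1]))
      \<longlonglongrightarrow> multi_G_pair r n i"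
      unfolding multi_G_pair_def using ge
      by (intro tendsto_mult truncated_G_tendsto_shift) blast+
    then show "(\<lambda>M. truncated_pair r n i (m + int M) (int M - m)) \<longlonglongrightarrow> multi_G_pair r n i"
      by (simp only: truncated_pair_def add.commute[of m] diff_conv_add_uminus)
  qed
qed

lemma chain_inj:
  assumes "ps \<in> chain_lists S r"
  shows "inj_on (\<lambda>j. lat (ps ! (j - 1))) {1..r}"
proof (rule inj_onI)
  fix j l assume jl: "j \<in> {1..r}" "l \<in> {1..r}" "lat (ps ! (j - 1)) = lat (ps ! (l - 1))"
  then have "ps ! (j - 1) = ps ! (l - 1)" by simp
  moreover have "distinct ps" "length ps = r"
    using assms chain_lists_distinct by (auto simp: chain_lists_def)
  ultimately have "j - 1 = l - 1" using jl by (auto simp: nth_eq_iff_index_eq)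
  then show "j = l" using jl by auto
qed

definition chain_term :: "nat \<Rightarrow> (nat \<Rightarrow> nat) \<Rightarrow> nat \<Rightarrow> point list \<Rightarrow> complex" where
  "chain_term r n i ps = (\<Prod>j\<in>{1..r} - {i}. 1 / (lat (ps ! (i - 1)) - lat (ps ! (j - 1))) ^ n j)"

definition pole_coeff :: "nat \<Rightarrow> (nat \<Rightarrow> nat) \<Rightarrow> (nat \<Rightarrow> nat) \<Rightarrow> nat \<Rightarrow> complex" where
  "pole_coeff r k n i = (-1) ^ (k i + n i) * binom_prod r k n i"

text \<open>The additional sign is that of chain_split_has_sum.\<close>

definition signed_coeff :: "nat \<Rightarrow> (nat \<Rightarrow> nat) \<Rightarrow> (nat \<Rightarrow> nat) \<Rightarrow> nat \<Rightarrow> complex" where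
  "signed_coeff r k n i = pole_coeff r k n i * (-1) ^ (\<Sum>j=i+1..r. n j)"

lemma signed_coeff_nonzero:
  assumes "signed_coeff r k n i \<noteq> 0" "\<And>j. j \<in> {1..r} \<Longrightarrow> k j \<ge> 2" "j \<in> {1..r} - {i}"
  shows "n j \<ge> 2"
proof -
  have "binom_prod r k n i \<noteq> 0" using assms(1) by (auto simp: signed_coeff_def pole_coeff_def)
  moreover have "k j \<ge> 2" using assms(2)[of j] assms(3) by simp
  ultimately show ?thesis using binom_prod_nonzero[of r k n i j] assms(3) by linarith
qed

lemma expansion_pairing_chain:
  assumes "ps \<in> chain_lists S r" "i \<in> {1..r}" "\<And>j. j \<in> {1..r} \<Longrightarrow> k j \<ge> 2"
  shows "expansion_pairing {1..r} (\<lambda>j. lat (ps ! (j - 1))) k i H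
     = (\<Sum>n\<in>compositions {1..r} (sum k {1..r}). pole_coeff r k n i * H (n i) * chain_term r n i ps)"
  unfolding pole_coeff_def chain_term_def
  using expansion_pairing_binom_prod[of i r k "\<lambda>j. lat (ps ! (j - 1))" H] assms chain_inj[OF assms(1)]
  by simp

lemma pole_sum_has_sum:
  assumes i: "i \<in> {1..r}" and k: "\<And>j. j \<in> {1..r} \<Longrightarrow> k j \<ge> 2" and H: "H summable_on strip M"
  shows "((\<lambda>ps. pole_coeff r k n i * H (ps ! (i - 1)) * chain_term r n i ps) has_sum
     signed_coeff r k n i * (\<Sum>\<^sub>\<infinity>p\<in>strip M. H p * truncated_pair r n i (fst p + M) (M - fst p)))
     (chain_lists (strip M) r)"
proof (cases "signed_coeff r k n i = 0")
  case True
  then have "pole_coeff r k n i = 0" by (auto simp: signed_coeff_def)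
  then show ?thesis using True by simp
next
  case False
  have "n j \<ge> 2" if "j \<in> {1..r} - {i}" for j
    using False k that by (rule signed_coeff_nonzero)
  from has_sum_cmult_right[OF chain_split_has_sum[OF i this H], where c = "pole_coeff r k n i"]
  show ?thesis
    by (simp only: chain_term_def truncated_pair_def signed_coeff_def mult.assoc)
qed

text \<open>For n = 0 the indicator of the origin stands for the constant coefficient of the chains through 0, so that
the compositions with n i = 0 need no separate treatment in the limit.\<close>

definition regularized_pole :: "complex \<Rightarrow> nat \<Rightarrow> point \<Rightarrow> complex" where
  "regularized_pole z n = (if n = 0 then (\<lambda>p. if p = (0, 0) then 1 else 0) else polar_difference z n)"

definition regularized_pole_sum :: "complex \<Rightarrow> nat \<Rightarrow> complex" where
  "regularized_pole_sum z n = (\<Sum>\<^sub>\<infinity>m. infsum (regularized_pole z n) (lattice_row m))"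

lemma regularized_pole_row_0: "infsum (regularized_pole z 0) (lattice_row m) = (if m = 0 then 1 else 0)"
  by (simp add: regularized_pole_def infsum_delta lattice_row_def)

lemma regularized_pole_sum_0: "regularized_pole_sum z 0 = 1"
  by (simp add: regularized_pole_sum_def regularized_pole_row_0 infsum_delta)

lemma regularized_pole_summable:
  assumes "z \<notin> range lat"
  shows "regularized_pole z n summable_on strip M"
    and "(\<lambda>m. infsum (regularized_pole z n) (lattice_row m)) summable_on UNIV"
proof -
  show "regularized_pole z n summable_on strip M"
    by (simp add: regularized_pole_def summable_on_delta polar_difference_summable[OF assms])
  show "(\<lambda>m. infsum (regularized_pole z n) (lattice_row m)) summable_on UNIV"
  proof (cases "n = 0")
    case True
    then show ?thesis by (simp add: regularized_pole_row_0 summable_on_delta)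
  next
    case False
    then show ?thesis using polar_difference_rows_summable[OF assms, of n] by (simp add: regularized_pole_def)
  qed
qed

text \<open>The difference of the partial fraction expansions at the arguments z and 0.\<close>

theorem chain_expansion:
  assumes z: "z \<notin> range lat" and r: "r \<ge> 1" and k: "\<And>j. j \<in> {1..r} \<Longrightarrow> k j \<ge> 2"
    and ps: "ps \<in> chain_lists S r"
  shows "power_weight (map k [1..<r+1]) (map (\<lambda>p. z - lat p) ps)
    = power_weight (map k [1..<r+1]) (map (\<lambda>p. 0 - lat p) ps)
      + (\<Sum>i=1..r. \<Sum>n\<in>compositions {1..r} (sum k {1..r}).
           pole_coeff r k n i * regularized_pole z (n i) (ps ! (i - 1)) * chain_term r n i ps)"
proof -
  let ?w = "\<lambda>j. lat (ps ! (j - 1))" and ?J = "{1..r}"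
  let ?E = "expansion_pairing ?J ?w k" and ?d = "\<lambda>n. if n = 0 then 1 else 0 :: complex"
  have len: "length ps = r" using ps by (simp add: chain_lists_def)
  have pw: "power_weight (map k [1..<r+1]) (map (\<lambda>p. u - lat p) ps) = (\<Prod>j\<in>?J. 1 / (u - ?w j) ^ k j)" for u
  proof -
    have "length (map (\<lambda>p. u - lat p) ps) = r" using len by simp
    from power_weight_upt[OF this, of k]
    have "power_weight (map k [1..<r+1]) (map (\<lambda>p. u - lat p) ps)
       = (\<Prod>j\<in>?J. 1 / (map (\<lambda>p. u - lat p) ps ! (j - 1)) ^ k j)" .
    also have "\<dots> = (\<Prod>j\<in>?J. 1 / (u - ?w j) ^ k j)"
      by (rule prod.cong) (use len in auto)
    finally show ?thesis .
  qed
  have k1: "k j \<ge> 1" if "j \<in> ?J" for j using k[OF that] by simp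
  have ne: "?J \<noteq> {}" using r by simp
  have pf: "(\<Prod>j\<in>?J. 1 / (u - ?w j) ^ k j) + (\<Sum>i\<in>?J. if ?w i = u then ?E i ?d else 0)
      = (\<Sum>i\<in>?J. ?E i (polar (u - ?w i)))" for u
    using k1 by (rule partial_fractions[OF finite_atLeastAtMost ne chain_inj[OF ps]])
  have pairing: "?E i H = (\<Sum>n\<in>compositions {1..r} (sum k {1..r}). pole_coeff r k n i * H (n i) * chain_term r n i ps)"
    if "i \<in> ?J" for i H
    using k by (rule expansion_pairing_chain[OF ps that])
  have "(\<Sum>i\<in>?J. if ?w i = z then ?E i ?d else 0) = 0"
    using z by (intro sum.neutral) auto
  then have "(\<Prod>j\<in>?J. 1 / (z - ?w j) ^ k j) = (\<Sum>i\<in>?J. ?E i (polar (z - ?w i)))"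
    using pf[of z] by simp
  also have "\<dots> = (\<Prod>j\<in>?J. 1 / (0 - ?w j) ^ k j) + (\<Sum>i\<in>?J. (if ?w i = 0 then ?E i ?d else 0)
       + ?E i (polar (z - ?w i)) - ?E i (polar (0 - ?w i)))"
    unfolding sum.distrib sum_subtractf pf[of 0, symmetric] by simp
  also have "(\<Sum>i\<in>?J. (if ?w i = 0 then ?E i ?d else 0) + ?E i (polar (z - ?w i)) - ?E i (polar (0 - ?w i)))
     = (\<Sum>i=1..r. \<Sum>n\<in>compositions {1..r} (sum k {1..r}).
           pole_coeff r k n i * regularized_pole z (n i) (ps ! (i - 1)) * chain_term r n i ps)"
  proof (rule sum.cong[OF refl])
    fix i assume i: "i \<in> ?J"
    have 1: "(if ?w i = 0 then ?E i ?d else 0) = ?E i (\<lambda>n. if n = 0 \<and> ps ! (i - 1) = (0, 0) then 1 else 0)"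
      unfolding pairing[OF i] by (cases "ps ! (i - 1) = (0, 0)") simp_all
    have 2: "pole_coeff r k n i * regularized_pole z (n i) (ps ! (i - 1)) * chain_term r n i ps
       = pole_coeff r k n i * (if n i = 0 \<and> ps ! (i - 1) = (0, 0) then 1 else 0) * chain_term r n i ps
       + pole_coeff r k n i * polar (z - ?w i) (n i) * chain_term r n i ps
       - pole_coeff r k n i * polar (0 - ?w i) (n i) * chain_term r n i ps" for n
    proof (cases "n i = 0")
      case True
      then show ?thesis by (simp add: regularized_pole_def polar_def)
    next
      case False
      then show ?thesis by (simp add: regularized_pole_def polar_difference_def algebra_simps)
    qed
    show "(if ?w i = 0 then ?E i ?d else 0) + ?E i (polar (z - ?w i)) - ?E i (polar (0 - ?w i))
      = (\<Sum>n\<in>compositions {1..r} (sum k {1..r}).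
           pole_coeff r k n i * regularized_pole z (n i) (ps ! (i - 1)) * chain_term r n i ps)"
      unfolding 1 unfolding pairing[OF i] 2 sum.distrib sum_subtractf by (rule refl)
  qed
  finally show ?thesis unfolding pw .
qed

lemma chain_sum_expansion:
  assumes z: "z \<notin> range lat" and r: "r \<ge> 1" and k: "\<And>j. j \<in> {1..r} \<Longrightarrow> k j \<ge> 2"
  shows "chain_sum (\<lambda>p. z - lat p) (strip M) (map k [1..<r+1])
    = chain_sum (\<lambda>p. 0 - lat p) (strip M) (map k [1..<r+1])
      + (\<Sum>i=1..r. \<Sum>n\<in>compositions {1..r} (sum k {1..r}). signed_coeff r k n i *
          (\<Sum>m\<in>{-M<..<M}. truncated_pair r n i (m + M) (M - m) * infsum (regularized_pole z (n i)) (lattice_row m)))"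
proof -
  let ?ks = "map k [1..<r+1]"
  have ks: "l \<ge> 2" if "l \<in> set ?ks" for l
  proof -
    from that obtain j where "l = k j" "j \<in> {1..<r+1}" by (auto simp del: upt_Suc)
    then show ?thesis using k[of j] by simp
  qed
  have len: "length ?ks = r" by simp
  have s0: "(\<lambda>p. 1 / (0 - lat p) ^ l) summable_on strip M" if "l \<in> set ?ks" for l
    using ks[OF that] by (rule strip_summable[OF _ order_refl])
  have c0: "((\<lambda>ps. power_weight ?ks (map (\<lambda>p. 0 - lat p) ps)) has_sum
      chain_sum (\<lambda>p. 0 - lat p) (strip M) ?ks) (chain_lists (strip M) r)"
    using has_sum_infsum[OF chain_summable[of ?ks "\<lambda>p. 0 - lat p", OF s0]]
    by (simp only: chain_sum_def len)
  have "((\<lambda>ps. power_weight ?ks (map (\<lambda>p. 0 - lat p) ps)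
       + (\<Sum>i=1..r. \<Sum>n\<in>compositions {1..r} (sum k {1..r}).
           pole_coeff r k n i * regularized_pole z (n i) (ps ! (i - 1)) * chain_term r n i ps)) has_sum
     chain_sum (\<lambda>p. 0 - lat p) (strip M) ?ks
       + (\<Sum>i=1..r. \<Sum>n\<in>compositions {1..r} (sum k {1..r}). signed_coeff r k n i *
          (\<Sum>\<^sub>\<infinity>p\<in>strip M. regularized_pole z (n i) p * truncated_pair r n i (fst p + M) (M - fst p))))
     (chain_lists (strip M) r)"
    by (intro has_sum_add[OF c0] has_sum_finite_sum finite_compositions finite_atLeastAtMost
        pole_sum_has_sum k regularized_pole_summable(1)[OF z])
  then have "((\<lambda>ps. power_weight ?ks (map (\<lambda>p. z - lat p) ps)) has_sum
     chain_sum (\<lambda>p. 0 - lat p) (strip M) ?ks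
       + (\<Sum>i=1..r. \<Sum>n\<in>compositions {1..r} (sum k {1..r}). signed_coeff r k n i *
          (\<Sum>\<^sub>\<infinity>p\<in>strip M. regularized_pole z (n i) p * truncated_pair r n i (fst p + M) (M - fst p))))
     (chain_lists (strip M) r)"
    by (subst has_sum_cong[OF chain_expansion[OF z r k]])
  moreover have "(\<Sum>\<^sub>\<infinity>p\<in>strip M. regularized_pole z (n i) p * truncated_pair r n i (fst p + M) (M - fst p))
     = (\<Sum>m\<in>{-M<..<M}. truncated_pair r n i (m + M) (M - m) * infsum (regularized_pole z (n i)) (lattice_row m))" for n i
    by (rule infsum_strip_row_factor[OF regularized_pole_summable(1)[OF z]])
  ultimately show ?thesis unfolding chain_sum_def[of "\<lambda>p. z - lat p"] len by (simp only: infsumI)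
qed

text \<open>Two normal forms of chains up to horizontal translation: the first point, or the i-th point, has second
coordinate 0.\<close>

lemma translate_chain_bij:
  assumes "i \<in> {1..r}"
  shows "bij_betw (\<lambda>ps. map (\<lambda>q. q - (0, snd (ps ! (i - 1)))) ps)
     {ps \<in> chain_lists (strip M) r. snd (ps ! 0) = 0} {ps \<in> chain_lists (strip M) r. snd (ps ! (i - 1)) = 0}"
proof -
  have chain: "map (\<lambda>q. q - (0, c)) ps \<in> chain_lists (strip M) r" if "ps \<in> chain_lists (strip M) r" for ps c
  proof -
    have "q - (0, c) \<in> strip M" if "q \<in> set ps" for q
      using that \<open>ps \<in> chain_lists (strip M) r\<close> by (auto simp: chain_lists_def strip_def dest!: subsetD)
    then show ?thesis using that by (auto simp: chain_lists_def sorted_wrt_map lt_diff_right)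
  qed
  have len: "length ps = r" if "ps \<in> chain_lists (strip M) r" for ps
    using that by (simp add: chain_lists_def)
  have "0 < r" "i - Suc 0 < r" using assms by auto
  then show ?thesis
    by (intro bij_betw_byWitness[where f' = "\<lambda>ps. map (\<lambda>q. q - (0, snd (ps ! 0))) ps"])
      (auto simp: len chain prod_eq_iff intro!: nth_equalityI)
qed

lemma chain_term_translate:
  assumes "length ps = r" "i \<in> {1..r}"
  shows "chain_term r n i (map (\<lambda>q. q - c) ps) = chain_term r n i ps"
  unfolding chain_term_def using assms by (intro prod.cong) (auto simp: lat_diff)

text \<open>For each chain with first point in column 0 the residues add up to 0. The i-th residue is invariant under
translation, so its sum over these chains equals its sum over the chains with i-th point in column 0, and
the latter is a sum, over the row m of that point, of products of two independent truncated sums.\<close>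

lemma residues_cancel_truncated:
  assumes r: "r \<ge> 1" and k: "\<And>j. j \<in> {1..r} \<Longrightarrow> k j \<ge> 2"
  shows "(\<Sum>i=1..r. \<Sum>n\<in>compositions {1..r} (sum k {1..r}). signed_coeff r k n i *
     (if n i = 1 then \<Sum>m\<in>{-M<..<M}. truncated_pair r n i (m + M) (M - m) else 0)) = 0"
proof -
  let ?N = "compositions {1..r} (sum k {1..r})" and ?C = "chain_lists (strip M) r"
  let ?Q = "\<lambda>i. {ps \<in> ?C. snd (ps ! (i - 1)) = 0}"
  let ?first = "{ps \<in> ?C. snd (ps ! 0) = 0}"
  let ?e = "\<lambda>n :: nat. if n = 1 then 1 else 0 :: complex"
  let ?f = "\<lambda>i n ps. pole_coeff r k n i * ?e (n i) * chain_term r n i ps"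
  let ?V = "\<lambda>i n. signed_coeff r k n i *
     (if n i = 1 then \<Sum>m\<in>{-M<..<M}. truncated_pair r n i (m + M) (M - m) else 0)"
  have f: "(?f i n has_sum ?V i n) ?first" if i: "i \<in> {1..r}" for i n
  proof -
    let ?H = "\<lambda>p :: point. if snd p = 0 then ?e (n i) else 0"
    have row: "(?H has_sum ?e (n i)) (lattice_row m)" for m
      by (rule has_sum_finite_neutralI[where B = "{(m, 0)}"]) (auto simp: lattice_row_def)
    have H: "?H summable_on strip M"
      unfolding strip_eq_Sigma
    proof (rule summable_on_finite_Sigma)
      fix m show "(\<lambda>b. ?H (m, b)) summable_on UNIV"
        using has_sum_imp_summable[OF row[of m]]
        by (simp add: row_eq_image summable_on_reindex[OF inj_Pair_UNIV] o_def)
    qed simp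
    have "(\<Sum>\<^sub>\<infinity>p\<in>strip M. ?H p * truncated_pair r n i (fst p + M) (M - fst p))
       = (\<Sum>m\<in>{-M<..<M}. truncated_pair r n i (m + M) (M - m) * infsum ?H (lattice_row m))"
      by (rule infsum_strip_row_factor[OF H])
    also have "\<dots> = (if n i = 1 then \<Sum>m\<in>{-M<..<M}. truncated_pair r n i (m + M) (M - m) else 0)"
      by (auto simp: infsumI[OF row])
    finally have rows: "(\<Sum>\<^sub>\<infinity>p\<in>strip M. ?H p * truncated_pair r n i (fst p + M) (M - fst p))
       = (if n i = 1 then \<Sum>m\<in>{-M<..<M}. truncated_pair r n i (m + M) (M - m) else 0)" .
    have "((\<lambda>ps. pole_coeff r k n i * ?H (ps ! (i - 1)) * chain_term r n i ps) has_sum ?V i n) ?C"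
      using pole_sum_has_sum[OF i, of k, OF k H, of n] unfolding rows .
    also have "?this \<longleftrightarrow> (?f i n has_sum ?V i n) (?Q i)"
      by (rule has_sum_cong_neutral) auto
    finally have moved: "((\<lambda>ps. ?f i n (map (\<lambda>q. q - (0, snd (ps ! (i - 1)))) ps)) has_sum ?V i n) ?first"
      by (rule has_sum_reindex_bij_betw[OF translate_chain_bij[OF i], of "?f i n", THEN iffD2])
    have "?f i n (map (\<lambda>q. q - (0, snd (ps ! (i - 1)))) ps) = ?f i n ps" if "ps \<in> ?first" for ps
      using chain_term_translate[of ps r i n] that i by (simp add: chain_lists_def)
    from has_sum_cong[OF this, THEN iffD1, OF _ moved] show ?thesis by blast
  qed
  have total: "((\<lambda>ps. \<Sum>i=1..r. \<Sum>n\<in>?N. ?f i n ps) has_sum (\<Sum>i=1..r. \<Sum>n\<in>?N. ?V i n)) ?first"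
    by (intro has_sum_finite_sum finite_compositions finite_atLeastAtMost f)
  have "(\<Sum>i=1..r. \<Sum>n\<in>?N. ?f i n ps) = 0" if ps: "ps \<in> ?first" for ps
  proof -
    have K: "sum k {1..r} \<ge> 2"
      using k[of 1] r member_le_sum[of 1 "{1..r}" k] by simp
    have "(\<Sum>i=1..r. \<Sum>n\<in>?N. ?f i n ps)
       = (\<Sum>i\<in>{1..r}. expansion_pairing {1..r} (\<lambda>j. lat (ps ! (j - 1))) k i ?e)"
      using ps by (intro sum.cong[OF refl] expansion_pairing_chain[where k = k, OF _ _ k, symmetric]) auto
    also have "\<dots> = 0"
      using ps by (intro sum_expansion_pairing_1[OF _ chain_inj K]) auto
    finally show ?thesis .
  qed
  from has_sum_cong[OF this, THEN iffD1, OF _ total]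
  have "((\<lambda>_. 0) has_sum (\<Sum>i=1..r. \<Sum>n\<in>?N. ?V i n)) ?first" by blast
  then show ?thesis using has_sum_unique has_sum_0_simp by blast
qed

text \<open>There are fewer than 2 M rows, and the truncated coefficients are convolutions of convergent
sequences. So their sum divided by 2 M tends to the limit coefficient, although it is always 0.\<close>

theorem residues_cancel:
  assumes r: "r \<ge> 1" and k: "\<And>j. j \<in> {1..r} \<Longrightarrow> k j \<ge> 2"
  shows "(\<Sum>i=1..r. \<Sum>n\<in>compositions {1..r} (sum k {1..r}).
     if n i = 1 then signed_coeff r k n i * multi_G_pair r n i else 0) = 0"
proof -
  let ?N = "compositions {1..r} (sum k {1..r})"
  let ?S = "\<lambda>M i n. \<Sum>m\<in>{-int M<..<int M}. truncated_pair r n i (m + int M) (int M - m)"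
  have lim: "(\<lambda>M. ?S M i n / of_nat (2 * M)) \<longlonglongrightarrow> multi_G_pair r n i"
    if i: "i \<in> {1..r}" and n: "\<And>j. j \<in> {1..r} - {i} \<Longrightarrow> n j \<ge> 2" for i n
  proof -
    note ge = split_indices_ge_2[of i r n, OF i n]
    let ?p = "\<lambda>A. truncated_G (int A) (map n (rev [1..<i]))" and ?q = "\<lambda>A. truncated_G (int A) (map n [i+1..<r+1])"
    have "?p \<longlonglongrightarrow> multi_G (map n (rev [1..<i])) \<tau>" using ge(1) by (rule truncated_G_tendsto)
    moreover have "?q \<longlonglongrightarrow> multi_G (map n [i+1..<r+1]) \<tau>" using ge(2) by (rule truncated_G_tendsto)
    ultimately have "(\<lambda>L. (\<Sum>A\<in>{0<..<L}. ?p A * ?q (L - A)) / of_nat L) \<longlonglongrightarrow> multi_G_pair r n i"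
      unfolding multi_G_pair_def by (rule cesaro_convolution)
    moreover have "strict_mono (\<lambda>M :: nat. 2 * M)" by (simp add: strict_mono_def)
    ultimately have "((\<lambda>L. (\<Sum>A\<in>{0<..<L}. ?p A * ?q (L - A)) / of_nat L) \<circ> (\<lambda>M. 2 * M)) \<longlonglongrightarrow> multi_G_pair r n i"
      by (rule LIMSEQ_subseq_LIMSEQ)
    moreover have "(\<Sum>A\<in>{0<..<2 * M}. ?p A * ?q (2 * M - A)) = ?S M i n" for M
      unfolding truncated_pair_def
      by (rule sum.reindex_bij_witness[of _ "\<lambda>m. nat (m + int M)" "\<lambda>A. int A - int M"])
        (auto simp: of_nat_diff algebra_simps)
    ultimately show ?thesis by (simp add: o_def)
  qed
  have "(\<lambda>M. \<Sum>i=1..r. \<Sum>n\<in>?N. signed_coeff r k n i * (if n i = 1 then ?S M i n / of_nat (2 * M) else 0))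
     \<longlonglongrightarrow> (\<Sum>i=1..r. \<Sum>n\<in>?N. signed_coeff r k n i * (if n i = 1 then multi_G_pair r n i else 0))"
  proof (intro tendsto_sum)
    fix i n assume i: "i \<in> {1..r}"
    show "(\<lambda>M. signed_coeff r k n i * (if n i = 1 then ?S M i n / of_nat (2 * M) else 0))
      \<longlonglongrightarrow> signed_coeff r k n i * (if n i = 1 then multi_G_pair r n i else 0)"
    proof (cases "signed_coeff r k n i = 0")
      case False
      have "n j \<ge> 2" if "j \<in> {1..r} - {i}" for j using False k that by (rule signed_coeff_nonzero)
      from tendsto_mult[OF tendsto_const lim[OF i this]] show ?thesis by simp
    qed simp
  qed
  moreover have "(\<Sum>i=1..r. \<Sum>n\<in>?N. signed_coeff r k n i * (if n i = 1 then ?S M i n / of_nat (2 * M) else 0)) = 0" for M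
  proof -
    have "(\<Sum>i=1..r. \<Sum>n\<in>?N. signed_coeff r k n i * (if n i = 1 then ?S M i n / of_nat (2 * M) else 0))
       = (\<Sum>i=1..r. \<Sum>n\<in>?N. signed_coeff r k n i * (if n i = 1 then ?S M i n else 0)) / of_nat (2 * M)"
    proof -
      have "signed_coeff r k n i * (if n i = 1 then ?S M i n / of_nat (2 * M) else 0)
        = signed_coeff r k n i * (if n i = 1 then ?S M i n else 0) / of_nat (2 * M)" for i n by simp
      then show ?thesis by (simp only: sum_divide_distrib[symmetric])
    qed
    also have "\<dots> = 0" using residues_cancel_truncated[of r k "int M", OF r k] by simp
    finally show ?thesis .
  qed
  ultimately have "(\<lambda>_ :: nat. 0) \<longlonglongrightarrow> (\<Sum>i=1..r. \<Sum>n\<in>?N. signed_coeff r k n i * (if n i = 1 then multi_G_pair r n i else 0))"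
    by simp
  from LIMSEQ_unique[OF tendsto_const this]
  have "(\<Sum>i=1..r. \<Sum>n\<in>?N. signed_coeff r k n i * (if n i = 1 then multi_G_pair r n i else 0)) = 0" ..
  moreover have "signed_coeff r k n i * (if n i = 1 then multi_G_pair r n i else 0)
      = (if n i = 1 then signed_coeff r k n i * multi_G_pair r n i else 0)" for i n by simp
  ultimately show ?thesis by (simp only:)
qed

text \<open>By reflection in 0, the sum of the (- w)^(- n) over a strip is 1 + (-1)^n times a truncated multiple
Eisenstein series of length 1. Hence it converges, and it is unchanged by the factor (-1)^n that turns it
into the sum of the w^(- n). So both parts of the regularized sum have limits of their own.\<close>

lemma regularized_pole_sum_eq:
  assumes z: "z \<notin> range lat" and n: "n \<ge> 2"
  shows "regularized_pole_sum z n = multi_wp [n] z \<tau> - Eisenstein_G n \<tau>"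
proof -
  let ?V = "\<lambda>M. chain_sum (\<lambda>p. 0 - lat p) (strip (int M)) [n]"
  let ?W = "\<lambda>M. chain_sum (\<lambda>p. z - lat p) (strip (int M)) [n]"
  let ?g = "multi_G [n] \<tau>"
  have V: "?V M = (1 + (-1) ^ n) * truncated_G (int M) [n]" if "M \<ge> 1" for M
  proof -
    have "?V M = (\<Sum>i\<le>length [n]. truncated_G (int M) (rev (take i [n]))
        * ((-1) ^ sum_list (drop i [n]) * truncated_G (int M) (drop i [n])))"
      by (rule chain_sum_at_0) (use that n in auto)
    then show ?thesis by (simp add: distrib_right)
  qed
  have "(\<lambda>M. (1 + (-1) ^ n) * truncated_G (int M) [n]) \<longlonglongrightarrow> (1 + (-1) ^ n) * ?g"
    using n by (intro tendsto_mult tendsto_const truncated_G_tendsto) simp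
  moreover have "\<forall>\<^sub>F M in sequentially. (1 + (-1) ^ n) * truncated_G (int M) [n] = ?V M"
    using eventually_ge_at_top[of 1] by eventually_elim (rule V[symmetric])
  ultimately have limV: "?V \<longlonglongrightarrow> (1 + (-1) ^ n) * ?g" by (rule Lim_transform_eventually)
  have E: "(\<Sum>\<^sub>\<infinity>p\<in>strip (int M). 1 / lat p ^ n) = (-1) ^ n * ?V M" for M
  proof -
    have "1 / lat p ^ n = (-1) ^ n * (1 / (0 - lat p) ^ n)" for p
      by (cases "even n") (simp_all add: power_minus_odd)
    then show ?thesis by (simp only: chain_sum_single infsum_cmult_right')
  qed
  have "(\<lambda>M. (-1) ^ n * ?V M) \<longlonglongrightarrow> (-1) ^ n * ((1 + (-1) ^ n) * ?g)"
    by (intro tendsto_mult tendsto_const limV)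
  then have "Eisenstein_G n \<tau> = (-1) ^ n * ((1 + (-1) ^ n) * ?g)"
    unfolding Eisenstein_G_eq_lim[OF n] E by (rule limI)
  then have EG: "Eisenstein_G n \<tau> = (1 + (-1) ^ n) * ?g" by (cases "even n") simp_all
  have "(\<lambda>M. \<Sum>m\<in>{-int M<..<int M}. 1 * infsum (regularized_pole z n) (lattice_row m)) \<longlonglongrightarrow> 1 * regularized_pole_sum z n"
    unfolding regularized_pole_sum_def
    by (rule dominated_symmetric_sum[OF regularized_pole_summable(2)[OF z], where B = 1]) auto
  moreover have "(\<Sum>m\<in>{-int M<..<int M}. 1 * infsum (regularized_pole z n) (lattice_row m)) = ?W M - ?V M" for M
  proof -
    have "(\<Sum>m\<in>{-int M<..<int M}. 1 * infsum (regularized_pole z n) (lattice_row m)) = infsum (regularized_pole z n) (strip (int M))"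
      using infsum_strip[OF regularized_pole_summable(1)[OF z]] by simp
    also have "\<dots> = ?W M - ?V M"
    proof -
      have "regularized_pole z n = (\<lambda>p. 1 / (z - lat p) ^ n + - (1 / (0 - lat p) ^ n))"
        using n by (simp add: regularized_pole_def polar_difference_def polar_def fun_eq_iff)
      moreover have "((\<lambda>p. 1 / (z - lat p) ^ n + - (1 / (0 - lat p) ^ n)) has_sum ?W M + - ?V M) (strip (int M))"
        unfolding chain_sum_single
        by (intro has_sum_add has_sum_uminusI has_sum_infsum strip_summable[OF n order_refl])
      ultimately show ?thesis using infsumI by fastforce
    qed
    finally show ?thesis .
  qed
  ultimately have "(\<lambda>M. ?W M - ?V M) \<longlonglongrightarrow> regularized_pole_sum z n" by simp
  from tendsto_add[OF this limV] have "?W \<longlonglongrightarrow> regularized_pole_sum z n + (1 + (-1) ^ n) * ?g" by simp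
  then have "multi_wp [n] z \<tau> = regularized_pole_sum z n + (1 + (-1) ^ n) * ?g"
    using n by (subst multi_wp_eq_lim) (auto intro: limI)
  then show ?thesis by (simp add: EG)
qed

theorem multi_wp_expansion:
  assumes z: "z \<notin> range lat" and r: "r \<ge> 1" and k: "\<And>j. j \<in> {1..r} \<Longrightarrow> k j \<ge> 2"
  shows "multi_wp (map k [1..<r+1]) z \<tau>
    = (\<Sum>i=0..r. (-1) ^ (\<Sum>j=i+1..r. k j) * multi_G (map k (rev [1..<i+1])) \<tau> * multi_G (map k [i+1..<r+1]) \<tau>)
      + (\<Sum>i=1..r. \<Sum>n\<in>compositions {1..r} (sum k {1..r}).
           signed_coeff r k n i * multi_G_pair r n i * regularized_pole_sum z (n i))"
proof -
  let ?ks = "map k [1..<r+1]" and ?N = "compositions {1..r} (sum k {1..r})"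
  have k': "l \<ge> 2" if "l \<in> set (map k [a..<b])" "1 \<le> a" "b \<le> r + 1" for l a b
  proof -
    from that obtain j where "l = k j" "j \<in> {a..<b}" by (auto simp del: upt_Suc)
    then show ?thesis using k[of j] that by simp
  qed
  have ks: "l \<ge> 2" if "l \<in> set ?ks" for l using k'[OF that] by simp
  let ?T = "\<lambda>M. \<Sum>i=0..r. truncated_G (int M) (map k (rev [1..<i+1]))
       * ((-1) ^ (\<Sum>j=i+1..r. k j) * truncated_G (int M) (map k [i+1..<r+1]))"
  have at_0: "chain_sum (\<lambda>p. 0 - lat p) (strip (int M)) ?ks = ?T M" if "M \<ge> 1" for M
  proof -
    have eqs: "rev (take i ?ks) = map k (rev [1..<i+1])" "drop i ?ks = map k [i+1..<r+1]"
      "sum_list (drop i ?ks) = (\<Sum>j=i+1..r. k j)" if "i \<le> r" for i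
      using that by (simp_all add: take_map drop_map take_upt drop_upt rev_map
          sum_list_distinct_conv_sum_set atLeastLessThanSuc_atLeastAtMost del: upt_Suc)
    have len: "length ?ks = r" by simp
    have "int M \<ge> 1" using that by simp
    from chain_sum_at_0[OF this, of ?ks, OF ks, unfolded len]
    have "chain_sum (\<lambda>p. 0 - lat p) (strip (int M)) ?ks = (\<Sum>i\<le>r. truncated_G (int M) (rev (take i ?ks))
       * ((-1) ^ sum_list (drop i ?ks) * truncated_G (int M) (drop i ?ks)))" .
    also have "\<dots> = ?T M"
      unfolding atLeast0AtMost
    proof (rule sum.cong[OF refl])
      fix i assume "i \<in> {..r}"
      then have "i \<le> r" by simp
      show "truncated_G (int M) (rev (take i ?ks))
         * ((-1) ^ sum_list (drop i ?ks) * truncated_G (int M) (drop i ?ks))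
         = truncated_G (int M) (map k (rev [1..<i+1]))
         * ((-1) ^ (\<Sum>j=i+1..r. k j) * truncated_G (int M) (map k [i+1..<r+1]))"
        unfolding eqs(3)[OF \<open>i \<le> r\<close>] unfolding eqs(1,2)[OF \<open>i \<le> r\<close>] by (rule refl)
    qed
    finally show ?thesis .
  qed
  have "?T \<longlonglongrightarrow> (\<Sum>i=0..r. multi_G (map k (rev [1..<i+1])) \<tau>
       * ((-1) ^ (\<Sum>j=i+1..r. k j) * multi_G (map k [i+1..<r+1]) \<tau>))"
  proof (intro tendsto_sum tendsto_mult tendsto_const truncated_G_tendsto)
    fix i l assume i: "i \<in> {0..r}"
    show "2 \<le> l" if "l \<in> set (map k (rev [1..<i+1]))"
      using k'[of l 1 "i+1"] that i by (simp del: upt_Suc)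
    show "2 \<le> l" if "l \<in> set (map k [i+1..<r+1])"
      using k'[of l "i+1" "r+1"] that i by (simp del: upt_Suc)
  qed
  moreover have "\<forall>\<^sub>F M in sequentially. ?T M = chain_sum (\<lambda>p. 0 - lat p) (strip (int M)) ?ks"
    using eventually_ge_at_top[of 1] by eventually_elim (simp only: at_0)
  ultimately have lim0: "(\<lambda>M. chain_sum (\<lambda>p. 0 - lat p) (strip (int M)) ?ks) \<longlonglongrightarrow>
     (\<Sum>i=0..r. multi_G (map k (rev [1..<i+1])) \<tau> * ((-1) ^ (\<Sum>j=i+1..r. k j) * multi_G (map k [i+1..<r+1]) \<tau>))"
    by (rule Lim_transform_eventually)
  have "(\<lambda>M. \<Sum>i=1..r. \<Sum>n\<in>?N. signed_coeff r k n i * (\<Sum>m\<in>{-int M<..<int M}.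
       truncated_pair r n i (m + int M) (int M - m) * infsum (regularized_pole z (n i)) (lattice_row m)))
     \<longlonglongrightarrow> (\<Sum>i=1..r. \<Sum>n\<in>?N. signed_coeff r k n i * (multi_G_pair r n i * regularized_pole_sum z (n i)))"
  proof (intro tendsto_sum)
    fix i n assume i: "i \<in> {1..r}"
    show "(\<lambda>M. signed_coeff r k n i * (\<Sum>m\<in>{-int M<..<int M}.
       truncated_pair r n i (m + int M) (int M - m) * infsum (regularized_pole z (n i)) (lattice_row m)))
     \<longlonglongrightarrow> signed_coeff r k n i * (multi_G_pair r n i * regularized_pole_sum z (n i))"
    proof (cases "signed_coeff r k n i = 0")
      case False
      have "n j \<ge> 2" if "j \<in> {1..r} - {i}" for j using False k that by (rule signed_coeff_nonzero)
      then show ?thesis unfolding regularized_pole_sum_def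
        by (intro tendsto_mult tendsto_const truncated_pair_weighted_tendsto[OF i] regularized_pole_summable(2)[OF z])
    qed simp
  qed
  from tendsto_add[OF lim0 this]
  have "(\<lambda>M. chain_sum (\<lambda>p. z - lat p) (strip (int M)) ?ks) \<longlonglongrightarrow>
     (\<Sum>i=0..r. multi_G (map k (rev [1..<i+1])) \<tau> * ((-1) ^ (\<Sum>j=i+1..r. k j) * multi_G (map k [i+1..<r+1]) \<tau>))
     + (\<Sum>i=1..r. \<Sum>n\<in>?N. signed_coeff r k n i * (multi_G_pair r n i * regularized_pole_sum z (n i)))"
    by (simp only: chain_sum_expansion[OF z r k])
  then have "lim (\<lambda>M. chain_sum (\<lambda>p. z - lat p) (strip (int M)) ?ks) =
     (\<Sum>i=0..r. multi_G (map k (rev [1..<i+1])) \<tau> * ((-1) ^ (\<Sum>j=i+1..r. k j) * multi_G (map k [i+1..<r+1]) \<tau>))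
     + (\<Sum>i=1..r. \<Sum>n\<in>?N. signed_coeff r k n i * (multi_G_pair r n i * regularized_pole_sum z (n i)))"
    by (rule limI)
  moreover have "multi_wp ?ks z \<tau> = lim (\<lambda>M. chain_sum (\<lambda>p. z - lat p) (strip (int M)) ?ks)"
    using ks by (rule multi_wp_eq_lim)
  ultimately show ?thesis by (simp only: mult.assoc mult.left_commute)
qed

end

theorem theorem1p1:
  fixes \<tau> z :: complex and r K :: nat and k :: "nat \<Rightarrow> nat"
  assumes "Im \<tau> > 0"
    and "r \<ge> 1"
    and "\<And>j. j \<in> {1..r} \<Longrightarrow> k j \<ge> 2"
    and "(\<Sum>j=1..r. k j) = K"
    and "z \<notin> period_lattice \<tau>"
  shows "multi_wp (map k [1..<r+1]) z \<tau> =
      (\<Sum>i=1..r. \<Sum>n | n \<in> {1..r} \<rightarrow>\<^sub>E {2..} \<and> (\<Sum>j=1..r. n j) = K.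
          (-1) ^ (k i + (\<Sum>j=i..r. n j)) * binom_prod r k n i *
          multi_G (map n (rev [1..<i])) \<tau> * multi_G (map n [i+1..<r+1]) \<tau> *
          (multi_wp [n i] z \<tau> - Eisenstein_G (n i) \<tau>))
    + (\<Sum>i=1..r. \<Sum>n | n \<in> {1..r} \<rightarrow>\<^sub>E {0..} \<and> (\<Sum>j=1..r. n j) = K \<and> n i = 0.
          (-1) ^ (k i + (\<Sum>j=i+1..r. n j)) * binom_prod r k n i *
          multi_G (map n (rev [1..<i])) \<tau> * multi_G (map n [i+1..<r+1]) \<tau>)
    + (\<Sum>i=0..r. (-1) ^ (\<Sum>j=i+1..r. k j) *
          multi_G (map k (rev [1..<i+1])) \<tau> * multi_G (map k [i+1..<r+1]) \<tau>)"
proof -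
  interpret upper_half_plane \<tau> by standard fact
  have z: "z \<notin> range lat" using assms(5) by (simp add: period_lattice_eq)
  note r = assms(2) and k = assms(3)
  let ?N = "compositions {1..r} K"
  let ?c = "\<lambda>n i. signed_coeff r k n i * multi_G_pair r n i"
  have fin: "finite ?N" by (rule finite_compositions) simp
  have A: "(\<Sum>n | n \<in> {1..r} \<rightarrow>\<^sub>E {2..} \<and> (\<Sum>j=1..r. n j) = K.
          (-1) ^ (k i + (\<Sum>j=i..r. n j)) * binom_prod r k n i *
          multi_G (map n (rev [1..<i])) \<tau> * multi_G (map n [i+1..<r+1]) \<tau> *
          (multi_wp [n i] z \<tau> - Eisenstein_G (n i) \<tau>))
     = (\<Sum>n\<in>?N. if n i \<ge> 2 then ?c n i * regularized_pole_sum z (n i) else 0)" if i: "i \<in> {1..r}" for i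
  proof (rule sum.mono_neutral_cong_left[OF fin])
    show "{n. n \<in> {1..r} \<rightarrow>\<^sub>E {2..} \<and> (\<Sum>j=1..r. n j) = K} \<subseteq> ?N"
      by (auto simp: compositions_def PiE_iff)
    show "\<forall>n\<in>?N - {n. n \<in> {1..r} \<rightarrow>\<^sub>E {2..} \<and> (\<Sum>j=1..r. n j) = K}.
       (if n i \<ge> 2 then ?c n i * regularized_pole_sum z (n i) else 0) = 0"
    proof
      fix n assume n: "n \<in> ?N - {n. n \<in> {1..r} \<rightarrow>\<^sub>E {2..} \<and> (\<Sum>j=1..r. n j) = K}"
      then obtain j where j: "j \<in> {1..r}" "n j < 2" by (auto simp: compositions_def PiE_iff not_le)
      show "(if n i \<ge> 2 then ?c n i * regularized_pole_sum z (n i) else 0) = 0"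
      proof (cases "i = j")
        case False
        have "signed_coeff r k n i = 0"
        proof (rule ccontr)
          assume "signed_coeff r k n i \<noteq> 0"
          from signed_coeff_nonzero[OF this k, of j] show False using j False by auto
        qed
        then show ?thesis by simp
      qed (use j in simp)
    qed
    fix n assume n: "n \<in> {n. n \<in> {1..r} \<rightarrow>\<^sub>E {2..} \<and> (\<Sum>j=1..r. n j) = K}"
    then have ni: "n i \<ge> 2" using i by (auto simp: PiE_iff)
    have "(\<Sum>j=i..r. n j) = n i + (\<Sum>j=i+1..r. n j)" using i by (simp add: sum.atLeast_Suc_atMost)
    then show "(-1) ^ (k i + (\<Sum>j=i..r. n j)) * binom_prod r k n i *
          multi_G (map n (rev [1..<i])) \<tau> * multi_G (map n [i+1..<r+1]) \<tau> *
          (multi_wp [n i] z \<tau> - Eisenstein_G (n i) \<tau>)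
        = (if n i \<ge> 2 then ?c n i * regularized_pole_sum z (n i) else 0)"
      using ni by (simp add: regularized_pole_sum_eq[OF z] signed_coeff_def pole_coeff_def multi_G_pair_def power_add mult_ac del: upt_Suc)
  qed
  have B: "(\<Sum>n | n \<in> {1..r} \<rightarrow>\<^sub>E {0..} \<and> (\<Sum>j=1..r. n j) = K \<and> n i = 0.
          (-1) ^ (k i + (\<Sum>j=i+1..r. n j)) * binom_prod r k n i *
          multi_G (map n (rev [1..<i])) \<tau> * multi_G (map n [i+1..<r+1]) \<tau>)
     = (\<Sum>n\<in>?N. if n i = 0 then ?c n i * regularized_pole_sum z (n i) else 0)" for i
  proof (rule sum.mono_neutral_cong_left[OF fin])
    show "{n. n \<in> {1..r} \<rightarrow>\<^sub>E {0..} \<and> (\<Sum>j=1..r. n j) = K \<and> n i = 0} \<subseteq> ?N"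
      by (auto simp: compositions_def)
    show "\<forall>n\<in>?N - {n. n \<in> {1..r} \<rightarrow>\<^sub>E {0..} \<and> (\<Sum>j=1..r. n j) = K \<and> n i = 0}.
       (if n i = 0 then ?c n i * regularized_pole_sum z (n i) else 0) = 0"
      by (auto simp: compositions_def)
    fix n assume "n \<in> {n. n \<in> {1..r} \<rightarrow>\<^sub>E {0..} \<and> (\<Sum>j=1..r. n j) = K \<and> n i = 0}"
    then have "n i = 0" by simp
    then show "(-1) ^ (k i + (\<Sum>j=i+1..r. n j)) * binom_prod r k n i *
          multi_G (map n (rev [1..<i])) \<tau> * multi_G (map n [i+1..<r+1]) \<tau>
        = (if n i = 0 then ?c n i * regularized_pole_sum z (n i) else 0)"
      by (simp add: regularized_pole_sum_0 signed_coeff_def pole_coeff_def multi_G_pair_def power_add mult_ac del: upt_Suc)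
  qed
  have residue_zero: "(\<Sum>i=1..r. \<Sum>n\<in>?N. if n i = 1 then ?c n i else 0) = 0"
    using residues_cancel[of r k] r k by (simp only: assms(4))
  have "(\<Sum>i=1..r. \<Sum>n\<in>?N. if n i = 1 then ?c n i * regularized_pole_sum z (n i) else 0)
      = (\<Sum>i=1..r. \<Sum>n\<in>?N. if n i = 1 then ?c n i else 0) * regularized_pole_sum z 1"
    unfolding sum_distrib_right by (intro sum.cong refl) auto
  then have C: "(\<Sum>i=1..r. \<Sum>n\<in>?N. if n i = 1 then ?c n i * regularized_pole_sum z (n i) else 0) = 0"
    using residue_zero by (simp only: mult_zero_left)
  \<comment> \<open>The compositions with n i = 1 drop out, those with n i = 0 and n i \<ge> 2 form the first two sums.\<close>
  have split: "?c n i * regularized_pole_sum z (n i) = (if n i \<ge> 2 then ?c n i * regularized_pole_sum z (n i) else 0)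
      + (if n i = 0 then ?c n i * regularized_pole_sum z (n i) else 0)
      + (if n i = 1 then ?c n i * regularized_pole_sum z (n i) else 0)" for n i
    by (cases "n i" rule: nat_cases_0_1_Suc) auto
  have expansion: "multi_wp (map k [1..<r+1]) z \<tau>
    = (\<Sum>i=0..r. (-1) ^ (\<Sum>j=i+1..r. k j) * multi_G (map k (rev [1..<i+1])) \<tau> * multi_G (map k [i+1..<r+1]) \<tau>)
      + (\<Sum>i=1..r. \<Sum>n\<in>compositions {1..r} (sum k {1..r}). ?c n i * regularized_pole_sum z (n i))"
    using k by (rule multi_wp_expansion[OF z r])
  have "(\<Sum>i=1..r. \<Sum>n\<in>?N. ?c n i * regularized_pole_sum z (n i))
     = (\<Sum>i=1..r. \<Sum>n\<in>?N. if n i \<ge> 2 then ?c n i * regularized_pole_sum z (n i) else 0)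
     + (\<Sum>i=1..r. \<Sum>n\<in>?N. if n i = 0 then ?c n i * regularized_pole_sum z (n i) else 0)"
    by (subst split) (simp only: sum.distrib C add_0_right)
  also have "(\<Sum>i=1..r. \<Sum>n\<in>?N. if n i \<ge> 2 then ?c n i * regularized_pole_sum z (n i) else 0)
     = (\<Sum>i=1..r. \<Sum>n | n \<in> {1..r} \<rightarrow>\<^sub>E {2..} \<and> (\<Sum>j=1..r. n j) = K.
          (-1) ^ (k i + (\<Sum>j=i..r. n j)) * binom_prod r k n i *
          multi_G (map n (rev [1..<i])) \<tau> * multi_G (map n [i+1..<r+1]) \<tau> *
          (multi_wp [n i] z \<tau> - Eisenstein_G (n i) \<tau>))"
    by (rule sum.cong[OF refl A[symmetric]])
  also have "(\<Sum>i=1..r. \<Sum>n\<in>?N. if n i = 0 then ?c n i * regularized_pole_sum z (n i) else 0)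
     = (\<Sum>i=1..r. \<Sum>n | n \<in> {1..r} \<rightarrow>\<^sub>E {0..} \<and> (\<Sum>j=1..r. n j) = K \<and> n i = 0.
          (-1) ^ (k i + (\<Sum>j=i+1..r. n j)) * binom_prod r k n i *
          multi_G (map n (rev [1..<i])) \<tau> * multi_G (map n [i+1..<r+1]) \<tau>)"
    by (rule sum.cong[OF refl B[symmetric]])
  finally show ?thesis unfolding expansion assms(4) by (simp only: add.commute)
qed

end
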